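(* Define $\mathcal{DT}:\mathbf{ThMV}\to\mathbf{ThDMV'}$ as follows. On objects: $\mathcal{DT}(X,I)=(X,(I]_{DMV})$, where $(I]_{DMV}$ is the ideal of $DMV_X$ generated by $I$. On arrows: if $\sigma:(X,I)\to(Y,J)$ is an arrow in $\mathbf{ThMV}$, then $\mathcal{DT}(\sigma)$ is the unique morphism $\sigma_D:(X,(I]_{DMV})\to(Y,(J]_{DMV})$ such that $\sigma_D:DMV_X\to DMV_Y$ and $\sigma_D(x)=\sigma(x)$ for every $x\in X$. Then $\mathcal{DT}$ is a functor and it establishes a categorical equivalence between $\mathbf{ThMV}$ and $\mathbf{ThDMV'}$.
   Context: An MV-algebra is a structure $(A,\oplus,{}^*,0)$ with $(A,\oplus,0)$ an Abelian monoid, $x^{**}=x$, $(x^*\oplus y)^*\oplus y=(y^*\oplus x)^*\oplus x$, $0^*\oplus x=0^*$; $1=0^*$, $x\odot y=(x^*\oplus y^* )^*$; order: $x\le y$ iff $x^*\oplus y=1$. A DMV-algebra is an MV-algebra with unary operations $x\mapsto rx$, $r\in[0,1]\cap\mathbb Q$, satisfying $r(x\odot y^* )=(rx)\odot(ry)^*$, $(r\odot q^* )x=(rx)\odot(qx)^*$, $r(qx)=(rq)x$, $1x=x$ (where $r\odot q^*=\max(0,r-q)$ for numbers). An ideal of an MV-algebra is a nonempty downward closed subset closed under $\oplus$; ideals of a DMV-algebra are the ideals of its MV-reduct. For a set $X$, $MV_X$ and $DMV_X$ denote the free MV-algebra and the free DMV-algebra over $X$ (the Lindenbaum–Tarski algebras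 over the set $X$ of variables of Łukasiewicz logic and of its extension with rational scalar connectives). $MV_X$ is identified with an MV-subalgebra of $DMV_X$ via the embedding $\iota_X:MV_X\to DMV_X$ with $\iota_X(x)=x$ for $x\in X$. $\mathbf{ThMV}$: objects are pairs $(X,I)$ with $X$ a set and $I$ a finitely generated ideal of $MV_X$; arrows $\sigma:(X,I)\to(Y,J)$ are MV-homomorphisms $\sigma:MV_X\to MV_Y$ with $\sigma(I)\subseteq J$. $\mathbf{ThDMV}$ is defined in the same way with $DMV_X$ and DMV-homomorphisms in place of $MV_X$ and MV-homomorphisms. $\mathbf{ThDMV'}$ is the subcategory of $\mathbf{ThDMV}$ with the same objects, whose arrows are the arrows $\sigma:(X,I)\to(Y,J)$ of $\mathbf{ThDMV}$ with $\sigma(X)\subseteq MV_Y$. *)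

theory Defs
  imports Complex_Main "HOL-Algebra.Group"
begin

section \<open>MV-algebras and DMV-algebras\<close>

record 'b mv = "'b partial_object" +
  oplus :: "'b \<Rightarrow> 'b \<Rightarrow> 'b" (infixl \<open>\<oplus>\<index>\<close> 65)
  mvneg :: "'b \<Rightarrow> 'b" (\<open>\<sim>\<index>_\<close> [81] 80)
  mvzero :: "'b" (\<open>\<zero>\<index>\<close>)

definition mvone :: "('b, 'm) mv_scheme \<Rightarrow> 'b" (\<open>\<one>\<^sub>M\<index>\<close>) where
  "\<one>\<^sub>M\<^bsub>A\<^esub> = \<sim>\<^bsub>A\<^esub> \<zero>\<^bsub>A\<^esub>"

definition odot :: "('b, 'm) mv_scheme \<Rightarrow> 'b \<Rightarrow> 'b \<Rightarrow> 'b" (infixl \<open>\<odot>\<index>\<close> 70) where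
  "x \<odot>\<^bsub>A\<^esub> y = \<sim>\<^bsub>A\<^esub> (\<sim>\<^bsub>A\<^esub> x \<oplus>\<^bsub>A\<^esub> \<sim>\<^bsub>A\<^esub> y)"

definition mvle :: "('b, 'm) mv_scheme \<Rightarrow> 'b \<Rightarrow> 'b \<Rightarrow> bool" (infix \<open>\<preceq>\<index>\<close> 50) where
  "x \<preceq>\<^bsub>A\<^esub> y \<longleftrightarrow> \<sim>\<^bsub>A\<^esub> x \<oplus>\<^bsub>A\<^esub> y = \<one>\<^sub>M\<^bsub>A\<^esub>"

locale mv_algebra =
  fixes A :: "('b, 'm) mv_scheme" (structure)
  assumes oplus_monoid:
      "comm_monoid \<lparr>carrier = carrier A, monoid.mult = oplus A, one = mvzero A\<rparr>"
    and neg_closed: "x \<in> carrier A \<Longrightarrow> \<sim>x \<in> carrier A"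
    and neg_neg: "x \<in> carrier A \<Longrightarrow> \<sim>(\<sim>x) = x"
    and lukasiewicz: "\<lbrakk>x \<in> carrier A; y \<in> carrier A\<rbrakk> \<Longrightarrow>
      \<sim>(\<sim>x \<oplus> y) \<oplus> y = \<sim>(\<sim>y \<oplus> x) \<oplus> x"
    and one_oplus: "x \<in> carrier A \<Longrightarrow> \<sim>\<zero> \<oplus> x = \<sim>\<zero>"

record 'b dmv = "'b mv" +
  scal :: "rat \<Rightarrow> 'b \<Rightarrow> 'b"

text \<open>The values of \<^term>\<open>scal A r\<close> for \<open>r\<close> outside the unit interval are irrelevant.\<close>

locale dmv_algebra = mv_algebra A for A :: "('b, 'm) dmv_scheme" (structure) +
  assumes scal_closed: "\<lbrakk>r \<in> {0..1}; x \<in> carrier A\<rbrakk> \<Longrightarrow> scal A r x \<in> carrier A"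
    and scal_diff: "\<lbrakk>r \<in> {0..1}; x \<in> carrier A; y \<in> carrier A\<rbrakk> \<Longrightarrow>
      scal A r (x \<odot> \<sim>y) = scal A r x \<odot> \<sim>(scal A r y)"
    and diff_scal: "\<lbrakk>r \<in> {0..1}; q \<in> {0..1}; x \<in> carrier A\<rbrakk> \<Longrightarrow>
      scal A (max 0 (r - q)) x = scal A r x \<odot> \<sim>(scal A q x)"
    and scal_scal: "\<lbrakk>r \<in> {0..1}; q \<in> {0..1}; x \<in> carrier A\<rbrakk> \<Longrightarrow>
      scal A r (scal A q x) = scal A (r * q) x"
    and scal_one: "x \<in> carrier A \<Longrightarrow> scal A 1 x = x"

text \<open>Homomorphisms are extensional functions, so that equality of homomorphisms is
  equality on the carrier.  By record extension, \<open>mv_hom\<close> also applies to the MV-reducts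
  of DMV-algebras, and so do the notions concerning ideals below.\<close>

definition mv_hom :: "('b, 'm) mv_scheme \<Rightarrow> ('c, 'n) mv_scheme \<Rightarrow> ('b \<Rightarrow> 'c) set" where
  "mv_hom A B = {h \<in> carrier A \<rightarrow>\<^sub>E carrier B.
     h \<zero>\<^bsub>A\<^esub> = \<zero>\<^bsub>B\<^esub> \<and>
     (\<forall>x\<in>carrier A. h (\<sim>\<^bsub>A\<^esub> x) = \<sim>\<^bsub>B\<^esub> (h x)) \<and>
     (\<forall>x\<in>carrier A. \<forall>y\<in>carrier A. h (x \<oplus>\<^bsub>A\<^esub> y) = h x \<oplus>\<^bsub>B\<^esub> h y)}"

definition dmv_hom :: "('b, 'm) dmv_scheme \<Rightarrow> ('c, 'n) dmv_scheme \<Rightarrow> ('b \<Rightarrow> 'c) set" where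
  "dmv_hom A B = {h \<in> mv_hom A B.
     \<forall>r\<in>{0..1}. \<forall>x\<in>carrier A. h (scal A r x) = scal B r (h x)}"

definition mv_ideal :: "('b, 'm) mv_scheme \<Rightarrow> 'b set \<Rightarrow> bool" where
  "mv_ideal A I \<longleftrightarrow> I \<subseteq> carrier A \<and> I \<noteq> {} \<and>
     (\<forall>x\<in>carrier A. \<forall>y\<in>I. x \<preceq>\<^bsub>A\<^esub> y \<longrightarrow> x \<in> I) \<and>
     (\<forall>x\<in>I. \<forall>y\<in>I. x \<oplus>\<^bsub>A\<^esub> y \<in> I)"

definition ideal_gen :: "('b, 'm) mv_scheme \<Rightarrow> 'b set \<Rightarrow> 'b set" where
  "ideal_gen A S = \<Inter>{I. mv_ideal A I \<and> S \<subseteq> I}"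

definition fin_gen_ideal :: "('b, 'm) mv_scheme \<Rightarrow> 'b set \<Rightarrow> bool" where
  "fin_gen_ideal A I \<longleftrightarrow> (\<exists>F. finite F \<and> F \<subseteq> carrier A \<and> I = ideal_gen A F)"


section \<open>Free algebras\<close>

datatype 'v mv_term = MVar 'v | MZero | MNeg "'v mv_term" | MPlus "'v mv_term" "'v mv_term"

datatype 'v dmv_term = DVar 'v | DZero | DNeg "'v dmv_term"
  | DPlus "'v dmv_term" "'v dmv_term" | DScal rat "'v dmv_term"

inductive_set mv_terms :: "'v set \<Rightarrow> 'v mv_term set" for X where
  "x \<in> X \<Longrightarrow> MVar x \<in> mv_terms X"
| "MZero \<in> mv_terms X"
| "t \<in> mv_terms X \<Longrightarrow> MNeg t \<in> mv_terms X"
| "\<lbrakk>s \<in> mv_terms X; t \<in> mv_terms X\<rbrakk> \<Longrightarrow> MPlus s t \<in> mv_terms X"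

inductive_set dmv_terms :: "'v set \<Rightarrow> 'v dmv_term set" for X where
  "x \<in> X \<Longrightarrow> DVar x \<in> dmv_terms X"
| "DZero \<in> dmv_terms X"
| "t \<in> dmv_terms X \<Longrightarrow> DNeg t \<in> dmv_terms X"
| "\<lbrakk>s \<in> dmv_terms X; t \<in> dmv_terms X\<rbrakk> \<Longrightarrow> DPlus s t \<in> dmv_terms X"
| "\<lbrakk>r \<in> {0..1}; t \<in> dmv_terms X\<rbrakk> \<Longrightarrow> DScal r t \<in> dmv_terms X"

abbreviation DDiff :: "'v dmv_term \<Rightarrow> 'v dmv_term \<Rightarrow> 'v dmv_term" where
  "DDiff s t \<equiv> DNeg (DPlus (DNeg s) (DNeg (DNeg t)))"

text \<open>Provable equality of terms over \<open>X\<close>: the least congruence of the term algebra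
  containing all instances of the defining identities.\<close>

inductive_set mv_eq :: "'v set \<Rightarrow> ('v mv_term \<times> 'v mv_term) set" for X where
  refl: "t \<in> mv_terms X \<Longrightarrow> (t, t) \<in> mv_eq X"
| sym: "(s, t) \<in> mv_eq X \<Longrightarrow> (t, s) \<in> mv_eq X"
| trans: "\<lbrakk>(s, t) \<in> mv_eq X; (t, u) \<in> mv_eq X\<rbrakk> \<Longrightarrow> (s, u) \<in> mv_eq X"
| cong_neg: "(s, t) \<in> mv_eq X \<Longrightarrow> (MNeg s, MNeg t) \<in> mv_eq X"
| cong_plus: "\<lbrakk>(s, t) \<in> mv_eq X; (s', t') \<in> mv_eq X\<rbrakk> \<Longrightarrow> (MPlus s s', MPlus t t') \<in> mv_eq X"
| assoc: "\<lbrakk>s \<in> mv_terms X; t \<in> mv_terms X; u \<in> mv_terms X\<rbrakk> \<Longrightarrow>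
    (MPlus (MPlus s t) u, MPlus s (MPlus t u)) \<in> mv_eq X"
| comm: "\<lbrakk>s \<in> mv_terms X; t \<in> mv_terms X\<rbrakk> \<Longrightarrow> (MPlus s t, MPlus t s) \<in> mv_eq X"
| zero: "t \<in> mv_terms X \<Longrightarrow> (MPlus MZero t, t) \<in> mv_eq X"
| neg_neg: "t \<in> mv_terms X \<Longrightarrow> (MNeg (MNeg t), t) \<in> mv_eq X"
| lukasiewicz: "\<lbrakk>s \<in> mv_terms X; t \<in> mv_terms X\<rbrakk> \<Longrightarrow>
    (MPlus (MNeg (MPlus (MNeg s) t)) t, MPlus (MNeg (MPlus (MNeg t) s)) s) \<in> mv_eq X"
| one_plus: "t \<in> mv_terms X \<Longrightarrow> (MPlus (MNeg MZero) t, MNeg MZero) \<in> mv_eq X"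

inductive_set dmv_eq :: "'v set \<Rightarrow> ('v dmv_term \<times> 'v dmv_term) set" for X where
  refl: "t \<in> dmv_terms X \<Longrightarrow> (t, t) \<in> dmv_eq X"
| sym: "(s, t) \<in> dmv_eq X \<Longrightarrow> (t, s) \<in> dmv_eq X"
| trans: "\<lbrakk>(s, t) \<in> dmv_eq X; (t, u) \<in> dmv_eq X\<rbrakk> \<Longrightarrow> (s, u) \<in> dmv_eq X"
| cong_neg: "(s, t) \<in> dmv_eq X \<Longrightarrow> (DNeg s, DNeg t) \<in> dmv_eq X"
| cong_plus: "\<lbrakk>(s, t) \<in> dmv_eq X; (s', t') \<in> dmv_eq X\<rbrakk> \<Longrightarrow> (DPlus s s', DPlus t t') \<in> dmv_eq X"
| cong_scal: "\<lbrakk>r \<in> {0..1}; (s, t) \<in> dmv_eq X\<rbrakk> \<Longrightarrow> (DScal r s, DScal r t) \<in> dmv_eq X"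
| assoc: "\<lbrakk>s \<in> dmv_terms X; t \<in> dmv_terms X; u \<in> dmv_terms X\<rbrakk> \<Longrightarrow>
    (DPlus (DPlus s t) u, DPlus s (DPlus t u)) \<in> dmv_eq X"
| comm: "\<lbrakk>s \<in> dmv_terms X; t \<in> dmv_terms X\<rbrakk> \<Longrightarrow> (DPlus s t, DPlus t s) \<in> dmv_eq X"
| zero: "t \<in> dmv_terms X \<Longrightarrow> (DPlus DZero t, t) \<in> dmv_eq X"
| neg_neg: "t \<in> dmv_terms X \<Longrightarrow> (DNeg (DNeg t), t) \<in> dmv_eq X"
| lukasiewicz: "\<lbrakk>s \<in> dmv_terms X; t \<in> dmv_terms X\<rbrakk> \<Longrightarrow>
    (DPlus (DNeg (DPlus (DNeg s) t)) t, DPlus (DNeg (DPlus (DNeg t) s)) s) \<in> dmv_eq X"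
| one_plus: "t \<in> dmv_terms X \<Longrightarrow> (DPlus (DNeg DZero) t, DNeg DZero) \<in> dmv_eq X"
| scal_diff: "\<lbrakk>r \<in> {0..1}; s \<in> dmv_terms X; t \<in> dmv_terms X\<rbrakk> \<Longrightarrow>
    (DScal r (DDiff s t), DDiff (DScal r s) (DScal r t)) \<in> dmv_eq X"
| diff_scal: "\<lbrakk>r \<in> {0..1}; q \<in> {0..1}; t \<in> dmv_terms X\<rbrakk> \<Longrightarrow>
    (DScal (max 0 (r - q)) t, DDiff (DScal r t) (DScal q t)) \<in> dmv_eq X"
| scal_scal: "\<lbrakk>r \<in> {0..1}; q \<in> {0..1}; t \<in> dmv_terms X\<rbrakk> \<Longrightarrow>
    (DScal r (DScal q t), DScal (r * q) t) \<in> dmv_eq X"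
| scal_one: "t \<in> dmv_terms X \<Longrightarrow> (DScal 1 t, t) \<in> dmv_eq X"

definition MV :: "'v set \<Rightarrow> 'v mv_term set mv" where
  "MV X = \<lparr>carrier = mv_terms X // mv_eq X,
     oplus = (\<lambda>C D. \<Union>s\<in>C. \<Union>t\<in>D. mv_eq X `` {MPlus s t}),
     mvneg = (\<lambda>C. \<Union>s\<in>C. mv_eq X `` {MNeg s}),
     mvzero = mv_eq X `` {MZero}\<rparr>"

definition DMV :: "'v set \<Rightarrow> 'v dmv_term set dmv" where
  "DMV X = \<lparr>carrier = dmv_terms X // dmv_eq X,
     oplus = (\<lambda>C D. \<Union>s\<in>C. \<Union>t\<in>D. dmv_eq X `` {DPlus s t}),
     mvneg = (\<lambda>C. \<Union>s\<in>C. dmv_eq X `` {DNeg s}),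
     mvzero = dmv_eq X `` {DZero},
     scal = (\<lambda>r C. \<Union>s\<in>C. dmv_eq X `` {DScal r s})\<rparr>"

definition mv_gen :: "'v set \<Rightarrow> 'v \<Rightarrow> 'v mv_term set" where
  "mv_gen X x = mv_eq X `` {MVar x}"

definition dmv_gen :: "'v set \<Rightarrow> 'v \<Rightarrow> 'v dmv_term set" where
  "dmv_gen X x = dmv_eq X `` {DVar x}"

text \<open>The embedding through which \<open>MV X\<close> is regarded as a subalgebra of \<open>DMV X\<close>.\<close>

definition iota :: "'v set \<Rightarrow> 'v mv_term set \<Rightarrow> 'v dmv_term set" where
  "iota X = (THE h. h \<in> mv_hom (MV X) (DMV X) \<and> (\<forall>x\<in>X. h (mv_gen X x) = dmv_gen X x))"

subsection \<open>Universal properties\<close>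

lemma mv_eq_terms: "(s, t) \<in> mv_eq X \<Longrightarrow> s \<in> mv_terms X \<and> t \<in> mv_terms X"
  by (induction rule: mv_eq.induct) (auto intro!: mv_terms.intros)

lemma dmv_eq_terms: "(s, t) \<in> dmv_eq X \<Longrightarrow> s \<in> dmv_terms X \<and> t \<in> dmv_terms X"
  by (induction rule: dmv_eq.induct)
    (auto intro!: dmv_terms.intros mult_le_one)

lemma equiv_mv_eq: "equiv (mv_terms X) (mv_eq X)"
  by (rule equivI) (auto simp: refl_on_def sym_def trans_def dest: mv_eq_terms
      intro: mv_eq.refl mv_eq.sym mv_eq.trans)

lemma equiv_dmv_eq: "equiv (dmv_terms X) (dmv_eq X)"
  by (rule equivI) (auto simp: refl_on_def sym_def trans_def dest: dmv_eq_terms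
      intro: dmv_eq.refl dmv_eq.sym dmv_eq.trans)

lemma mv_class_eq: "(s, t) \<in> mv_eq X \<Longrightarrow> mv_eq X `` {s} = mv_eq X `` {t}"
  by (rule equiv_class_eq[OF equiv_mv_eq])

lemma dmv_class_eq: "(s, t) \<in> dmv_eq X \<Longrightarrow> dmv_eq X `` {s} = dmv_eq X `` {t}"
  by (rule equiv_class_eq[OF equiv_dmv_eq])

lemma MV_ops:
  shows "carrier (MV X) = mv_terms X // mv_eq X"
    and "mvzero (MV X) = mv_eq X `` {MZero}"
    and "s \<in> mv_terms X \<Longrightarrow> mvneg (MV X) (mv_eq X `` {s}) = mv_eq X `` {MNeg s}"
    and "\<lbrakk>s \<in> mv_terms X; t \<in> mv_terms X\<rbrakk> \<Longrightarrow>
      oplus (MV X) (mv_eq X `` {s}) (mv_eq X `` {t}) = mv_eq X `` {MPlus s t}"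
proof -
  have self: "u \<in> mv_eq X `` {u}" if "u \<in> mv_terms X" for u
    using that by (simp add: mv_eq.refl)
  show "carrier (MV X) = mv_terms X // mv_eq X" "mvzero (MV X) = mv_eq X `` {MZero}"
    by (simp_all add: MV_def)
  show "mvneg (MV X) (mv_eq X `` {s}) = mv_eq X `` {MNeg s}" if "s \<in> mv_terms X"
    unfolding MV_def mv.simps
    by (intro UN_constant_eq[OF self] ballI that mv_class_eq[symmetric] mv_eq.cong_neg) simp
  show "oplus (MV X) (mv_eq X `` {s}) (mv_eq X `` {t}) = mv_eq X `` {MPlus s t}"
    if "s \<in> mv_terms X" "t \<in> mv_terms X"
    unfolding MV_def mv.simps
    by (intro UN_constant_eq[OF self] ballI that mv_class_eq[symmetric] mv_eq.cong_plus) simp_all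
qed

lemma DMV_ops:
  shows "carrier (DMV X) = dmv_terms X // dmv_eq X"
    and "mvzero (DMV X) = dmv_eq X `` {DZero}"
    and "s \<in> dmv_terms X \<Longrightarrow> mvneg (DMV X) (dmv_eq X `` {s}) = dmv_eq X `` {DNeg s}"
    and "\<lbrakk>s \<in> dmv_terms X; t \<in> dmv_terms X\<rbrakk> \<Longrightarrow>
      oplus (DMV X) (dmv_eq X `` {s}) (dmv_eq X `` {t}) = dmv_eq X `` {DPlus s t}"
    and "\<lbrakk>r \<in> {0..1}; s \<in> dmv_terms X\<rbrakk> \<Longrightarrow>
      scal (DMV X) r (dmv_eq X `` {s}) = dmv_eq X `` {DScal r s}"
proof -
  have self: "u \<in> dmv_eq X `` {u}" if "u \<in> dmv_terms X" for u
    using that by (simp add: dmv_eq.refl)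
  show "carrier (DMV X) = dmv_terms X // dmv_eq X" "mvzero (DMV X) = dmv_eq X `` {DZero}"
    by (simp_all add: DMV_def)
  show "mvneg (DMV X) (dmv_eq X `` {s}) = dmv_eq X `` {DNeg s}" if "s \<in> dmv_terms X"
    unfolding DMV_def mv.simps
    by (intro UN_constant_eq[OF self] ballI that dmv_class_eq[symmetric] dmv_eq.cong_neg) simp
  show "oplus (DMV X) (dmv_eq X `` {s}) (dmv_eq X `` {t}) = dmv_eq X `` {DPlus s t}"
    if "s \<in> dmv_terms X" "t \<in> dmv_terms X"
    unfolding DMV_def mv.simps
    by (intro UN_constant_eq[OF self] ballI that dmv_class_eq[symmetric] dmv_eq.cong_plus) simp_all
  show "scal (DMV X) r (dmv_eq X `` {s}) = dmv_eq X `` {DScal r s}"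
    if "r \<in> {0..1}" "s \<in> dmv_terms X"
    unfolding DMV_def dmv.simps
    by (intro UN_constant_eq[OF self] ballI that dmv_class_eq[symmetric] dmv_eq.cong_scal) simp
qed

lemma MV_cases:
  assumes "C \<in> carrier (MV X)"
  obtains s where "s \<in> mv_terms X" "C = mv_eq X `` {s}"
  using assms by (auto simp: MV_ops elim: quotientE)

lemma DMV_cases:
  assumes "C \<in> carrier (DMV X)"
  obtains s where "s \<in> dmv_terms X" "C = dmv_eq X `` {s}"
  using assms by (auto simp: DMV_ops elim: quotientE)

lemma mv_algebra_MV: "mv_algebra (MV X)"
proof
  fix x y z
  let ?M = "\<lparr>carrier = carrier (MV X), monoid.mult = oplus (MV X), one = mvzero (MV X)\<rparr>"
  have cl: "mv_eq X `` {s} \<in> carrier (MV X)" if "s \<in> mv_terms X" for s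
    using that by (auto simp: MV_ops intro: quotientI)
  { assume x: "x \<in> carrier ?M"
    then obtain s where s: "s \<in> mv_terms X" "x = mv_eq X `` {s}" by (auto elim: MV_cases)
    show "\<one>\<^bsub>?M\<^esub> \<otimes>\<^bsub>?M\<^esub> x = x"
      using s by (auto simp: MV_ops mv_terms.intros intro!: mv_class_eq mv_eq.zero)
    show "x \<otimes>\<^bsub>?M\<^esub> \<one>\<^bsub>?M\<^esub> = x"
      using s by (auto simp: MV_ops mv_terms.intros intro!: mv_class_eq mv_eq.trans[OF mv_eq.comm mv_eq.zero])
    assume y: "y \<in> carrier ?M"
    then obtain t where t: "t \<in> mv_terms X" "y = mv_eq X `` {t}" by (auto elim: MV_cases)
    show "x \<otimes>\<^bsub>?M\<^esub> y \<in> carrier ?M"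
      using s t cl[of "MPlus s t"] by (auto simp: MV_ops mv_terms.intros)
    show "x \<otimes>\<^bsub>?M\<^esub> y = y \<otimes>\<^bsub>?M\<^esub> x"
      using s t by (auto simp: MV_ops mv_terms.intros intro!: mv_class_eq mv_eq.comm)
    assume z: "z \<in> carrier ?M"
    then obtain u where u: "u \<in> mv_terms X" "z = mv_eq X `` {u}" by (auto elim: MV_cases)
    show "x \<otimes>\<^bsub>?M\<^esub> y \<otimes>\<^bsub>?M\<^esub> z = x \<otimes>\<^bsub>?M\<^esub> (y \<otimes>\<^bsub>?M\<^esub> z)"
      using s t u by (auto simp: MV_ops mv_terms.intros intro!: mv_class_eq mv_eq.assoc) }
  show "\<one>\<^bsub>?M\<^esub> \<in> carrier ?M" using cl[of MZero] by (auto simp: MV_ops mv_terms.intros)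
  { assume x: "x \<in> carrier (MV X)"
    then obtain s where s: "s \<in> mv_terms X" "x = mv_eq X `` {s}" by (auto elim: MV_cases)
    show "\<sim>\<^bsub>MV X\<^esub> x \<in> carrier (MV X)" using s cl[of "MNeg s"] by (auto simp: MV_ops mv_terms.intros)
    show "\<sim>\<^bsub>MV X\<^esub> (\<sim>\<^bsub>MV X\<^esub> x) = x"
      using s by (auto simp: MV_ops mv_terms.intros intro!: mv_class_eq mv_eq.neg_neg)
    show "\<sim>\<^bsub>MV X\<^esub> \<zero>\<^bsub>MV X\<^esub> \<oplus>\<^bsub>MV X\<^esub> x = \<sim>\<^bsub>MV X\<^esub> \<zero>\<^bsub>MV X\<^esub>"
      using s by (auto simp: MV_ops mv_terms.intros intro!: mv_class_eq mv_eq.one_plus)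
    assume y: "y \<in> carrier (MV X)"
    then obtain t where t: "t \<in> mv_terms X" "y = mv_eq X `` {t}" by (auto elim: MV_cases)
    show "\<sim>\<^bsub>MV X\<^esub> (\<sim>\<^bsub>MV X\<^esub> x \<oplus>\<^bsub>MV X\<^esub> y) \<oplus>\<^bsub>MV X\<^esub> y = \<sim>\<^bsub>MV X\<^esub> (\<sim>\<^bsub>MV X\<^esub> y \<oplus>\<^bsub>MV X\<^esub> x) \<oplus>\<^bsub>MV X\<^esub> x"
      using s t by (auto simp: MV_ops mv_terms.intros intro!: mv_class_eq mv_eq.lukasiewicz) }
qed

lemma mv_algebra_DMV: "mv_algebra (DMV X)"
proof
  fix x y z
  let ?M = "\<lparr>carrier = carrier (DMV X), monoid.mult = oplus (DMV X), one = mvzero (DMV X)\<rparr>"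
  have cl: "dmv_eq X `` {s} \<in> carrier (DMV X)" if "s \<in> dmv_terms X" for s
    using that by (auto simp: DMV_ops intro: quotientI)
  { assume x: "x \<in> carrier ?M"
    then obtain s where s: "s \<in> dmv_terms X" "x = dmv_eq X `` {s}" by (auto elim: DMV_cases)
    show "\<one>\<^bsub>?M\<^esub> \<otimes>\<^bsub>?M\<^esub> x = x"
      using s by (auto simp: DMV_ops dmv_terms.intros intro!: dmv_class_eq dmv_eq.zero)
    show "x \<otimes>\<^bsub>?M\<^esub> \<one>\<^bsub>?M\<^esub> = x"
      using s by (auto simp: DMV_ops dmv_terms.intros intro!: dmv_class_eq dmv_eq.trans[OF dmv_eq.comm dmv_eq.zero])
    assume y: "y \<in> carrier ?M"
    then obtain t where t: "t \<in> dmv_terms X" "y = dmv_eq X `` {t}" by (auto elim: DMV_cases)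
    show "x \<otimes>\<^bsub>?M\<^esub> y \<in> carrier ?M"
      using s t cl[of "DPlus s t"] by (auto simp: DMV_ops dmv_terms.intros)
    show "x \<otimes>\<^bsub>?M\<^esub> y = y \<otimes>\<^bsub>?M\<^esub> x"
      using s t by (auto simp: DMV_ops dmv_terms.intros intro!: dmv_class_eq dmv_eq.comm)
    assume z: "z \<in> carrier ?M"
    then obtain u where u: "u \<in> dmv_terms X" "z = dmv_eq X `` {u}" by (auto elim: DMV_cases)
    show "x \<otimes>\<^bsub>?M\<^esub> y \<otimes>\<^bsub>?M\<^esub> z = x \<otimes>\<^bsub>?M\<^esub> (y \<otimes>\<^bsub>?M\<^esub> z)"
      using s t u by (auto simp: DMV_ops dmv_terms.intros intro!: dmv_class_eq dmv_eq.assoc) }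
  show "\<one>\<^bsub>?M\<^esub> \<in> carrier ?M" using cl[of DZero] by (auto simp: DMV_ops dmv_terms.intros)
  { assume x: "x \<in> carrier (DMV X)"
    then obtain s where s: "s \<in> dmv_terms X" "x = dmv_eq X `` {s}" by (auto elim: DMV_cases)
    show "\<sim>\<^bsub>DMV X\<^esub> x \<in> carrier (DMV X)" using s cl[of "DNeg s"] by (auto simp: DMV_ops dmv_terms.intros)
    show "\<sim>\<^bsub>DMV X\<^esub> (\<sim>\<^bsub>DMV X\<^esub> x) = x"
      using s by (auto simp: DMV_ops dmv_terms.intros intro!: dmv_class_eq dmv_eq.neg_neg)
    show "\<sim>\<^bsub>DMV X\<^esub> \<zero>\<^bsub>DMV X\<^esub> \<oplus>\<^bsub>DMV X\<^esub> x = \<sim>\<^bsub>DMV X\<^esub> \<zero>\<^bsub>DMV X\<^esub>"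
      using s by (auto simp: DMV_ops dmv_terms.intros intro!: dmv_class_eq dmv_eq.one_plus)
    assume y: "y \<in> carrier (DMV X)"
    then obtain t where t: "t \<in> dmv_terms X" "y = dmv_eq X `` {t}" by (auto elim: DMV_cases)
    show "\<sim>\<^bsub>DMV X\<^esub> (\<sim>\<^bsub>DMV X\<^esub> x \<oplus>\<^bsub>DMV X\<^esub> y) \<oplus>\<^bsub>DMV X\<^esub> y = \<sim>\<^bsub>DMV X\<^esub> (\<sim>\<^bsub>DMV X\<^esub> y \<oplus>\<^bsub>DMV X\<^esub> x) \<oplus>\<^bsub>DMV X\<^esub> x"
      using s t by (auto simp: DMV_ops dmv_terms.intros intro!: dmv_class_eq dmv_eq.lukasiewicz) }
qed

lemma dmv_algebra_DMV: "dmv_algebra (DMV X)"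
proof -
  interpret mv_algebra "DMV X" by (rule mv_algebra_DMV)
  show ?thesis
  proof
    fix x y :: "'a dmv_term set" and r q :: rat
    { assume x: "x \<in> carrier (DMV X)"
      then obtain s where s: "s \<in> dmv_terms X" "x = dmv_eq X `` {s}" by (auto elim: DMV_cases)
      show "scal (DMV X) 1 x = x"
        using s by (auto simp: DMV_ops dmv_terms.intros intro!: dmv_class_eq dmv_eq.scal_one)
      assume r: "r \<in> {0..1}"
      show "scal (DMV X) r x \<in> carrier (DMV X)"
        using s r by (auto simp: DMV_ops intro!: quotientI dmv_terms.intros)
      { assume y: "y \<in> carrier (DMV X)"
        then obtain t where t: "t \<in> dmv_terms X" "y = dmv_eq X `` {t}" by (auto elim: DMV_cases)
        show "scal (DMV X) r (x \<odot>\<^bsub>DMV X\<^esub> \<sim>\<^bsub>DMV X\<^esub> y)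
            = scal (DMV X) r x \<odot>\<^bsub>DMV X\<^esub> \<sim>\<^bsub>DMV X\<^esub> (scal (DMV X) r y)"
          using s r t dmv_class_eq[OF dmv_eq.scal_diff[of r s X t]]
          by (simp add: odot_def DMV_ops dmv_terms.intros) }
      assume q: "q \<in> {0..1}"
      have m: "max 0 (r - q) \<in> {0..1}" "r * q \<in> {0..1}" using r q by (auto intro: mult_le_one)
      show "scal (DMV X) (max 0 (r - q)) x
          = scal (DMV X) r x \<odot>\<^bsub>DMV X\<^esub> \<sim>\<^bsub>DMV X\<^esub> (scal (DMV X) q x)"
        using s r q m(1) dmv_class_eq[OF dmv_eq.diff_scal[of r q s X]]
        by (simp only: odot_def DMV_ops dmv_terms.intros)
      show "scal (DMV X) r (scal (DMV X) q x) = scal (DMV X) (r * q) x"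
        using s r q m(2) dmv_class_eq[OF dmv_eq.scal_scal[of r q s X]]
        by (simp only: DMV_ops dmv_terms.intros) }
  qed
qed

context mv_algebra
begin

lemma zero_closed: "\<zero> \<in> carrier A"
  and oplus_closed: "\<lbrakk>x \<in> carrier A; y \<in> carrier A\<rbrakk> \<Longrightarrow> x \<oplus> y \<in> carrier A"
  and oplus_assoc: "\<lbrakk>x \<in> carrier A; y \<in> carrier A; z \<in> carrier A\<rbrakk> \<Longrightarrow> x \<oplus> y \<oplus> z = x \<oplus> (y \<oplus> z)"
  and oplus_comm: "\<lbrakk>x \<in> carrier A; y \<in> carrier A\<rbrakk> \<Longrightarrow> x \<oplus> y = y \<oplus> x"
  and zero_oplus: "x \<in> carrier A \<Longrightarrow> \<zero> \<oplus> x = x"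
proof -
  interpret M: comm_monoid "\<lparr>carrier = carrier A, monoid.mult = oplus A, one = mvzero A\<rparr>"
    by (rule oplus_monoid)
  show "\<zero> \<in> carrier A" using M.one_closed by simp
  show "\<lbrakk>x \<in> carrier A; y \<in> carrier A\<rbrakk> \<Longrightarrow> x \<oplus> y \<in> carrier A" using M.m_closed by simp
  show "\<lbrakk>x \<in> carrier A; y \<in> carrier A; z \<in> carrier A\<rbrakk> \<Longrightarrow> x \<oplus> y \<oplus> z = x \<oplus> (y \<oplus> z)"
    using M.m_assoc by simp
  show "\<lbrakk>x \<in> carrier A; y \<in> carrier A\<rbrakk> \<Longrightarrow> x \<oplus> y = y \<oplus> x" using M.m_comm by simp
  show "x \<in> carrier A \<Longrightarrow> \<zero> \<oplus> x = x" using M.l_one by simp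
qed

end

primrec mv_eval :: "('b, 'm) mv_scheme \<Rightarrow> ('v \<Rightarrow> 'b) \<Rightarrow> 'v mv_term \<Rightarrow> 'b" where
  "mv_eval A f (MVar x) = f x"
| "mv_eval A f MZero = mvzero A"
| "mv_eval A f (MNeg t) = mvneg A (mv_eval A f t)"
| "mv_eval A f (MPlus s t) = oplus A (mv_eval A f s) (mv_eval A f t)"

primrec dmv_eval :: "('b, 'm) dmv_scheme \<Rightarrow> ('v \<Rightarrow> 'b) \<Rightarrow> 'v dmv_term \<Rightarrow> 'b" where
  "dmv_eval A f (DVar x) = f x"
| "dmv_eval A f DZero = mvzero A"
| "dmv_eval A f (DNeg t) = mvneg A (dmv_eval A f t)"
| "dmv_eval A f (DPlus s t) = oplus A (dmv_eval A f s) (dmv_eval A f t)"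
| "dmv_eval A f (DScal r t) = scal A r (dmv_eval A f t)"

lemma (in mv_algebra) mv_eval_closed:
  assumes "f \<in> X \<rightarrow> carrier A" "t \<in> mv_terms X"
  shows "mv_eval A f t \<in> carrier A"
  using assms(2,1) by induction (auto intro: zero_closed neg_closed oplus_closed)

lemma (in mv_algebra) mv_eval_sound:
  assumes "f \<in> X \<rightarrow> carrier A" "(s, t) \<in> mv_eq X"
  shows "mv_eval A f s = mv_eval A f t"
  using assms(2)
proof induction
  case (comm s t)
  then show ?case by (simp add: mv_eval_closed[OF assms(1)] oplus_comm)
next
  case (lukasiewicz s t)
  then show ?case
    by (simp add: mv_eval_closed[OF assms(1)] mv_algebra.lukasiewicz[OF mv_algebra_axioms,
          of "mv_eval A f s" "mv_eval A f t"])
qed (simp_all add: mv_eval_closed[OF assms(1)] oplus_assoc zero_oplus neg_neg one_oplus)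

lemma (in dmv_algebra) dmv_eval_closed:
  assumes "f \<in> X \<rightarrow> carrier A" "t \<in> dmv_terms X"
  shows "dmv_eval A f t \<in> carrier A"
  using assms(2,1) by induction (auto intro: zero_closed neg_closed oplus_closed scal_closed)

lemma (in dmv_algebra) dmv_eval_sound:
  assumes "f \<in> X \<rightarrow> carrier A" "(s, t) \<in> dmv_eq X"
  shows "dmv_eval A f s = dmv_eval A f t"
  using assms(2)
proof induction
  case (comm s t)
  then show ?case by (simp add: dmv_eval_closed[OF assms(1)] oplus_comm)
next
  case (lukasiewicz s t)
  then show ?case
    by (simp add: dmv_eval_closed[OF assms(1)] mv_algebra.lukasiewicz[OF mv_algebra_axioms,
          of "dmv_eval A f s" "dmv_eval A f t"])
next
  case (scal_diff r s t)
  then show ?case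
    using dmv_algebra.scal_diff[OF dmv_algebra_axioms, of r "dmv_eval A f s" "dmv_eval A f t"]
    by (simp add: dmv_eval_closed[OF assms(1)] odot_def)
next
  case (diff_scal r q t)
  then show ?case
    using dmv_algebra.diff_scal[OF dmv_algebra_axioms, of r q "dmv_eval A f t"]
    by (simp add: dmv_eval_closed[OF assms(1)] odot_def)
qed (simp_all add: dmv_eval_closed[OF assms(1)] oplus_assoc zero_oplus neg_neg
      one_oplus scal_scal scal_one)

theorem MV_free:
  assumes "mv_algebra A" "f \<in> X \<rightarrow> carrier A"
  shows "\<exists>!h. h \<in> mv_hom (MV X) A \<and> (\<forall>x\<in>X. h (mv_gen X x) = f x)"
proof (rule ex_ex1I)
  interpret mv_algebra A by fact
  define h where "h = (\<lambda>C\<in>carrier (MV X). mv_eval A f (SOME s. s \<in> C))"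
  have h: "h (mv_eq X `` {s}) = mv_eval A f s" if s: "s \<in> mv_terms X" for s
  proof -
    have "s \<in> mv_eq X `` {s}" using s by (auto intro: mv_eq.refl)
    then have "(SOME u. u \<in> mv_eq X `` {s}) \<in> mv_eq X `` {s}" by (rule someI)
    then have "(s, SOME u. u \<in> mv_eq X `` {s}) \<in> mv_eq X" by blast
    with s show ?thesis
      by (auto simp: h_def MV_ops quotientI dest!: mv_eval_sound[OF assms(2)])
  qed
  have "h \<in> carrier (MV X) \<rightarrow>\<^sub>E carrier A"
  proof (rule PiE_I)
    show "h C \<in> carrier A" if "C \<in> carrier (MV X)" for C
      using that by (rule MV_cases) (simp add: h mv_eval_closed[OF assms(2)])
  qed (simp add: h_def)
  then have "h \<in> mv_hom (MV X) A"
    unfolding mv_hom_def by (auto elim!: MV_cases simp: MV_ops(2-) h mv_terms.intros)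
  then show "\<exists>h. h \<in> mv_hom (MV X) A \<and> (\<forall>x\<in>X. h (mv_gen X x) = f x)"
    by (intro exI[of _ h]) (simp add: mv_gen_def h mv_terms.intros)
next
  fix g h
  assume g: "g \<in> mv_hom (MV X) A \<and> (\<forall>x\<in>X. g (mv_gen X x) = f x)"
    and h: "h \<in> mv_hom (MV X) A \<and> (\<forall>x\<in>X. h (mv_gen X x) = f x)"
  have *: "k (mv_eq X `` {s}) = mv_eval A f s"
    if k: "k \<in> mv_hom (MV X) A" "\<forall>x\<in>X. k (mv_gen X x) = f x" and s: "s \<in> mv_terms X" for k s
    using s
  proof induction
    case (3 t)
    then have "mv_eq X `` {t} \<in> carrier (MV X)" by (simp add: MV_ops quotientI)
    with 3 k(1) show ?case unfolding mv_hom_def by (auto simp: MV_ops(3)[symmetric])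
  next
    case (4 s t)
    then have "mv_eq X `` {s} \<in> carrier (MV X)" "mv_eq X `` {t} \<in> carrier (MV X)"
      by (simp_all add: MV_ops quotientI)
    with 4 k(1) show ?case unfolding mv_hom_def by (auto simp: MV_ops(4)[symmetric])
  qed (use k in \<open>auto simp: mv_hom_def mv_gen_def MV_ops\<close>)
  show "g = h"
  proof (rule extensionalityI[of _ "carrier (MV X)"])
    show "g C = h C" if "C \<in> carrier (MV X)" for C
      using that g h by (auto elim!: MV_cases simp: *)
  qed (use g h in \<open>auto simp: mv_hom_def PiE_def\<close>)
qed

theorem DMV_free:
  assumes "dmv_algebra A" "f \<in> X \<rightarrow> carrier A"
  shows "\<exists>!h. h \<in> dmv_hom (DMV X) A \<and> (\<forall>x\<in>X. h (dmv_gen X x) = f x)"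
proof (rule ex_ex1I)
  interpret dmv_algebra A by fact
  define h where "h = (\<lambda>C\<in>carrier (DMV X). dmv_eval A f (SOME s. s \<in> C))"
  have h: "h (dmv_eq X `` {s}) = dmv_eval A f s" if s: "s \<in> dmv_terms X" for s
  proof -
    have "s \<in> dmv_eq X `` {s}" using s by (auto intro: dmv_eq.refl)
    then have "(SOME u. u \<in> dmv_eq X `` {s}) \<in> dmv_eq X `` {s}" by (rule someI)
    then have "(s, SOME u. u \<in> dmv_eq X `` {s}) \<in> dmv_eq X" by blast
    with s show ?thesis
      by (auto simp: h_def DMV_ops quotientI dest!: dmv_eval_sound[OF assms(2)])
  qed
  have "h \<in> carrier (DMV X) \<rightarrow>\<^sub>E carrier A"
  proof (rule PiE_I)
    show "h C \<in> carrier A" if "C \<in> carrier (DMV X)" for C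
      using that by (rule DMV_cases) (simp add: h dmv_eval_closed[OF assms(2)])
  qed (simp add: h_def)
  then have "h \<in> dmv_hom (DMV X) A"
    unfolding dmv_hom_def mv_hom_def by (auto elim!: DMV_cases simp: DMV_ops(2-) h dmv_terms.intros)
  then show "\<exists>h. h \<in> dmv_hom (DMV X) A \<and> (\<forall>x\<in>X. h (dmv_gen X x) = f x)"
    by (intro exI[of _ h]) (simp add: dmv_gen_def h dmv_terms.intros)
next
  fix g h
  assume g: "g \<in> dmv_hom (DMV X) A \<and> (\<forall>x\<in>X. g (dmv_gen X x) = f x)"
    and h: "h \<in> dmv_hom (DMV X) A \<and> (\<forall>x\<in>X. h (dmv_gen X x) = f x)"
  have *: "k (dmv_eq X `` {s}) = dmv_eval A f s"
    if k: "k \<in> dmv_hom (DMV X) A" "\<forall>x\<in>X. k (dmv_gen X x) = f x" and s: "s \<in> dmv_terms X" for k s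
    using s
  proof induction
    case (3 t)
    then have "dmv_eq X `` {t} \<in> carrier (DMV X)" by (simp add: DMV_ops quotientI)
    with 3 k(1) show ?case unfolding dmv_hom_def mv_hom_def by (auto simp: DMV_ops(3)[symmetric])
  next
    case (4 s t)
    then have "dmv_eq X `` {s} \<in> carrier (DMV X)" "dmv_eq X `` {t} \<in> carrier (DMV X)"
      by (simp_all add: DMV_ops quotientI)
    with 4 k(1) show ?case unfolding dmv_hom_def mv_hom_def by (auto simp: DMV_ops(4)[symmetric])
  next
    case (5 r t)
    then have "dmv_eq X `` {t} \<in> carrier (DMV X)" by (simp add: DMV_ops quotientI)
    with 5 k(1) show ?case unfolding dmv_hom_def by (auto simp: DMV_ops(5)[symmetric])
  qed (use k in \<open>auto simp: dmv_hom_def mv_hom_def dmv_gen_def DMV_ops\<close>)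
  show "g = h"
  proof (rule extensionalityI[of _ "carrier (DMV X)"])
    show "g C = h C" if "C \<in> carrier (DMV X)" for C
      using that g h by (auto elim!: DMV_cases simp: *)
  qed (use g h in \<open>auto simp: dmv_hom_def mv_hom_def PiE_def\<close>)
qed

lemma iota_unique:
  "\<exists>!h. h \<in> mv_hom (MV X) (DMV X) \<and> (\<forall>x\<in>X. h (mv_gen X x) = dmv_gen X x)"
  by (rule MV_free[OF mv_algebra_DMV])
    (auto simp: DMV_ops dmv_gen_def intro!: quotientI dmv_terms.intros)

lemma iota_hom: "iota X \<in> mv_hom (MV X) (DMV X)"
  and iota_gen: "x \<in> X \<Longrightarrow> iota X (mv_gen X x) = dmv_gen X x"
  using theI'[OF iota_unique[of X]] by (auto simp: iota_def)


section \<open>Categories\<close>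

text \<open>Arrows need not determine their domain and codomain, so identities and composites
  are indexed by objects: for \<open>f : a \<rightarrow> b\<close> and \<open>g : b \<rightarrow> c\<close>, the composite of \<open>g\<close> after \<open>f\<close>
  is \<open>Comp C a b c g f\<close>.\<close>

record ('o, 'a) cat =
  Obj :: "'o set"
  Hom :: "'o \<Rightarrow> 'o \<Rightarrow> 'a set"
  Id :: "'o \<Rightarrow> 'a"
  Comp :: "'o \<Rightarrow> 'o \<Rightarrow> 'o \<Rightarrow> 'a \<Rightarrow> 'a \<Rightarrow> 'a"

definition category :: "('o, 'a) cat \<Rightarrow> bool" where
  "category C \<longleftrightarrow>
     (\<forall>a\<in>Obj C. Id C a \<in> Hom C a a) \<and>
     (\<forall>a\<in>Obj C. \<forall>b\<in>Obj C. \<forall>c\<in>Obj C. \<forall>f\<in>Hom C a b. \<forall>g\<in>Hom C b c.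
        Comp C a b c g f \<in> Hom C a c) \<and>
     (\<forall>a\<in>Obj C. \<forall>b\<in>Obj C. \<forall>f\<in>Hom C a b.
        Comp C a a b f (Id C a) = f \<and> Comp C a b b (Id C b) f = f) \<and>
     (\<forall>a\<in>Obj C. \<forall>b\<in>Obj C. \<forall>c\<in>Obj C. \<forall>d\<in>Obj C.
        \<forall>f\<in>Hom C a b. \<forall>g\<in>Hom C b c. \<forall>h\<in>Hom C c d.
        Comp C a b d (Comp C b c d h g) f = Comp C a c d h (Comp C a b c g f))"

record ('o, 'a, 'p, 'b) ftor =
  on_obj :: "'o \<Rightarrow> 'p"
  on_arr :: "'o \<Rightarrow> 'o \<Rightarrow> 'a \<Rightarrow> 'b"

definition is_functor :: "('o, 'a) cat \<Rightarrow> ('p, 'b) cat \<Rightarrow> ('o, 'a, 'p, 'b) ftor \<Rightarrow> bool" where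
  "is_functor C D F \<longleftrightarrow> category C \<and> category D \<and>
     (\<forall>a\<in>Obj C. on_obj F a \<in> Obj D) \<and>
     (\<forall>a\<in>Obj C. \<forall>b\<in>Obj C. \<forall>f\<in>Hom C a b.
        on_arr F a b f \<in> Hom D (on_obj F a) (on_obj F b)) \<and>
     (\<forall>a\<in>Obj C. on_arr F a a (Id C a) = Id D (on_obj F a)) \<and>
     (\<forall>a\<in>Obj C. \<forall>b\<in>Obj C. \<forall>c\<in>Obj C. \<forall>f\<in>Hom C a b. \<forall>g\<in>Hom C b c.
        on_arr F a c (Comp C a b c g f) =
          Comp D (on_obj F a) (on_obj F b) (on_obj F c) (on_arr F b c g) (on_arr F a b f))"

definition id_functor :: "('o, 'a, 'o, 'a) ftor" where
  "id_functor = \<lparr>on_obj = (\<lambda>a. a), on_arr = (\<lambda>a b f. f)\<rparr>"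

definition comp_functor ::
    "('p, 'b, 'q, 'c) ftor \<Rightarrow> ('o, 'a, 'p, 'b) ftor \<Rightarrow> ('o, 'a, 'q, 'c) ftor" where
  "comp_functor G F = \<lparr>on_obj = (\<lambda>a. on_obj G (on_obj F a)),
     on_arr = (\<lambda>a b f. on_arr G (on_obj F a) (on_obj F b) (on_arr F a b f))\<rparr>"

definition is_iso :: "('o, 'a) cat \<Rightarrow> 'o \<Rightarrow> 'o \<Rightarrow> 'a \<Rightarrow> bool" where
  "is_iso C a b f \<longleftrightarrow> f \<in> Hom C a b \<and>
     (\<exists>g\<in>Hom C b a. Comp C a b a g f = Id C a \<and> Comp C b a b f g = Id C b)"

definition natural_iso :: "('o, 'a) cat \<Rightarrow> ('p, 'b) cat \<Rightarrow> ('o, 'a, 'p, 'b) ftor \<Rightarrow>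
    ('o, 'a, 'p, 'b) ftor \<Rightarrow> ('o \<Rightarrow> 'b) \<Rightarrow> bool" where
  "natural_iso C D F G \<eta> \<longleftrightarrow>
     (\<forall>a\<in>Obj C. is_iso D (on_obj F a) (on_obj G a) (\<eta> a)) \<and>
     (\<forall>a\<in>Obj C. \<forall>b\<in>Obj C. \<forall>f\<in>Hom C a b.
        Comp D (on_obj F a) (on_obj F b) (on_obj G b) (\<eta> b) (on_arr F a b f) =
        Comp D (on_obj F a) (on_obj G a) (on_obj G b) (on_arr G a b f) (\<eta> a))"

definition is_equivalence :: "('o, 'a) cat \<Rightarrow> ('p, 'b) cat \<Rightarrow> ('o, 'a, 'p, 'b) ftor \<Rightarrow> bool" where
  "is_equivalence C D F \<longleftrightarrow> is_functor C D F \<and>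
     (\<exists>G \<eta> \<epsilon>. is_functor D C G \<and>
        natural_iso C C id_functor (comp_functor G F) \<eta> \<and>
        natural_iso D D (comp_functor F G) id_functor \<epsilon>)"


section \<open>Categories of theories\<close>

text \<open>The sets of variables are the subsets of the type \<open>'v\<close>, which plays the role of
  the universe.\<close>

type_synonym 'v mv_theory = "'v set \<times> 'v mv_term set set"
type_synonym 'v dmv_theory = "'v set \<times> 'v dmv_term set set"

definition ThMV :: "('v mv_theory, 'v mv_term set \<Rightarrow> 'v mv_term set) cat" where
  "ThMV = \<lparr>Obj = {(X, I). fin_gen_ideal (MV X) I},
     Hom = (\<lambda>(X, I) (Y, J). {\<sigma> \<in> mv_hom (MV X) (MV Y). \<sigma> ` I \<subseteq> J}),
     Id = (\<lambda>(X, I). \<lambda>u\<in>carrier (MV X). u),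
     Comp = (\<lambda>(X, I) _ _ \<tau> \<sigma>. compose (carrier (MV X)) \<tau> \<sigma>)\<rparr>"

definition ThDMV :: "('v dmv_theory, 'v dmv_term set \<Rightarrow> 'v dmv_term set) cat" where
  "ThDMV = \<lparr>Obj = {(X, I). fin_gen_ideal (DMV X) I},
     Hom = (\<lambda>(X, I) (Y, J). {\<sigma> \<in> dmv_hom (DMV X) (DMV Y). \<sigma> ` I \<subseteq> J}),
     Id = (\<lambda>(X, I). \<lambda>u\<in>carrier (DMV X). u),
     Comp = (\<lambda>(X, I) _ _ \<tau> \<sigma>. compose (carrier (DMV X)) \<tau> \<sigma>)\<rparr>"

definition ThDMV' :: "('v dmv_theory, 'v dmv_term set \<Rightarrow> 'v dmv_term set) cat" where
  "ThDMV' = ThDMV\<lparr>Hom := (\<lambda>A B. {\<sigma> \<in> Hom ThDMV A B.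
     \<forall>x\<in>fst A. \<sigma> (dmv_gen (fst A) x) \<in> iota (fst B) ` carrier (MV (fst B))})\<rparr>"

definition DT_obj :: "'v mv_theory \<Rightarrow> 'v dmv_theory" where
  "DT_obj = (\<lambda>(X, I). (X, ideal_gen (DMV X) (iota X ` I)))"

definition DT_spec :: "'v mv_theory \<Rightarrow> 'v mv_theory \<Rightarrow> ('v mv_term set \<Rightarrow> 'v mv_term set) \<Rightarrow>
    ('v dmv_term set \<Rightarrow> 'v dmv_term set) \<Rightarrow> bool" where
  "DT_spec A B \<sigma> \<sigma>D \<longleftrightarrow> \<sigma>D \<in> Hom ThDMV (DT_obj A) (DT_obj B) \<and>
     (\<forall>x\<in>fst A. \<sigma>D (dmv_gen (fst A) x) = iota (fst B) (\<sigma> (mv_gen (fst A) x)))"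

definition DT :: "('v mv_theory, 'v mv_term set \<Rightarrow> 'v mv_term set,
    'v dmv_theory, 'v dmv_term set \<Rightarrow> 'v dmv_term set) ftor" where
  "DT = \<lparr>on_obj = DT_obj, on_arr = (\<lambda>A B \<sigma>. THE \<sigma>D. DT_spec A B \<sigma> \<sigma>D)\<rparr>"

end

theory Submission
  imports Defs "HOL-Algebra.FiniteProduct"
begin

text \<open>
  Equations between MV-terms, and between DMV-terms, hold in the free algebras as soon as they hold
  in the real interval \<open>[0,1]\<close>: a failing equation is separated by a quotient chain, the chain
  embeds into Chang's totally ordered group, and Fourier--Motzkin elimination transfers the finitely
  many linear relations involved to the reals.  Since \<open>[0,1]\<close> is itself a DMV-algebra, the
  embedding of the free MV-algebra is injective, so an ideal of \<open>MV X\<close> is recovered from the ideal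
  of \<open>DMV X\<close> it generates.  Conversely, each \<open>f\<close> in \<open>DMV X\<close> has a multiple \<open>n f\<close> which,
  as a real function, is an integer constant plus a sum of values of MV-terms; its truncation is
  the value of an MV-term and generates the same ideal as \<open>f\<close>.  Hence the functor is bijective on
  objects, and by the universal properties also on arrows.
\<close>

text \<open>Injectivity of the embedding is the obstacle: scalars might prove new identities between
  MV-terms, and then different ideals or arrows would be identified. One DMV-algebra whose
  MV-identities are just the provable ones excludes this, so the core is completeness of
  \<open>[0,1]\<close>. In a general MV-algebra, a homomorphism to \<open>[0,1]\<close> separating
  two elements need not exist, because a quotient chain may contain infinitesimals. The separating
  maps therefore respect the operations only on a prescribed finite set, which is enough to evaluate
  a term. Such a map is compatible with a given scalar as soon as the set is large enough, since
  \<open>r x\<close> is tied to \<open>x\<close> by finitely many MV-relations; hence the chain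
  argument concerns MV-reducts and serves both kinds of algebra. On the way back to
  \<open>MV X\<close>, a DMV-term need not have the function of an MV-term, since its slopes may be
  fractions. But an ideal contains an element as soon as it contains a finite sum of copies of it,
  and conversely, which leaves room to clear denominators.\<close>

section \<open>Arithmetic of MV-algebras\<close>

context mv_algebra
begin

text \<open>Truncated difference, \<open>x \<odot> \<sim>y\<close> with the double negation removed;
  on the real unit interval it is \<open>max 0 (x - y)\<close>.\<close>

abbreviation diff (infixl \<open>\<ominus>\<close> 65) where "x \<ominus> y \<equiv> \<sim>(\<sim>x \<oplus> y)"

lemmas closed [simp, intro] = zero_closed neg_closed oplus_closed

lemma one_closed [simp, intro]: "\<one>\<^sub>M \<in> carrier A"
  by (simp add: mvone_def)

lemma neg_zero [simp]: "\<sim>\<zero> = \<one>\<^sub>M" and neg_one [simp]: "\<sim>\<one>\<^sub>M = \<zero>"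
  by (simp_all add: mvone_def neg_neg)

declare neg_neg [simp]

lemma oplus_lcomm:
  "\<lbrakk>x \<in> carrier A; y \<in> carrier A; z \<in> carrier A\<rbrakk> \<Longrightarrow> x \<oplus> (y \<oplus> z) = y \<oplus> (x \<oplus> z)"
  by (metis oplus_assoc oplus_comm)

lemmas oplus_ac = oplus_assoc oplus_comm oplus_lcomm

lemma zero_simps [simp]:
  assumes "x \<in> carrier A"
  shows "\<zero> \<oplus> x = x" "x \<oplus> \<zero> = x" "\<one>\<^sub>M \<oplus> x = \<one>\<^sub>M" "x \<oplus> \<one>\<^sub>M = \<one>\<^sub>M"
  using assms one_oplus[folded mvone_def] zero_oplus oplus_comm[of x "\<zero>"] oplus_comm[of x "\<one>\<^sub>M"]
  by simp_all

text \<open>For \<open>y = 1\<close> the left-hand side of the Lukasiewicz identity collapses to 1,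
  and the right-hand side to \<open>\<sim>x \<oplus> x\<close>.\<close>

lemma neg_oplus [simp]:
  assumes "x \<in> carrier A" shows "\<sim>x \<oplus> x = \<one>\<^sub>M" "x \<oplus> \<sim>x = \<one>\<^sub>M"
  using lukasiewicz[of x "\<one>\<^sub>M"] assms oplus_comm[of x "\<sim>x"] by simp_all

section \<open>The natural order\<close>

lemma le_refl [simp]: "x \<in> carrier A \<Longrightarrow> x \<preceq> x"
  by (simp add: mvle_def)

lemma le_antisym: "\<lbrakk>x \<preceq> y; y \<preceq> x; x \<in> carrier A; y \<in> carrier A\<rbrakk> \<Longrightarrow> x = y"
  using lukasiewicz[of x y] by (simp add: mvle_def)

lemma le_oplus1 [simp]: "\<lbrakk>x \<in> carrier A; y \<in> carrier A\<rbrakk> \<Longrightarrow> x \<preceq> x \<oplus> y"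
  by (simp add: mvle_def oplus_assoc[symmetric])

lemma le_oplus2 [simp]: "\<lbrakk>x \<in> carrier A; y \<in> carrier A\<rbrakk> \<Longrightarrow> y \<preceq> x \<oplus> y"
  using le_oplus1[of y x] by (simp add: oplus_comm)

text \<open>If \<open>x \<preceq> y\<close>, one side of the Lukasiewicz identity is
  \<open>y\<close>, the other \<open>(y \<ominus> x) \<oplus> x\<close>. Turning inequalities into
  sums in this way reduces transitivity and monotonicity to associativity and commutativity.\<close>

lemma le_imp_oplus_diff:
  "\<lbrakk>x \<preceq> y; x \<in> carrier A; y \<in> carrier A\<rbrakk> \<Longrightarrow> x \<oplus> (y \<ominus> x) = y"
  using lukasiewicz[of x y] by (simp add: mvle_def oplus_comm)

lemma le_trans:
  assumes "x \<preceq> y" "y \<preceq> z" "x \<in> carrier A" "y \<in> carrier A" "z \<in> carrier A"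
  shows "x \<preceq> z"
proof -
  have "z = x \<oplus> ((y \<ominus> x) \<oplus> (z \<ominus> y))"
    using le_imp_oplus_diff[of x y] le_imp_oplus_diff[of y z] assms
    by (simp add: oplus_assoc[symmetric])
  then show ?thesis
    using le_oplus1[of x "(y \<ominus> x) \<oplus> (z \<ominus> y)"] assms by simp
qed

lemma oplus_mono:
  assumes "x \<preceq> y" "u \<preceq> v" "x \<in> carrier A" "y \<in> carrier A" "u \<in> carrier A" "v \<in> carrier A"
  shows "x \<oplus> u \<preceq> y \<oplus> v"
proof -
  have "y \<oplus> v = (x \<oplus> (y \<ominus> x)) \<oplus> (u \<oplus> (v \<ominus> u))"
    using le_imp_oplus_diff[of x y] le_imp_oplus_diff[of u v] assms by simp
  also have "\<dots> = (x \<oplus> u) \<oplus> ((y \<ominus> x) \<oplus> (v \<ominus> u))"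
    using assms by (simp add: oplus_ac)
  finally show ?thesis
    using le_oplus1[of "x \<oplus> u" "(y \<ominus> x) \<oplus> (v \<ominus> u)"] assms by simp
qed

lemma neg_le_neg: "\<lbrakk>x \<in> carrier A; y \<in> carrier A\<rbrakk> \<Longrightarrow> \<sim>y \<preceq> \<sim>x \<longleftrightarrow> x \<preceq> y"
  by (simp add: mvle_def oplus_comm)

lemma zero_le [simp]: "x \<in> carrier A \<Longrightarrow> \<zero> \<preceq> x"
  and le_one [simp]: "x \<in> carrier A \<Longrightarrow> x \<preceq> \<one>\<^sub>M"
  by (simp_all add: mvle_def)

text \<open>Residuation: subtracting \<open>y\<close> is left adjoint to adding \<open>y\<close>,
  both inequalities being the same equation up to associativity.\<close>

lemma diff_le_iff:
  "\<lbrakk>x \<in> carrier A; y \<in> carrier A; z \<in> carrier A\<rbrakk> \<Longrightarrow> x \<ominus> y \<preceq> z \<longleftrightarrow> x \<preceq> y \<oplus> z"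
  by (simp add: mvle_def oplus_assoc)

lemma le_oplus_diff: "\<lbrakk>x \<in> carrier A; y \<in> carrier A\<rbrakk> \<Longrightarrow> x \<preceq> y \<oplus> (x \<ominus> y)"
  using diff_le_iff[of x y "x \<ominus> y"] by simp

lemma diff_le [simp]: "\<lbrakk>x \<in> carrier A; y \<in> carrier A\<rbrakk> \<Longrightarrow> x \<ominus> y \<preceq> x"
  by (simp add: diff_le_iff)

lemma diff_eq_zero_iff: "\<lbrakk>x \<in> carrier A; y \<in> carrier A\<rbrakk> \<Longrightarrow> x \<ominus> y = \<zero> \<longleftrightarrow> x \<preceq> y"
  using neg_neg[of "\<sim>x \<oplus> y"] by (auto simp: mvle_def simp del: neg_neg)

text \<open>The bound \<open>x \<preceq> \<sim>y\<close> says that \<open>x \<oplus> y\<close> is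
  not truncated, which is what makes cancellation possible.\<close>

lemma oplus_diff_cancel:
  assumes "x \<in> carrier A" "y \<in> carrier A" "x \<preceq> \<sim>y"
  shows "(x \<oplus> y) \<ominus> y = x"
proof -
  have "(x \<oplus> y) \<ominus> y = \<sim>(y \<oplus> (\<sim>y \<ominus> x))" using assms by (simp add: oplus_comm)
  also have "\<dots> = \<sim>((\<sim>x \<ominus> y) \<oplus> y)" using assms by (simp add: oplus_comm)
  also have "\<dots> = \<sim>(\<sim>x)"
    using le_imp_oplus_diff[of y "\<sim>x"] assms neg_le_neg[of x "\<sim>y"] by (simp add: oplus_comm)
  finally show ?thesis using assms by simp
qed

section \<open>Meets and prelinearity\<close>

abbreviation meet (infixl \<open>\<triangle>\<close> 70) where "x \<triangle> y \<equiv> x \<ominus> (x \<ominus> y)"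

text \<open>This is the negation of the Lukasiewicz identity for \<open>\<sim>x\<close> and
  \<open>\<sim>y\<close>.\<close>

lemma meet_comm: "\<lbrakk>x \<in> carrier A; y \<in> carrier A\<rbrakk> \<Longrightarrow> x \<triangle> y = y \<triangle> x"
  using lukasiewicz[of "\<sim>x" "\<sim>y"] by (simp add: oplus_comm)

lemma meet_le1: "\<lbrakk>x \<in> carrier A; y \<in> carrier A\<rbrakk> \<Longrightarrow> x \<triangle> y \<preceq> x"
  by simp

lemma meet_le2: "\<lbrakk>x \<in> carrier A; y \<in> carrier A\<rbrakk> \<Longrightarrow> x \<triangle> y \<preceq> y"
  by (subst meet_comm) simp_all

lemma le_meet:
  assumes "z \<preceq> x" "z \<preceq> y" "x \<in> carrier A" "y \<in> carrier A" "z \<in> carrier A"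
  shows "z \<preceq> x \<triangle> y"
proof -
  have "x \<ominus> y \<preceq> x \<ominus> z"
    using assms oplus_mono[of "\<sim>x" "\<sim>x" z y] by (simp add: neg_le_neg)
  then have "x \<triangle> z \<preceq> x \<triangle> y"
    using assms oplus_mono[of "\<sim>x" "\<sim>x" "x \<ominus> y" "x \<ominus> z"] by (simp add: neg_le_neg)
  moreover have "x \<triangle> z = z"
    using assms meet_comm[of x z] by (simp add: mvle_def)
  ultimately show ?thesis by simp
qed

lemma le_oplus_meet:
  "\<lbrakk>t \<preceq> x \<oplus> y; t \<preceq> x \<oplus> z; t \<in> carrier A; x \<in> carrier A; y \<in> carrier A; z \<in> carrier A\<rbrakk>
    \<Longrightarrow> t \<preceq> x \<oplus> (y \<triangle> z)"
  using le_meet[of "t \<ominus> x" y z] diff_le_iff[of t x] by simp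

text \<open>The left-hand side lies below \<open>x \<oplus> y\<close> and below every sum with
  summand \<open>z\<close>; residuation then allows the meet with \<open>z\<close> to be formed in
  one summand at a time. The inequality makes the sets of all \<open>u\<close> with
  \<open>u \<triangle> y \<in> P\<close> closed under \<open>\<oplus>\<close>.\<close>

lemma oplus_meet_le:
  assumes "x \<in> carrier A" "y \<in> carrier A" "z \<in> carrier A"
  shows "(x \<oplus> y) \<triangle> z \<preceq> (x \<triangle> z) \<oplus> (y \<triangle> z)"
proof -
  let ?t = "(x \<oplus> y) \<triangle> z"
  have t: "?t \<preceq> x \<oplus> y" "?t \<preceq> z" "?t \<in> carrier A"
    using assms by (simp_all add: meet_le1 meet_le2)
  have up: "?t \<preceq> u \<oplus> z" if "u \<in> carrier A" for u
    using le_trans[OF t(2) le_oplus2[of u z]] that assms t by simp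
  have "?t \<preceq> x \<oplus> (y \<triangle> z)"
    using assms t up by (intro le_oplus_meet) auto
  then have "?t \<preceq> (y \<triangle> z) \<oplus> x" using assms by (simp add: oplus_comm)
  then have "?t \<preceq> (y \<triangle> z) \<oplus> (x \<triangle> z)"
    using assms t up by (intro le_oplus_meet) auto
  then show ?thesis using assms by (simp add: oplus_comm)
qed

text \<open>Both \<open>x\<close> and \<open>y\<close> arise by adding a difference \<open>a\<close>
  or \<open>b\<close> to the meet \<open>m\<close>. A common part \<open>c\<close> of the
  differences yields \<open>c \<oplus> m \<preceq> m\<close>, and as this sum is not truncated,
  cancelling \<open>m\<close> leaves \<open>c = \<zero>\<close>.\<close>

lemma prelinear:
  assumes "x \<in> carrier A" "y \<in> carrier A"
  shows "(x \<ominus> y) \<triangle> (y \<ominus> x) = \<zero>"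
proof -
  define a b m where "a = x \<ominus> y" and "b = y \<ominus> x" and "m = x \<triangle> y"
  define c where "c = a \<triangle> b"
  have cl [simp]: "a \<in> carrier A" "b \<in> carrier A" "m \<in> carrier A" "c \<in> carrier A"
    using assms by (simp_all add: a_def b_def m_def c_def)
  have ax: "a \<preceq> x" and "b \<preceq> y" using assms by (simp_all add: a_def b_def)
  then have x: "a \<oplus> m = x" and y: "b \<oplus> m = y"
    using le_imp_oplus_diff[of a x] le_imp_oplus_diff[of b y] assms meet_comm[of x y]
    by (simp_all add: m_def a_def b_def)
  have ca: "c \<preceq> a" and cb: "c \<preceq> b" by (simp_all add: c_def meet_le2)
  have "a \<preceq> \<sim>m" using assms by (simp add: m_def a_def)
  then have cm: "c \<preceq> \<sim>m" using le_trans[OF ca] by simp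
  have "c \<oplus> m \<preceq> x" "c \<oplus> m \<preceq> y"
    using oplus_mono[OF ca le_refl[of m]] oplus_mono[OF cb le_refl[of m]] x y by simp_all
  then have "c \<oplus> m \<preceq> m" unfolding m_def[symmetric]
    using le_meet[of "c \<oplus> m" x y] assms by (simp add: m_def[symmetric])
  then have "(c \<oplus> m) \<ominus> m = \<zero>" by (simp add: diff_eq_zero_iff)
  then have "c = \<zero>" using oplus_diff_cancel[OF _ _ cm] by simp
  then show ?thesis by (simp add: c_def a_def b_def)
qed

end

subsection \<open>Prime ideals and quotients\<close>

context mv_algebra
begin

lemma ideal_zero: "mv_ideal A I \<Longrightarrow> \<zero> \<in> I"
  unfolding mv_ideal_def by (metis ex_in_conv subsetD zero_closed zero_le)

text \<open>The analogue of a colon ideal. It is the extension of \<open>P\<close> on which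
  maximality is tested when \<open>P\<close> is shown to be prime.\<close>

lemma ideal_quotient:
  assumes P: "mv_ideal A P" and y: "y \<in> carrier A"
  shows "mv_ideal A {u \<in> carrier A. u \<triangle> y \<in> P}" (is "mv_ideal A ?I")
    and "P \<subseteq> {u \<in> carrier A. u \<triangle> y \<in> P}"
proof -
  have sub: "P \<subseteq> carrier A" using P by (simp add: mv_ideal_def)
  have down: "u \<in> P" if "u \<preceq> v" "v \<in> P" "u \<in> carrier A" for u v
    using P that by (auto simp: mv_ideal_def)
  show *: "P \<subseteq> ?I"
  proof
    fix u assume u: "u \<in> P"
    then have "u \<triangle> y \<in> P" using sub y by (intro down[OF meet_le1 u]) auto
    then show "u \<in> ?I" using u sub by blast
  qed
  show "mv_ideal A ?I" unfolding mv_ideal_def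
  proof (intro conjI ballI impI)
    show "?I \<noteq> {}" using * P by (auto simp: mv_ideal_def)
    show "u \<in> ?I" if u: "u \<in> carrier A" "v \<in> ?I" "u \<preceq> v" for u v
    proof -
      have "u \<triangle> y \<preceq> v"
        using u y by (intro le_trans[OF meet_le1 u(3)]) auto
      then have "u \<triangle> y \<preceq> v \<triangle> y"
        using u y by (intro le_meet meet_le2) auto
      then show ?thesis using down u y by auto
    qed
    show "u \<oplus> v \<in> ?I" if uv: "u \<in> ?I" "v \<in> ?I" for u v
    proof -
      have "(u \<triangle> y) \<oplus> (v \<triangle> y) \<in> P"
        using P uv by (auto simp: mv_ideal_def)
      then show ?thesis using down[OF oplus_meet_le] uv y by auto
    qed
  qed auto
qed

text \<open>An ideal maximal among those omitting \<open>z\<close> contains a member of every pair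
  with meet zero. By prelinearity the two differences of \<open>x\<close> and \<open>y\<close> form
  such a pair.\<close>

lemma prime_ideal_exists:
  assumes z: "z \<in> carrier A" "z \<noteq> \<zero>"
  obtains P where "mv_ideal A P" "z \<notin> P"
    "\<And>x y. \<lbrakk>x \<in> carrier A; y \<in> carrier A\<rbrakk> \<Longrightarrow> x \<ominus> y \<in> P \<or> y \<ominus> x \<in> P"
proof -
  let ?S = "{I. mv_ideal A I \<and> z \<notin> I}"
  have "{\<zero>} \<in> ?S"
    using z le_antisym[of _ "\<zero>"] by (auto simp: mv_ideal_def)
  then have ne: "?S \<noteq> {}" by blast
  have "\<exists>M\<in>?S. \<forall>X\<in>?S. M \<subseteq> X \<longrightarrow> X = M"
  proof (rule subset_Zorn_nonempty[OF ne])
    fix \<C> assume \<C>: "\<C> \<noteq> {}" "subset.chain ?S \<C>"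
    then have id: "mv_ideal A I" if "I \<in> \<C>" for I
      using that by (auto simp: subset.chain_def)
    have "mv_ideal A (\<Union>\<C>)" unfolding mv_ideal_def
    proof (intro conjI ballI impI)
      show "\<Union>\<C> \<subseteq> carrier A"
        by (rule Union_least) (simp add: id[unfolded mv_ideal_def])
      obtain I where "I \<in> \<C>" using \<C> by blast
      then show "\<Union>\<C> \<noteq> {}" using id[of I] by (auto simp: mv_ideal_def)
      show "x \<in> \<Union>\<C>" if xy: "x \<in> carrier A" "y \<in> \<Union>\<C>" "x \<preceq> y" for x y
      proof -
        obtain I where I: "I \<in> \<C>" "y \<in> I" using xy by blast
        then have "x \<in> I" using id[of I] xy by (auto simp: mv_ideal_def)
        then show ?thesis using I by blast
      qed
      fix x y assume "x \<in> \<Union>\<C>" "y \<in> \<Union>\<C>"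
      then obtain I J where IJ: "I \<in> \<C>" "J \<in> \<C>" "x \<in> I" "y \<in> J" by blast
      then have "I \<subseteq> J \<or> J \<subseteq> I" using \<C> by (auto simp: subset.chain_def)
      with IJ obtain K where K: "K \<in> \<C>" "x \<in> K" "y \<in> K" by blast
      then have "x \<oplus> y \<in> K" using id[of K] by (simp add: mv_ideal_def)
      then show "x \<oplus> y \<in> \<Union>\<C>" using K by blast
    qed
    then show "\<Union>\<C> \<in> ?S" using \<C> by (auto simp: subset.chain_def)
  qed
  then obtain P where P: "mv_ideal A P" "z \<notin> P"
    and max: "\<And>I. \<lbrakk>mv_ideal A I; z \<notin> I; P \<subseteq> I\<rbrakk> \<Longrightarrow> I = P"
    by blast
  have zero: "\<zero> \<in> P" using P(1) by (rule ideal_zero)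
  have prime: "x \<in> P \<or> y \<in> P" if xy: "x \<in> carrier A" "y \<in> carrier A" "x \<triangle> y = \<zero>" for x y
  \<comment> \<open>If \<open>z \<triangle> y\<close> is outside \<open>P\<close>, maximality
    applies to the colon ideal of \<open>y\<close>, which contains \<open>x\<close>. Otherwise it
    applies to the colon ideal of \<open>z\<close>, which contains \<open>y\<close> and omits
    \<open>z\<close> because \<open>z \<triangle> z = z\<close>.\<close>
  proof (cases "z \<triangle> y \<in> P")
    case False
    then have "{u \<in> carrier A. u \<triangle> y \<in> P} = P"
      by (intro max ideal_quotient[OF P(1) xy(2)]) simp
    moreover have "x \<in> {u \<in> carrier A. u \<triangle> y \<in> P}" using xy zero by simp
    ultimately show ?thesis by simp
  next
    case True
    have "z \<triangle> z = z" using z by simp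
    then have "{u \<in> carrier A. u \<triangle> z \<in> P} = P"
      by (intro max ideal_quotient[OF P(1) z(1)]) (simp add: P(2))
    moreover have "y \<triangle> z \<in> P" using True meet_comm[OF xy(2) z(1)] by (simp only:)
    then have "y \<in> {u \<in> carrier A. u \<triangle> z \<in> P}" using xy by simp
    ultimately show ?thesis by simp
  qed
  show thesis
    by (rule that[OF P]) (rule prime, simp_all only: prelinear closed)
qed

end

locale mv_chain = mv_algebra +
  assumes total: "\<lbrakk>x \<in> carrier A; y \<in> carrier A\<rbrakk> \<Longrightarrow> x \<preceq> y \<or> y \<preceq> x"

context mv_algebra
begin

text \<open>The quotient by a prime ideal omitting \<open>z\<close>: two elements are identified
  when both differences lie in the ideal, and primeness makes one difference of any two elements
  vanish.\<close>

lemma chain_quotient: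
  assumes z: "z \<in> carrier A" "z \<noteq> \<zero>"
  obtains B :: "'b set mv" and h where "mv_chain B" "h \<in> mv_hom A B" "h z \<noteq> mvzero B"
proof -
  obtain P where P: "mv_ideal A P" "z \<notin> P"
    and prime: "\<And>x y. \<lbrakk>x \<in> carrier A; y \<in> carrier A\<rbrakk> \<Longrightarrow> x \<ominus> y \<in> P \<or> y \<ominus> x \<in> P"
    using prime_ideal_exists[OF z] by metis
  have sub: "P \<subseteq> carrier A" and P_plus: "\<And>x y. \<lbrakk>x \<in> P; y \<in> P\<rbrakk> \<Longrightarrow> x \<oplus> y \<in> P"
    using P by (auto simp: mv_ideal_def)
  have down: "u \<in> P" if "u \<preceq> v" "v \<in> P" "u \<in> carrier A" for u v
    using P that by (auto simp: mv_ideal_def)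
  have zero: "\<zero> \<in> P" using P(1) by (rule ideal_zero)
  define R where "R = {(x, y). x \<in> carrier A \<and> y \<in> carrier A \<and> x \<ominus> y \<in> P \<and> y \<ominus> x \<in> P}"
  have diff_trans: "x \<ominus> v \<in> P"
    if "x \<ominus> y \<in> P" "y \<ominus> v \<in> P" "x \<in> carrier A" "y \<in> carrier A" "v \<in> carrier A" for x y v
  proof -
    have "x \<preceq> (v \<oplus> (y \<ominus> v)) \<oplus> (x \<ominus> y)"
      using that by (intro le_trans[OF le_oplus_diff[of x y] oplus_mono]) (auto intro: le_oplus_diff)
    then have "x \<ominus> v \<preceq> (y \<ominus> v) \<oplus> (x \<ominus> y)"
      using that by (simp add: diff_le_iff oplus_assoc)
    then show ?thesis using down P_plus that by blast
  qed
  have diff_plus: "(x \<oplus> u) \<ominus> (y \<oplus> v) \<in> P"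
    if "x \<ominus> y \<in> P" "u \<ominus> v \<in> P" "x \<in> carrier A" "y \<in> carrier A" "u \<in> carrier A" "v \<in> carrier A"
    for x y u v
  proof -
    have "x \<oplus> u \<preceq> (y \<oplus> (x \<ominus> y)) \<oplus> (v \<oplus> (u \<ominus> v))"
      using that by (intro oplus_mono le_oplus_diff) auto
    also have "\<dots> = (y \<oplus> v) \<oplus> ((x \<ominus> y) \<oplus> (u \<ominus> v))"
      using that by (simp add: oplus_ac)
    finally have "(x \<oplus> u) \<ominus> (y \<oplus> v) \<preceq> (x \<ominus> y) \<oplus> (u \<ominus> v)"
      using that by (simp only: diff_le_iff closed)
    then show ?thesis using down P_plus that by blast
  qed
  have equiv: "equiv (carrier A) R"
    by (rule equivI) (auto simp: R_def refl_on_def sym_def trans_def zero intro: diff_trans)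
  define h where "h = (\<lambda>x\<in>carrier A. R `` {x})"
  \<comment> \<open>The operations of the quotient are computed on chosen representatives;
    \<open>plus\<close> and \<open>neg\<close> below show that the choice does not matter.\<close>
  define rep where "rep = (\<lambda>C::'b set. SOME x. x \<in> C)"
  have h_eq: "h x = h y \<longleftrightarrow> (x, y) \<in> R" if "x \<in> carrier A" "y \<in> carrier A" for x y
    using that eq_equiv_class_iff[OF equiv] by (simp add: h_def)
  have rep: "(x, rep (h x)) \<in> R" if "x \<in> carrier A" for x
  proof -
    have "x \<in> R `` {x}" using that equiv by (auto simp: equiv_def refl_on_def)
    then have "rep (R `` {x}) \<in> R `` {x}" unfolding rep_def by (rule someI)
    then show ?thesis using that by (simp add: h_def)
  qed
  define B :: "'b set mv" where "B = \<lparr>carrier = h ` carrier A,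
    oplus = (\<lambda>C D. h (rep C \<oplus> rep D)), mvneg = (\<lambda>C. h (\<sim>(rep C))), mvzero = h \<zero>\<rparr>"
  have rep_cl [simp]: "rep (h x) \<in> carrier A" if "x \<in> carrier A" for x
    using rep[OF that] by (simp add: R_def)
  have plus: "oplus B (h x) (h y) = h (x \<oplus> y)" if xy: "x \<in> carrier A" "y \<in> carrier A" for x y
  proof -
    have "(x \<oplus> y, rep (h x) \<oplus> rep (h y)) \<in> R"
      using rep[OF xy(1)] rep[OF xy(2)] by (auto simp: R_def intro: diff_plus)
    then show ?thesis using xy by (simp add: B_def h_eq[symmetric])
  qed
  have neg: "mvneg B (h x) = h (\<sim>x)" if x: "x \<in> carrier A" for x
  proof -
    have "(\<sim>x, \<sim>(rep (h x))) \<in> R"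
      using rep[OF x] by (auto simp: R_def oplus_comm)
    then show ?thesis using x by (simp add: B_def h_eq[symmetric])
  qed
  have car: "carrier B = h ` carrier A" and zeroB: "mvzero B = h \<zero>" by (simp_all add: B_def)
  have "mv_algebra B"
  proof
    show "\<sim>\<^bsub>B\<^esub> x \<in> carrier B" "\<sim>\<^bsub>B\<^esub> (\<sim>\<^bsub>B\<^esub> x) = x" "\<sim>\<^bsub>B\<^esub> \<zero>\<^bsub>B\<^esub> \<oplus>\<^bsub>B\<^esub> x = \<sim>\<^bsub>B\<^esub> \<zero>\<^bsub>B\<^esub>"
      if "x \<in> carrier B" for x
      using that by (auto simp: car neg plus zeroB)
    show "\<sim>\<^bsub>B\<^esub> (\<sim>\<^bsub>B\<^esub> x \<oplus>\<^bsub>B\<^esub> y) \<oplus>\<^bsub>B\<^esub> y = \<sim>\<^bsub>B\<^esub> (\<sim>\<^bsub>B\<^esub> y \<oplus>\<^bsub>B\<^esub> x) \<oplus>\<^bsub>B\<^esub> x"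
      if "x \<in> carrier B" "y \<in> carrier B" for x y
      using that lukasiewicz by (auto simp: car neg plus)
  qed (auto simp: car plus zeroB oplus_ac)
  then interpret B: mv_algebra B .
  have le: "h x \<preceq>\<^bsub>B\<^esub> h y" if "x \<ominus> y \<in> P" "x \<in> carrier A" "y \<in> carrier A" for x y
  proof -
    have "(x \<ominus> y, \<zero>) \<in> R" using that zero by (simp add: R_def)
    then have "\<sim>\<^bsub>B\<^esub> (\<sim>\<^bsub>B\<^esub> (h x) \<oplus>\<^bsub>B\<^esub> h y) = \<zero>\<^bsub>B\<^esub>"
      using that by (simp add: neg plus zeroB h_eq)
    then show ?thesis using that by (simp add: B.diff_eq_zero_iff car)
  qed
  have "mv_chain B"
  proof
    fix C D assume "C \<in> carrier B" "D \<in> carrier B"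
    then obtain x y where xy: "x \<in> carrier A" "y \<in> carrier A" and "C = h x" "D = h y"
      by (auto simp: car)
    then show "C \<preceq>\<^bsub>B\<^esub> D \<or> D \<preceq>\<^bsub>B\<^esub> C" using prime[OF xy] le by metis
  qed
  moreover have "h \<in> carrier A \<rightarrow>\<^sub>E carrier B"
    unfolding car by (rule PiE_I) (auto simp: h_def)
  then have "h \<in> mv_hom A B"
    by (simp add: mv_hom_def zeroB neg plus)
  moreover have "h z \<noteq> mvzero B"
    using z P(2) by (simp add: zeroB h_eq R_def)
  ultimately show thesis by (rule that)
qed

end

subsection \<open>The totally ordered group of an MV-chain\<close>

context mv_algebra
begin

lemma odot_closed [simp, intro]: "\<lbrakk>x \<in> carrier A; y \<in> carrier A\<rbrakk> \<Longrightarrow> x \<odot> y \<in> carrier A"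
  by (simp add: odot_def)

lemma odot_comm: "\<lbrakk>x \<in> carrier A; y \<in> carrier A\<rbrakk> \<Longrightarrow> x \<odot> y = y \<odot> x"
  by (simp add: odot_def oplus_comm)

lemma neg_odot: "\<lbrakk>x \<in> carrier A; y \<in> carrier A\<rbrakk> \<Longrightarrow> \<sim>(x \<odot> y) = \<sim>x \<oplus> \<sim>y"
  by (simp add: odot_def)

lemma neg_oplus_odot: "\<lbrakk>x \<in> carrier A; y \<in> carrier A\<rbrakk> \<Longrightarrow> \<sim>(x \<oplus> y) = \<sim>x \<odot> \<sim>y"
  by (simp add: odot_def)

lemma odot_simps [simp]:
  assumes "x \<in> carrier A"
  shows "\<zero> \<odot> x = \<zero>" "x \<odot> \<zero> = \<zero>" "\<one>\<^sub>M \<odot> x = x" "x \<odot> \<one>\<^sub>M = x" "x \<odot> \<sim>x = \<zero>" "\<sim>x \<odot> x = \<zero>"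
  using assms by (simp_all add: odot_def)

lemma odot_assoc:
  "\<lbrakk>x \<in> carrier A; y \<in> carrier A; z \<in> carrier A\<rbrakk> \<Longrightarrow> x \<odot> y \<odot> z = x \<odot> (y \<odot> z)"
  by (simp add: odot_def oplus_assoc)

lemma neg_inject: "\<lbrakk>x \<in> carrier A; y \<in> carrier A; \<sim>x = \<sim>y\<rbrakk> \<Longrightarrow> x = y"
  by (metis neg_neg)

lemma odot_eq_zero_iff: "\<lbrakk>x \<in> carrier A; y \<in> carrier A\<rbrakk> \<Longrightarrow> x \<odot> y = \<zero> \<longleftrightarrow> x \<preceq> \<sim>y"
  using diff_eq_zero_iff[of x "\<sim>y"] by (simp add: odot_def)

lemma odot_le1: "\<lbrakk>x \<in> carrier A; y \<in> carrier A\<rbrakk> \<Longrightarrow> x \<odot> y \<preceq> x"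
  using le_oplus1[of "\<sim>x" "\<sim>y"] neg_le_neg[of "x \<odot> y" x] by (simp add: neg_odot)

lemma one_le_iff: "x \<in> carrier A \<Longrightarrow> \<one>\<^sub>M \<preceq> x \<longleftrightarrow> x = \<one>\<^sub>M"
  using le_antisym[of "\<one>\<^sub>M" x] by auto

text \<open>The hypotheses say that \<open>a + b\<close> does not exceed 1 while
  \<open>b + c\<close> reaches 1, so that both sides stand for \<open>a + b + c - 1\<close>. The gap
  \<open>d\<close> between \<open>a \<oplus> b\<close> and 1 is a summand of both
  \<open>\<sim>b\<close> and \<open>c\<close>; cancelling it in \<open>c\<close> gives the
  identity.\<close>

lemma oplus_odot_carry:
  assumes abc: "a \<in> carrier A" "b \<in> carrier A" "c \<in> carrier A"
    and ab: "a \<odot> b = \<zero>" and bc: "b \<oplus> c = \<one>\<^sub>M"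
  shows "(a \<oplus> b) \<odot> c = a \<oplus> (b \<odot> c)"
proof -
  define d where "d = \<sim>(a \<oplus> b)"
  have d [simp]: "d \<in> carrier A" using abc by (simp add: d_def)
  have "a \<oplus> (\<sim>b \<ominus> a) = \<sim>b"
    using ab abc by (intro le_imp_oplus_diff) (simp_all add: odot_eq_zero_iff)
  then have b: "\<sim>b = a \<oplus> d" using abc by (simp add: d_def oplus_comm)
  have "\<sim>b \<oplus> (c \<ominus> \<sim>b) = c"
    using bc abc by (intro le_imp_oplus_diff) (simp_all add: mvle_def)
  then have "c = \<sim>b \<oplus> (b \<odot> c)" using abc by (simp add: odot_def oplus_comm)
  also have "\<dots> = (a \<oplus> (b \<odot> c)) \<oplus> d" unfolding b using abc by (simp add: oplus_ac)
  finally have c: "c = (a \<oplus> (b \<odot> c)) \<oplus> d" .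
  have "a \<oplus> (b \<odot> c) \<preceq> \<sim>d"
    using abc oplus_mono[OF le_refl odot_le1, of a b c] by (simp add: d_def)
  then have "((a \<oplus> (b \<odot> c)) \<oplus> d) \<ominus> d = a \<oplus> (b \<odot> c)"
    using abc by (intro oplus_diff_cancel) simp_all
  then have "c \<ominus> d = a \<oplus> (b \<odot> c)" using c by simp
  moreover have "(a \<oplus> b) \<odot> c = c \<ominus> d" using abc by (simp add: odot_def d_def oplus_comm)
  ultimately show ?thesis by simp
qed

end

context mv_chain
begin

text \<open>By totality \<open>a\<close> lies below \<open>\<sim>b\<close>, and the product
  vanishes, or above it, and the sum is 1.\<close>

lemma oplus_ne_one: "\<lbrakk>a \<in> carrier A; b \<in> carrier A; a \<oplus> b \<noteq> \<one>\<^sub>M\<rbrakk> \<Longrightarrow> a \<odot> b = \<zero>"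
  using total[of a "\<sim>b"] by (auto simp: odot_eq_zero_iff) (simp add: mvle_def oplus_comm)

text \<open>Neither \<open>a + b\<close> nor \<open>b + c\<close> exceeds 1, and both sides stand
  for \<open>max 0 (a + b + c - 1)\<close>. Comparing \<open>c\<close> with the gap \<open>d\<close>
  above \<open>a \<oplus> b\<close> decides which argument of the maximum counts.\<close>

lemma oplus_odot_no_carry:
  assumes abc: "a \<in> carrier A" "b \<in> carrier A" "c \<in> carrier A"
    and ab: "a \<odot> b = \<zero>" and bc: "b \<odot> c = \<zero>"
  shows "(a \<oplus> b) \<odot> c = a \<odot> (b \<oplus> c)"
proof -
  define d where "d = \<sim>(a \<oplus> b)"
  have d [simp]: "d \<in> carrier A" using abc by (simp add: d_def)
  have "a \<oplus> (\<sim>b \<ominus> a) = \<sim>b"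
    using ab abc by (intro le_imp_oplus_diff) (simp_all add: odot_eq_zero_iff)
  then have nb: "\<sim>b = a \<oplus> d" using abc by (simp add: d_def oplus_comm)
  have "b \<oplus> (\<sim>a \<ominus> b) = \<sim>a"
    using ab abc by (intro le_imp_oplus_diff) (simp_all add: odot_eq_zero_iff odot_comm[of a b])
  then have na: "\<sim>a = b \<oplus> d" using abc by (simp add: d_def oplus_comm)
  have lhs: "(a \<oplus> b) \<odot> c = c \<ominus> d" using abc by (simp add: odot_def d_def oplus_comm)
  have rhs: "a \<odot> (b \<oplus> c) = a \<ominus> \<sim>(b \<oplus> c)" using abc by (simp add: odot_def)
  consider "c \<preceq> d" | "d \<preceq> c" using total[OF abc(3) d] by blast
  then show ?thesis
  proof cases
    case 1
    then have "b \<oplus> c \<preceq> \<sim>a" unfolding na using abc by (intro oplus_mono) auto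
    then have "a \<preceq> \<sim>(b \<oplus> c)" using abc neg_le_neg[of "b \<oplus> c" "\<sim>a"] by simp
    then have "a \<ominus> \<sim>(b \<oplus> c) = \<zero>" using abc by (subst diff_eq_zero_iff) auto
    moreover have "c \<ominus> d = \<zero>" using 1 abc by (subst diff_eq_zero_iff) auto
    ultimately show ?thesis using lhs rhs by simp
  next
    case 2
    define c' where "c' = c \<ominus> d"
    have c' [simp]: "c' \<in> carrier A" using abc by (simp add: c'_def)
    have "c = d \<oplus> c'" unfolding c'_def using 2 abc by (intro le_imp_oplus_diff[symmetric]) auto
    then have bc': "b \<oplus> c = \<sim>a \<oplus> c'" unfolding na using abc by (simp add: oplus_assoc)
    \<comment> \<open>The right-hand side is now \<open>a \<odot> (\<sim>a \<oplus> c')\<close>, the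
      meet of \<open>a\<close> and \<open>c'\<close>; it equals \<open>c'\<close> because the
      absence of a carry in \<open>b\<close>, \<open>c\<close> puts \<open>c'\<close> below
      \<open>a\<close>.\<close>
    have "c \<preceq> \<sim>b" using bc abc by (simp add: odot_eq_zero_iff odot_comm[of b c])
    then have "c' \<preceq> a" unfolding c'_def nb using abc by (subst diff_le_iff) (simp_all add: oplus_comm)
    then have "c' \<triangle> a = c'" using abc by (simp add: mvle_def)
    then show ?thesis unfolding lhs rhs bc' c'_def[symmetric]
      using meet_comm[of c' a] abc by (simp add: odot_def)
  qed
qed

text \<open>The de Morgan dual of the previous identity: a sum equal to 1 is a product of negations
  equal to 0.\<close>

lemma odot_oplus_both_carry:
  assumes abc: "a \<in> carrier A" "b \<in> carrier A" "c \<in> carrier A"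
    and ab: "a \<oplus> b = \<one>\<^sub>M" and bc: "b \<oplus> c = \<one>\<^sub>M"
  shows "(a \<odot> b) \<oplus> c = a \<oplus> (b \<odot> c)"
proof -
  have "\<sim>a \<odot> \<sim>b = \<zero>" "\<sim>b \<odot> \<sim>c = \<zero>" using abc ab bc by (simp_all add: neg_oplus_odot[symmetric])
  then have "(\<sim>a \<oplus> \<sim>b) \<odot> \<sim>c = \<sim>a \<odot> (\<sim>b \<oplus> \<sim>c)"
    using abc by (intro oplus_odot_no_carry) auto
  then have "\<sim>((a \<odot> b) \<oplus> c) = \<sim>(a \<oplus> (b \<odot> c))"
    using abc by (simp add: neg_oplus_odot neg_odot)
  then show ?thesis using abc by (intro neg_inject[of "(a \<odot> b) \<oplus> c" "a \<oplus> (b \<odot> c)"]) auto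
qed

text \<open>Chang's construction: \<open>(m, a)\<close> stands for the sum of \<open>m\<close> copies of the unit and \<open>a\<close>, so
  that the nonnegative elements are those with \<open>0 \<le> m\<close>.\<close>

definition chang_mult :: "int \<times> 'a \<Rightarrow> int \<times> 'a \<Rightarrow> int \<times> 'a" where
  "chang_mult x y = (if snd x \<oplus> snd y = \<one>\<^sub>M then (fst x + fst y + 1, snd x \<odot> snd y)
    else (fst x + fst y, snd x \<oplus> snd y))"

text \<open>The pair \<open>(m, 1)\<close> would denote the same element as
  \<open>(m + 1, 0)\<close>; excluding 1 from the second components makes names unique.\<close>

definition chang_group :: "(int \<times> 'a) monoid" where
  "chang_group = \<lparr>carrier = UNIV \<times> (carrier A - {\<one>\<^sub>M}), monoid.mult = chang_mult, one = (0, \<zero>)\<rparr>"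

lemma odot_ne_one: "\<lbrakk>a \<in> carrier A; b \<in> carrier A; a \<noteq> \<one>\<^sub>M\<rbrakk> \<Longrightarrow> a \<odot> b \<noteq> \<one>\<^sub>M"
  using odot_le1[of a b] by (auto simp: one_le_iff)

text \<open>Each combination of carries in \<open>a \<oplus> b\<close> and
  \<open>b \<oplus> c\<close> is settled by one of the identities above. The two mixed combinations
  are mirror images, so \<open>mixed\<close> is stated for arbitrary elements and reused with
  \<open>a\<close> and \<open>c\<close> exchanged.\<close>

lemma chang_mult_assoc:
  assumes abc: "a \<in> carrier A" "b \<in> carrier A" "c \<in> carrier A"
    and ne: "a \<noteq> \<one>\<^sub>M" "b \<noteq> \<one>\<^sub>M" "c \<noteq> \<one>\<^sub>M"
  shows "chang_mult (chang_mult (i, a) (j, b)) (k, c) = chang_mult (i, a) (chang_mult (j, b) (k, c))"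
proof -
  have mixed: "chang_mult (chang_mult (i, a) (j, b)) (k, c) = chang_mult (i, a) (chang_mult (j, b) (k, c))"
    if abc: "a \<in> carrier A" "b \<in> carrier A" "c \<in> carrier A"
      and ab: "a \<oplus> b \<noteq> \<one>\<^sub>M" and bc: "b \<oplus> c = \<one>\<^sub>M" for a b c i j k
  proof -
    have eq: "(a \<oplus> b) \<odot> c = a \<oplus> (b \<odot> c)"
      using abc ab bc by (intro oplus_odot_carry oplus_ne_one)
    moreover have "a \<oplus> (b \<odot> c) \<noteq> \<one>\<^sub>M"
      unfolding eq[symmetric] using abc ab by (intro odot_ne_one) auto
    moreover have "a \<oplus> b \<oplus> c = \<one>\<^sub>M" using abc bc by (simp add: oplus_assoc)
    ultimately show ?thesis using ab bc by (simp add: chang_mult_def)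
  qed
  have comm: "chang_mult (i, a) (j, b) = chang_mult (j, b) (i, a)"
    if "a \<in> carrier A" "b \<in> carrier A" for a b i j
    using that by (simp add: chang_mult_def oplus_comm odot_comm)
  have comm': "chang_mult (i, a) (chang_mult (j, b) (k, c)) = chang_mult (chang_mult (j, b) (k, c)) (i, a)"
    if "a \<in> carrier A" "b \<in> carrier A" "c \<in> carrier A" for a b c i j k
    using comm[of a] that by (simp add: chang_mult_def[of "(j, b)"])
  consider "a \<oplus> b \<noteq> \<one>\<^sub>M" "b \<oplus> c = \<one>\<^sub>M" | "a \<oplus> b = \<one>\<^sub>M" "b \<oplus> c \<noteq> \<one>\<^sub>M"
    | "a \<oplus> b \<noteq> \<one>\<^sub>M" "b \<oplus> c \<noteq> \<one>\<^sub>M" | "a \<oplus> b = \<one>\<^sub>M" "b \<oplus> c = \<one>\<^sub>M" by blast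
  then show ?thesis
  proof cases
    case 1
    then show ?thesis using mixed abc by blast
  next
    case 2
    then have "chang_mult (chang_mult (k, c) (j, b)) (i, a) = chang_mult (k, c) (chang_mult (j, b) (i, a))"
      using abc by (intro mixed) (simp_all add: oplus_comm)
    then show ?thesis using abc by (simp add: comm' comm[of c b] comm[of b a])
  next
    case 3
    have "(a \<oplus> b) \<odot> c = a \<odot> (b \<oplus> c)"
      using abc 3 by (intro oplus_odot_no_carry oplus_ne_one)
    then show ?thesis using 3 abc by (simp add: chang_mult_def oplus_assoc)
  next
    case 4
    have "(a \<odot> b) \<oplus> c = a \<oplus> (b \<odot> c)"
      using abc 4 by (intro odot_oplus_both_carry)
    then show ?thesis using 4 abc by (simp add: chang_mult_def odot_assoc)
  qed
qed

lemma comm_group_chang: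
  assumes "\<zero> \<noteq> \<one>\<^sub>M"
  shows "comm_group chang_group"
proof (rule comm_groupI)
  fix x y z assume "x \<in> carrier chang_group" "y \<in> carrier chang_group" "z \<in> carrier chang_group"
  then show "x \<otimes>\<^bsub>chang_group\<^esub> y \<otimes>\<^bsub>chang_group\<^esub> z = x \<otimes>\<^bsub>chang_group\<^esub> (y \<otimes>\<^bsub>chang_group\<^esub> z)"
    by (auto simp: chang_group_def intro: chang_mult_assoc)
next
  fix x y assume "x \<in> carrier chang_group" "y \<in> carrier chang_group"
  then show "x \<otimes>\<^bsub>chang_group\<^esub> y \<in> carrier chang_group"
    by (auto simp: chang_group_def chang_mult_def odot_ne_one)
next
  fix x assume x: "x \<in> carrier chang_group"
  show "\<exists>y\<in>carrier chang_group. y \<otimes>\<^bsub>chang_group\<^esub> x = \<one>\<^bsub>chang_group\<^esub>"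
  proof (cases "snd x = \<zero>")
    case True
    then show ?thesis using assms x
      by (intro bexI[of _ "(- fst x, \<zero>)"]) (auto simp: chang_group_def chang_mult_def)
  next
    case False
    then have "\<sim>(snd x) \<noteq> \<one>\<^sub>M" using x neg_neg[of "snd x"] by (auto simp: chang_group_def simp del: neg_neg)
    \<comment> \<open>The negative of \<open>m + a\<close> is
      \<open>(- m - 1) + (1 - a)\<close>.\<close>
    then show ?thesis using x
      by (intro bexI[of _ "(- fst x - 1, \<sim>(snd x))"]) (auto simp: chang_group_def chang_mult_def)
  qed
next
  fix x y assume "x \<in> carrier chang_group" "y \<in> carrier chang_group"
  then show "x \<otimes>\<^bsub>chang_group\<^esub> y = y \<otimes>\<^bsub>chang_group\<^esub> x"
    using oplus_comm[of "snd x" "snd y"] odot_comm[of "snd x" "snd y"]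
    by (auto simp: chang_group_def chang_mult_def)
qed (use assms in \<open>auto simp: chang_group_def chang_mult_def\<close>)

end

subsection \<open>Realising sign patterns of linear forms\<close>

lemma finite_sets_separated:
  fixes L U :: "'a :: {dense_linorder, no_top, no_bot} set"
  assumes "finite L" "finite U" "\<And>l u. \<lbrakk>l \<in> L; u \<in> U\<rbrakk> \<Longrightarrow> l < u"
  obtains c where "\<And>l. l \<in> L \<Longrightarrow> l < c" "\<And>u. u \<in> U \<Longrightarrow> c < u"
proof (cases "L = {} \<or> U = {}")
  case True
  then show ?thesis
  proof
    assume L: "L = {}"
    obtain c where "\<forall>u\<in>U. c < u"
      using lt_ex[of "Min U"] assms(2) by (cases "U = {}") auto
    with L that show ?thesis by blast
  next
    assume U: "U = {}"
    obtain c where "\<forall>l\<in>L. l < c"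
      using gt_ex[of "Max L"] assms(1) by (cases "L = {}") auto
    with U that show ?thesis by blast
  qed
next
  case False
  then have "Max L < Min U" using assms by simp
  then obtain c where "Max L < c" "c < Min U" using dense by blast
  with False that[of c] assms show ?thesis by auto
qed

text \<open>\<open>N\<close> collects the integer linear forms that count as nonnegative, for a
  total preorder. A form that lies in \<open>N\<close> together with its negative counts as
  zero.\<close>

locale form_cone =
  fixes N :: "('i \<Rightarrow> int) set"
  assumes add: "\<lbrakk>f \<in> N; g \<in> N\<rbrakk> \<Longrightarrow> (\<lambda>i. f i + g i) \<in> N"
    and total: "f \<in> N \<or> (\<lambda>i. - f i) \<in> N"
begin

lemma zero_form: "(\<lambda>i. 0) \<in> N"
  using total[of "\<lambda>i. 0"] by simp

lemma scale_nat: "f \<in> N \<Longrightarrow> (\<lambda>i. int n * f i) \<in> N"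
  by (induction n) (use zero_form add in \<open>auto simp: algebra_simps\<close>)

lemma scale: "\<lbrakk>f \<in> N; 0 \<le> k\<rbrakk> \<Longrightarrow> (\<lambda>i. k * f i) \<in> N"
  using scale_nat[of f "nat k"] by simp

text \<open>If \<open>f\<close> were not in \<open>N\<close>, its negative would be; adding
  \<open>k - 1\<close> copies of the negative to \<open>k f\<close> gives \<open>f\<close>
  back.\<close>

lemma unscale:
  assumes "(\<lambda>i. k * f i) \<in> N" "0 < k"
  shows "f \<in> N"
proof (rule ccontr)
  assume "f \<notin> N"
  then have "(\<lambda>i. - f i) \<in> N" using total by blast
  then have "(\<lambda>i. (k - 1) * - f i) \<in> N" using assms(2) scale[of "\<lambda>i. - f i" "k - 1"] by simp
  from add[OF assms(1) this] have "f \<in> N" by (simp add: algebra_simps)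
  with \<open>f \<notin> N\<close> show False ..
qed

text \<open>Fourier--Motzkin elimination: the forms in which a variable occurs, normalised to have
  a positive coefficient, are compared by the forms \<open>h f g\<close> below, which do not contain it.\<close>

lemma realise_signs:
  assumes "finite V" "finite F" "\<And>f i. \<lbrakk>f \<in> F; i \<notin> V\<rbrakk> \<Longrightarrow> f i = 0"
  shows "\<exists>w :: 'i \<Rightarrow> real. \<forall>f\<in>F. f \<in> N \<longleftrightarrow> 0 \<le> (\<Sum>i\<in>V. of_int (f i) * w i)"
  using assms
proof (induction V arbitrary: F rule: finite_induct)
  case empty
  then have "f \<in> N" if "f \<in> F" for f using that zero_form by (metis empty_iff ext)
  then show ?case by simp
next
  case (insert x V)
  define m where "m f = (\<lambda>i. - f i)" for f :: "'i \<Rightarrow> int"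
  define h where "h f g = (\<lambda>i. g x * f i - f x * g i)" for f g :: "'i \<Rightarrow> int"
  \<comment> \<open>With the negatives adjoined, a form whose coefficient at \<open>x\<close> is
    negative is handled through its negative, which belongs to \<open>P\<close>.\<close>
  define F1 where "F1 = F \<union> m ` F"
  define P where "P = {f \<in> F1. f x > 0}"
  define F' where "F' = {f \<in> F1. f x = 0} \<union> (\<lambda>(f, g). h f g) ` (P \<times> P)"
  have F1_0: "f i = 0" if "f \<in> F1" "i \<notin> V" "i \<noteq> x" for f i
    using that insert.prems(2) by (auto simp: F1_def m_def)
  have "finite F'" using insert.prems by (simp add: F'_def P_def F1_def)
  moreover have "f i = 0" if f: "f \<in> F'" and i: "i \<notin> V" for f i
  proof -
    consider "f \<in> F1" "f x = 0" | g k where "g \<in> F1" "k \<in> F1" "f = h g k"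
      using f by (auto simp: F'_def P_def)
    then show ?thesis
    proof cases
      case 1
      then show ?thesis using F1_0[of f i] i by (cases "i = x") simp_all
    next
      case (2 g k)
      then show ?thesis using F1_0[of g i] F1_0[of k i] i by (cases "i = x") (simp_all add: h_def)
    qed
  qed
  ultimately have "\<exists>w :: 'i \<Rightarrow> real. \<forall>f\<in>F'. f \<in> N \<longleftrightarrow> 0 \<le> (\<Sum>i\<in>V. of_int (f i) * w i)"
    by (rule insert.IH)
  then obtain w :: "'i \<Rightarrow> real"
    where w: "\<And>f. f \<in> F' \<Longrightarrow> f \<in> N \<longleftrightarrow> 0 \<le> (\<Sum>i\<in>V. of_int (f i) * w i)"
    by blast
  define L where "L f = (\<Sum>i\<in>V. of_int (f i) * w i)" for f :: "'i \<Rightarrow> int"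
  \<comment> \<open>The root of \<open>f\<close> as a function of the coordinate \<open>x\<close>,
    the other coordinates being given by \<open>w\<close>. For \<open>f\<close> in \<open>P\<close>,
    the form is nonnegative exactly from \<open>r f\<close> upwards.\<close>
  define r where "r f = - L f / of_int (f x)" for f
  have h: "h f g \<in> N \<longleftrightarrow> r f \<le> r g" if "f \<in> P" "g \<in> P" for f g
  proof -
    have L: "L (h f g) = of_int (g x) * L f - of_int (f x) * L g"
      by (simp add: L_def h_def sum_subtractf sum_distrib_left algebra_simps)
    have "of_int (f x) > (0 :: real)" "of_int (g x) > (0 :: real)"
      using that by (simp_all add: P_def)
    then have "r f \<le> r g \<longleftrightarrow> of_int (f x) * L g \<le> of_int (g x) * L f"
      by (simp add: r_def field_simps)
    then have "0 \<le> L (h f g) \<longleftrightarrow> r f \<le> r g"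
      using L by simp
    moreover have "h f g \<in> F'" using that by (auto simp: F'_def)
    ultimately show ?thesis using w[of "h f g"] by (simp add: L_def)
  qed
  \<comment> \<open>\<open>f \<in> N\<close> asks for a coordinate of at least \<open>r f\<close>,
    and \<open>m g \<in> N\<close> for one of at most \<open>r g\<close>. The induction hypothesis
    for \<open>h f g\<close> makes the two demands compatible.\<close>
  have le: "r f \<le> r g" if f: "f \<in> P" "f \<in> N" and g: "g \<in> P" "m g \<in> N" for f g
  proof -
    have "0 \<le> f x" "0 \<le> g x" using f g by (simp_all add: P_def)
    from add[OF scale[OF f(2) this(2)] scale[OF g(2) this(1)]]
    show ?thesis using h[OF f(1) g(1)] by (simp add: h_def m_def)
  qed
  have less: "r f < r g"
    if f: "f \<in> P" "f \<in> N" and g: "g \<in> P" "m g \<in> N" and strict: "m f \<notin> N \<or> g \<notin> N" for f g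
  proof (rule ccontr)
    assume "\<not> r f < r g"
    then have *: "h g f \<in> N" using h f g by auto
    have pos: "0 < f x" "0 < g x" using f g by (simp_all add: P_def)
    have "(\<lambda>i. g x * m f i) \<in> N"
      using add[OF * scale[OF g(2), of "f x"]] pos by (simp add: h_def m_def)
    then have "m f \<in> N" using unscale pos by blast
    moreover have "(\<lambda>i. f x * g i) \<in> N"
      using add[OF * scale[OF f(2), of "g x"]] pos by (simp add: h_def)
    then have "g \<in> N" using unscale pos by blast
    ultimately show False using strict by blast
  qed
  have tot: "f \<in> N \<or> m f \<in> N" for f using total by (simp add: m_def)
  have "\<exists>\<rho>. \<forall>f\<in>P. (f \<in> N \<longleftrightarrow> r f \<le> \<rho>) \<and> (m f \<in> N \<longleftrightarrow> \<rho> \<le> r f)"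
  \<comment> \<open>A form that counts as zero fixes the new coordinate at its root. Without such a
    form every demand is strict, and any value between the finitely many lower and upper bounds will
    do.\<close>
  proof (cases "\<exists>e\<in>P. e \<in> N \<and> m e \<in> N")
    case True
    then obtain e where e: "e \<in> P" "e \<in> N" "m e \<in> N" by blast
    have "(f \<in> N \<longleftrightarrow> r f \<le> r e) \<and> (m f \<in> N \<longleftrightarrow> r e \<le> r f)" if "f \<in> P" for f
      using le[OF that _ e(1,3)] le[OF e(1,2) that] less[OF that _ e(1,3)] less[OF e(1,2) that] tot[of f]
      by fastforce
    then show ?thesis by blast
  next
    case False
    have fin: "finite P" using insert.prems by (simp add: P_def F1_def)
    obtain \<rho> where \<rho>: "\<And>l. l \<in> r ` {f \<in> P. f \<in> N} \<Longrightarrow> l < \<rho>"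
        "\<And>u. u \<in> r ` {f \<in> P. m f \<in> N} \<Longrightarrow> \<rho> < u"
    proof (rule finite_sets_separated)
      show "finite (r ` {f \<in> P. f \<in> N})" "finite (r ` {f \<in> P. m f \<in> N})" using fin by simp_all
    qed (use less False in blast)+
    have "(f \<in> N \<longleftrightarrow> r f \<le> \<rho>) \<and> (m f \<in> N \<longleftrightarrow> \<rho> \<le> r f)" if "f \<in> P" for f
      using \<rho>(1)[of "r f"] \<rho>(2)[of "r f"] that False tot[of f] by force
    then show ?thesis by blast
  qed
  then obtain \<rho> where \<rho>: "\<And>f. f \<in> P \<Longrightarrow> f \<in> N \<longleftrightarrow> r f \<le> \<rho>" "\<And>f. f \<in> P \<Longrightarrow> m f \<in> N \<longleftrightarrow> \<rho> \<le> r f"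
    by blast
  define E where "E f = (\<Sum>i\<in>insert x V. of_int (f i) * (w(x := \<rho>)) i)" for f :: "'i \<Rightarrow> int"
  have E: "E f = of_int (f x) * \<rho> + L f" for f
  proof -
    have "(\<Sum>i\<in>V. of_int (f i) * (w(x := \<rho>)) i) = L f"
      unfolding L_def using insert.hyps by (intro sum.cong) auto
    then show ?thesis using insert.hyps by (simp add: E_def)
  qed
  have Em: "E (m f) = - E f" for f by (simp add: E_def m_def sum_negf)
  have EP: "(0 \<le> E f \<longleftrightarrow> r f \<le> \<rho>) \<and> (E f \<le> 0 \<longleftrightarrow> \<rho> \<le> r f)" if "f \<in> P" for f
    using that unfolding E by (auto simp: r_def P_def field_simps)
  have "f \<in> N \<longleftrightarrow> 0 \<le> E f" if f: "f \<in> F" for f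
  proof (cases "f x" "0 :: int" rule: linorder_cases)
    case less
    then have "m f \<in> P" using f by (auto simp: P_def F1_def m_def)
    moreover have "m (m f) = f" by (simp add: m_def)
    ultimately show ?thesis using \<rho>(2)[of "m f"] EP[of "m f"] Em[of f] by simp
  next
    case equal
    then show ?thesis using w[of f] f E[of f] by (simp add: F'_def F1_def L_def)
  next
    case greater
    then show ?thesis using \<rho>(1)[of f] EP[of f] f by (simp add: P_def F1_def)
  qed
  then show ?case unfolding E_def by blast
qed

end

subsection \<open>Local embeddings into the unit interval\<close>

text \<open>Only the arguments of the operations are confined to \<open>E\<close>; the results may
  lie outside. Enlarging \<open>E\<close> strengthens the condition, so the sets needed for several
  purposes can be united.\<close>

definition local_valuation :: "('b, 'm) mv_scheme \<Rightarrow> ('b \<Rightarrow> real) \<Rightarrow> 'b set \<Rightarrow> bool" where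
  "local_valuation A w E \<longleftrightarrow> w \<zero>\<^bsub>A\<^esub> = 0 \<and>
     (\<forall>x\<in>E. 0 \<le> w x \<and> w x \<le> 1 \<and> w (\<sim>\<^bsub>A\<^esub> x) = 1 - w x) \<and>
     (\<forall>x\<in>E. \<forall>y\<in>E. w (x \<oplus>\<^bsub>A\<^esub> y) = min 1 (w x + w y))"

lemma local_valuation_mono: "\<lbrakk>local_valuation A w E; D \<subseteq> E\<rbrakk> \<Longrightarrow> local_valuation A w D"
  unfolding local_valuation_def by blast

context mv_chain
begin

text \<open>The identification of \<open>(0, 1)\<close> with the unit \<open>(1, 0)\<close> explains
  the special case.\<close>

definition chang_emb :: "'a \<Rightarrow> int \<times> 'a" where
  "chang_emb a = (if a = \<one>\<^sub>M then (1, \<zero>) else (0, a))"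

text \<open>Integer forms over a finite set \<open>V\<close> are evaluated in the Chang group, and
  those with nonnegative value form a cone. Real weights giving the same signs to the finitely many
  forms that describe the operations become a valuation after division by the weight of 1.\<close>

lemma local_valuation_exists_chain:
  assumes E: "finite E" "E \<subseteq> carrier A" and z: "z \<in> carrier A" "z \<noteq> \<zero>"
  shows "\<exists>w. local_valuation A w E \<and> 0 < w z"
proof -
  have nontriv: "\<zero> \<noteq> \<one>\<^sub>M"
    using z by (metis zero_simps(1,3))
  interpret G: comm_group chang_group by (rule comm_group_chang[OF nontriv])
  have emb [simp]: "chang_emb a \<in> carrier chang_group" if "a \<in> carrier A" for a
    using that nontriv by (simp add: chang_group_def chang_emb_def)
  have fst_mult: "fst (x \<otimes>\<^bsub>chang_group\<^esub> y) \<in> {fst x + fst y, fst x + fst y + 1}" for x y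
    by (simp add: chang_group_def chang_mult_def)
  have fst_one: "fst \<one>\<^bsub>chang_group\<^esub> = 0" by (simp add: chang_group_def)
  define V where "V = E \<union> mvneg A ` E \<union> (\<lambda>(a, b). a \<oplus> b) ` (E \<times> E) \<union> {\<zero>, \<one>\<^sub>M, z}"
  have V: "finite V" "V \<subseteq> carrier A" using E z by (auto simp: V_def)
  define ev where "ev k = (\<Otimes>\<^bsub>chang_group\<^esub>a\<in>V. chang_emb a [^]\<^bsub>chang_group\<^esub> (k a :: int))" for k
  have emb_V: "chang_emb a \<in> carrier chang_group" if "a \<in> V" for a using that V by auto
  have ev_closed [simp]: "ev k \<in> carrier chang_group" for k
    unfolding ev_def using emb_V by (intro G.finprod_closed) auto
  have ev_add: "ev (\<lambda>a. k a + l a) = ev k \<otimes>\<^bsub>chang_group\<^esub> ev l" for k l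
  proof -
    have "ev (\<lambda>a. k a + l a) =
        (\<Otimes>\<^bsub>chang_group\<^esub>a\<in>V. chang_emb a [^]\<^bsub>chang_group\<^esub> k a \<otimes>\<^bsub>chang_group\<^esub> chang_emb a [^]\<^bsub>chang_group\<^esub> l a)"
      unfolding ev_def using emb_V by (intro G.finprod_cong') (auto simp: G.int_pow_mult)
    also have "\<dots> = ev k \<otimes>\<^bsub>chang_group\<^esub> ev l"
      unfolding ev_def using emb_V by (intro G.finprod_multf) auto
    finally show ?thesis .
  qed
  have ev_zero: "ev (\<lambda>a. 0) = \<one>\<^bsub>chang_group\<^esub>" unfolding ev_def by (simp add: G.finprod_one_eqI)
  have ev_neg: "ev (\<lambda>a. - k a) = inv\<^bsub>chang_group\<^esub> (ev k)" for k
    using ev_add[of k "\<lambda>a. - k a"] by (intro G.inv_equality[symmetric]) (simp_all add: ev_zero G.m_comm)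
  define \<delta> where "\<delta> a = (\<lambda>b. if b = a then 1 else 0 :: int)" for a :: 'a
  have ev_\<delta>: "ev (\<delta> a) = chang_emb a" if "a \<in> V" for a
  proof -
    have "ev (\<delta> a) = (\<Otimes>\<^bsub>chang_group\<^esub>b\<in>V. if a = b then chang_emb b else \<one>\<^bsub>chang_group\<^esub>)"
      unfolding ev_def using emb_V by (intro G.finprod_cong') (auto simp: \<delta>_def)
    also have "\<dots> = chang_emb a"
      using that V(1) emb_V by (intro G.finprod_singleton) auto
    finally show ?thesis .
  qed
  define N where "N = {k. 0 \<le> fst (ev k)}"
  interpret form_cone N
  proof
    show "(\<lambda>i. f i + g i) \<in> N" if "f \<in> N" "g \<in> N" for f g
      using that fst_mult[of "ev f" "ev g"] by (auto simp: N_def ev_add)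
    \<comment> \<open>The first components of an element and its inverse add up to 0 or -1, hence
      are not both negative.\<close>
    show "f \<in> N \<or> (\<lambda>i. - f i) \<in> N" for f
      using fst_mult[of "ev f" "inv\<^bsub>chang_group\<^esub> (ev f)"] by (auto simp: N_def ev_neg fst_one)
  qed
  \<comment> \<open>The form \<open>a + b - c\<close>: its sign expresses an inequality between
    weights, its sign and that of its negative together an equation.\<close>
  define tri where "tri a b c = (\<lambda>i. (\<delta> a i + \<delta> b i) + - \<delta> c i)" for a b c
  define F where "F = \<delta> ` V \<union> {\<lambda>i. - \<delta> z i, \<lambda>i. - \<delta> \<zero> i} \<union>
    (\<lambda>(a, b, c). tri a b c) ` (V \<times> V \<times> V) \<union> (\<lambda>(a, b, c) i. - tri a b c i) ` (V \<times> V \<times> V)"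
  define S where "S w k = (\<Sum>i\<in>V. of_int (k i) * w i)" for w :: "'a \<Rightarrow> real" and k :: "'a \<Rightarrow> int"
  have zV: "z \<in> V" "\<zero> \<in> V" "\<one>\<^sub>M \<in> V" by (simp_all add: V_def)
  have "\<exists>w :: 'a \<Rightarrow> real. \<forall>f\<in>F. f \<in> N \<longleftrightarrow> 0 \<le> (\<Sum>i\<in>V. of_int (f i) * w i)"
  proof (rule realise_signs[OF V(1)])
    show "finite F" using V by (simp add: F_def)
    show "f i = 0" if "f \<in> F" "i \<notin> V" for f i
      using that zV by (auto simp: F_def \<delta>_def tri_def)
  qed
  then obtain w :: "'a \<Rightarrow> real" where w: "\<And>f. f \<in> F \<Longrightarrow> f \<in> N \<longleftrightarrow> 0 \<le> S w f"
    unfolding S_def by blast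
  have S_\<delta>: "S w (\<delta> a) = w a" if "a \<in> V" for a
  proof -
    have "S w (\<delta> a) = (\<Sum>i\<in>V. if i = a then w i else 0)"
      unfolding S_def \<delta>_def by (intro sum.cong) auto
    then show ?thesis using that V by simp
  qed
  have S_neg: "S w (\<lambda>i. - k i) = - S w k" for k by (simp add: S_def sum_negf)
  have S_tri: "S w (tri a b c) = w a + w b - w c" if "a \<in> V" "b \<in> V" "c \<in> V" for a b c
    using that S_\<delta>[of a] S_\<delta>[of b] S_\<delta>[of c]
    by (simp add: S_def tri_def sum.distrib sum_subtractf algebra_simps)
  have ev_tri: "ev (tri a b c) = chang_emb a \<otimes>\<^bsub>chang_group\<^esub> chang_emb b \<otimes>\<^bsub>chang_group\<^esub> inv\<^bsub>chang_group\<^esub> (chang_emb c)"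
    if "a \<in> V" "b \<in> V" "c \<in> V" for a b c
    unfolding tri_def ev_add ev_neg using that by (simp add: ev_\<delta>)
  have eqI: "w a + w b = w c"
    if "chang_emb a \<otimes>\<^bsub>chang_group\<^esub> chang_emb b = chang_emb c" "a \<in> V" "b \<in> V" "c \<in> V" for a b c
  proof -
    have "ev (tri a b c) = \<one>\<^bsub>chang_group\<^esub>" using that V by (simp add: ev_tri emb_V)
    then have "tri a b c \<in> N" "(\<lambda>i. - tri a b c i) \<in> N" by (simp_all add: N_def ev_neg fst_one)
    moreover have "tri a b c \<in> F" "(\<lambda>i. - tri a b c i) \<in> F"
      using that by (auto simp: F_def intro!: image_eqI[of _ _ "(a, b, c)"])
    ultimately show ?thesis using w[of "tri a b c"] w[of "\<lambda>i. - tri a b c i"] that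
      by (simp add: S_neg S_tri)
  qed
  have nonneg: "0 \<le> w a" if "a \<in> V" for a
  proof -
    have "\<delta> a \<in> N" using that by (simp add: N_def ev_\<delta> chang_emb_def)
    then show ?thesis using w[of "\<delta> a"] that by (simp add: F_def S_\<delta>)
  qed
  have emb_zero: "chang_emb \<zero> = \<one>\<^bsub>chang_group\<^esub>" using nontriv by (simp add: chang_emb_def chang_group_def)
  have "(\<lambda>i. - \<delta> \<zero> i) \<in> N"
    using zV by (simp add: N_def ev_neg ev_\<delta> emb_zero fst_one)
  then have w0: "w \<zero> = 0"
    using w[of "\<lambda>i. - \<delta> \<zero> i"] nonneg[OF zV(2)] zV by (simp add: F_def S_neg S_\<delta>)
  \<comment> \<open>Strict positivity of \<open>w z\<close> is the failure of the sign of
    \<open>- z\<close>. If the inverse of \<open>z\<close> had a nonnegative first component, no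
    carry could occur in their sum, and \<open>z\<close> would lie below 0.\<close>
  have "(\<lambda>i. - \<delta> z i) \<notin> N"
  proof
    assume "(\<lambda>i. - \<delta> z i) \<in> N"
    then have nn: "0 \<le> fst (inv\<^bsub>chang_group\<^esub> (chang_emb z))" using zV by (simp add: N_def ev_neg ev_\<delta>)
    define y where "y = inv\<^bsub>chang_group\<^esub> (chang_emb z)"
    have y: "y \<in> carrier chang_group" using z by (simp add: y_def)
    have "chang_mult (chang_emb z) y = (0, \<zero>)"
      using G.r_inv[OF emb[OF z(1)]] by (simp add: y_def chang_group_def)
    then have "z \<noteq> \<one>\<^sub>M" "z \<oplus> snd y = \<zero>"
      using nn[folded y_def] by (auto simp: chang_mult_def chang_emb_def split: if_splits)
    then have "z \<preceq> \<zero>" using le_oplus1[of z "snd y"] y z by (auto simp: chang_group_def)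
    then show False using le_antisym[of z "\<zero>"] z by simp
  qed
  then have wz: "0 < w z"
    using w[of "\<lambda>i. - \<delta> z i"] zV by (simp add: F_def S_neg S_\<delta>)
  have odd: "chang_emb a \<otimes>\<^bsub>chang_group\<^esub> chang_emb b = chang_emb (a \<oplus> b)" if "a \<oplus> b \<noteq> \<one>\<^sub>M" "a \<in> carrier A" "b \<in> carrier A" for a b
    using that by (auto simp: chang_group_def chang_emb_def chang_mult_def)
  have carry: "chang_emb a \<otimes>\<^bsub>chang_group\<^esub> chang_emb b = chang_emb (a \<odot> b) \<otimes>\<^bsub>chang_group\<^esub> chang_emb \<one>\<^sub>M"
    if "a \<oplus> b = \<one>\<^sub>M" "a \<in> carrier A" "b \<in> carrier A" for a b
    using that nontriv by (auto simp: chang_group_def chang_emb_def chang_mult_def odot_ne_one)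
  \<comment> \<open>Used with \<open>c = 1\<close> and \<open>d = a \<odot> b\<close>, and with a
    negation as \<open>d\<close>. The element \<open>d\<close> enters only through being
    nonnegative, so it may lie outside \<open>V\<close>.\<close>
  have leI: "w c \<le> w a + w b"
    if "chang_emb a \<otimes>\<^bsub>chang_group\<^esub> chang_emb b = chang_emb d \<otimes>\<^bsub>chang_group\<^esub> chang_emb c" "a \<in> V" "b \<in> V" "c \<in> V" "d \<in> carrier A"
    for a b c d
  proof -
    have "ev (tri a b c) = chang_emb d \<otimes>\<^bsub>chang_group\<^esub> (chang_emb c \<otimes>\<^bsub>chang_group\<^esub> inv\<^bsub>chang_group\<^esub> (chang_emb c))"
      using that emb_V by (simp add: ev_tri G.m_assoc)
    then have "ev (tri a b c) = chang_emb d" using that emb_V by simp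
    then have "tri a b c \<in> N" by (simp add: N_def chang_emb_def)
    moreover have "tri a b c \<in> F"
      using that by (auto simp: F_def intro!: image_eqI[of _ _ "(a, b, c)"])
    ultimately show ?thesis using w[of "tri a b c"] that by (simp add: S_tri)
  qed
  have neg: "chang_emb a \<otimes>\<^bsub>chang_group\<^esub> chang_emb (\<sim>a) = chang_emb \<one>\<^sub>M" if "a \<in> carrier A" for a
    using carry[of a "\<sim>a"] that by (simp add: emb_zero)
  have w_neg: "w a + w (\<sim>a) = w \<one>\<^sub>M" if "a \<in> V" "\<sim>a \<in> V" for a
    using that zV V neg by (intro eqI) auto
  have w_le: "w a \<le> w \<one>\<^sub>M" if "a \<in> V" for a
  proof -
    have a: "a \<in> carrier A" using that V by auto
    then have "chang_emb \<one>\<^sub>M \<otimes>\<^bsub>chang_group\<^esub> chang_emb \<zero> = chang_emb (\<sim>a) \<otimes>\<^bsub>chang_group\<^esub> chang_emb a"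
      using neg[OF a] by (simp add: emb_zero G.m_comm)
    then have "w a \<le> w \<one>\<^sub>M + w \<zero>" using leI that zV a by blast
    then show ?thesis using w0 by simp
  qed
  have w_plus: "w (a \<oplus> b) = min (w \<one>\<^sub>M) (w a + w b)" if "a \<in> V" "b \<in> V" "a \<oplus> b \<in> V" for a b
  proof -
    have ab: "a \<in> carrier A" "b \<in> carrier A" using that V by auto
    show ?thesis
    proof (cases "a \<oplus> b = \<one>\<^sub>M")
      case True
      then have "w \<one>\<^sub>M \<le> w a + w b"
        using that zV ab by (intro leI[OF carry[OF True ab]]) auto
      with True show ?thesis by simp
    next
      case False
      then have "w a + w b = w (a \<oplus> b)" using odd[OF False ab] that by (intro eqI)
      then show ?thesis using w_le[OF that(3)] by simp
    qed
  qed
  have w1: "0 < w \<one>\<^sub>M" using wz w_le[of z] zV by simp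
  have sub: "a \<in> V" "\<sim>a \<in> V" "a \<oplus> b \<in> V" if "a \<in> E" "b \<in> E" for a b
    using that by (auto simp: V_def)
  have "local_valuation A (\<lambda>a. w a / w \<one>\<^sub>M) E"
    unfolding local_valuation_def
  proof (intro conjI ballI)
    show "w \<zero> / w \<one>\<^sub>M = 0" by (simp add: w0)
    fix a assume a: "a \<in> E"
    note Va = sub[OF a a]
    show "0 \<le> w a / w \<one>\<^sub>M" "w a / w \<one>\<^sub>M \<le> 1" using nonneg w_le w1 Va by auto
    show "w (\<sim>a) / w \<one>\<^sub>M = 1 - w a / w \<one>\<^sub>M"
      using w_neg[of a] Va w1 by (simp add: field_simps)
    fix b assume "b \<in> E"
    from sub[OF a this] sub[OF this a]
    show "w (a \<oplus> b) / w \<one>\<^sub>M = min 1 (w a / w \<one>\<^sub>M + w b / w \<one>\<^sub>M)"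
      using w_plus[of a b] w1 by (auto simp: min_def field_simps)
  qed
  then show ?thesis using wz w1 by (intro exI[of _ "\<lambda>a. w a / w \<one>\<^sub>M"]) simp
qed

end

lemma (in mv_algebra) local_valuation_exists:
  assumes E: "finite E" "E \<subseteq> carrier A" and z: "z \<in> carrier A" "z \<noteq> \<zero>"
  shows "\<exists>w. local_valuation A w E \<and> 0 < w z"
proof -
  obtain B :: "'b set mv" and h
    where B: "mv_chain B" and h: "h \<in> mv_hom A B" "h z \<noteq> mvzero B"
    using chain_quotient[OF z] .
  interpret B: mv_chain B by fact
  have sub: "h ` E \<subseteq> carrier B" and hz: "h z \<in> carrier B"
    using h E z by (auto simp: mv_hom_def PiE_iff)
  from B.local_valuation_exists_chain[OF finite_imageI[OF E(1)] sub hz h(2)]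
  obtain w where w: "local_valuation B w (h ` E)" "0 < w (h z)" by blast
  have hom: "h \<zero> = mvzero B" "\<And>x. x \<in> E \<Longrightarrow> h (\<sim>x) = mvneg B (h x)"
    "\<And>x y. \<lbrakk>x \<in> E; y \<in> E\<rbrakk> \<Longrightarrow> h (x \<oplus> y) = oplus B (h x) (h y)"
    using h(1) E(2) by (simp_all add: mv_hom_def subset_iff)
  have "local_valuation A (w \<circ> h) E"
    using w(1) by (simp add: local_valuation_def hom)
  then show ?thesis using w(2) by (intro exI[of _ "w \<circ> h"]) simp
qed

lemma local_valuation_diff:
  assumes "local_valuation A w E" "x \<in> E" "y \<in> E" "\<sim>\<^bsub>A\<^esub> x \<in> E" "\<sim>\<^bsub>A\<^esub> x \<oplus>\<^bsub>A\<^esub> y \<in> E"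
  shows "w (\<sim>\<^bsub>A\<^esub> (\<sim>\<^bsub>A\<^esub> x \<oplus>\<^bsub>A\<^esub> y)) = max 0 (w x - w y)"
  using assms unfolding local_valuation_def by auto

text \<open>Distinct elements have a nonzero difference in one order. A valuation positive on it
  separates them once the elements from which the difference is built belong to the finite
  set.\<close>

lemma (in mv_algebra) separating_local_valuation:
  assumes E: "finite E" "E \<subseteq> carrier A" and xy: "x \<in> carrier A" "y \<in> carrier A" "x \<noteq> y"
  shows "\<exists>w. local_valuation A w E \<and> w x \<noteq> w y"
proof -
  have *: "\<exists>w. local_valuation A w E \<and> w x \<noteq> w y"
    if xy: "x \<in> carrier A" "y \<in> carrier A" "x \<ominus> y \<noteq> \<zero>" for x y
  proof -
    let ?E = "E \<union> {x, y, \<sim>x, \<sim>x \<oplus> y}"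
    obtain w where w: "local_valuation A w ?E" "0 < w (x \<ominus> y)"
      using local_valuation_exists[of ?E "x \<ominus> y"] E xy by auto
    then have "w y < w x" using local_valuation_diff[OF w(1), of x y] by simp
    moreover have "local_valuation A w E" using w(1) by (rule local_valuation_mono) auto
    ultimately show ?thesis by (intro exI[of _ w]) simp
  qed
  have "x \<ominus> y \<noteq> \<zero> \<or> y \<ominus> x \<noteq> \<zero>"
    using xy le_antisym[of x y] by (auto simp: diff_eq_zero_iff)
  then show ?thesis using *[of x y] *[of y x] xy by metis
qed

text \<open>Write \<open>r = p / q\<close>. The elements \<open>y i = (i / q) x\<close> satisfy
  \<open>y i \<ominus> y j = y (i - j)\<close> with truncated subtraction of indices, so a valuation
  respecting these finitely many MV-relations spaces them evenly between 0 and the value of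
  \<open>x\<close>.\<close>

lemma (in dmv_algebra) local_valuation_scal:
  assumes r: "r \<in> {0..1}" and x: "x \<in> carrier A"
  shows "\<exists>E. finite E \<and> E \<subseteq> carrier A \<and>
    (\<forall>w. local_valuation A w E \<longrightarrow> w (scal A r x) = of_rat r * w x)"
proof -
  obtain a b where ab: "r = Fract a b" "b > 0" by (cases r) auto
  define p q where "p = nat a" and "q = nat b"
  have "0 \<le> a" using r ab by (simp add: zero_le_Fract_iff)
  then have pq: "r = of_nat p / of_nat q" "q > 0"
    using ab by (simp_all add: p_def q_def Fract_of_int_quotient)
  then have "p \<le> q" using r by (simp add: divide_le_eq_1)
  define y where "y i = scal A (of_nat i / of_nat q) x" for i
  have I: "of_nat i / of_nat q \<in> {0..1 :: rat}" if "i \<le> q" for i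
    using that pq by (simp add: divide_le_eq_1)
  have y [simp]: "y i \<in> carrier A" if "i \<le> q" for i
    unfolding y_def using I[OF that] x by (rule scal_closed)
  have diff: "y i \<ominus> y j = y (i - j)" if "i \<le> q" "j \<le> q" for i j
  proof -
    have "max 0 (of_nat i / of_nat q - of_nat j / of_nat q) = (of_nat (i - j) / of_nat q :: rat)"
    proof (cases "j \<le> i")
      case True
      then have "(of_nat j / of_nat q :: rat) \<le> of_nat i / of_nat q"
        by (intro divide_right_mono) simp_all
      with True show ?thesis by (simp add: max_def diff_divide_distrib)
    next
      case False
      then have "(of_nat i / of_nat q :: rat) \<le> of_nat j / of_nat q"
        by (intro divide_right_mono) simp_all
      with False show ?thesis by (simp add: max_def)
    qed
    then have "y (i - j) = y i \<odot> \<sim>(y j)"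
      using diff_scal[OF I[OF that(1)] I[OF that(2)] x] by (simp only: y_def)
    then show ?thesis using that by (simp add: odot_def)
  qed
  have y0: "y 0 = \<zero>" using diff[of 0 0] by simp
  define E where "E = y ` {..q} \<union> mvneg A ` y ` {..q} \<union> (\<lambda>(i, j). \<sim>(y i) \<oplus> y j) ` ({..q} \<times> {..q})"
  have "w (scal A r x) = of_rat r * w x" if w: "local_valuation A w E" for w
  proof -
    have w0: "w (y 0) = 0" using w by (simp add: y0 local_valuation_def)
    have wd: "w (y (i - j)) = max 0 (w (y i) - w (y j))" if "i \<le> q" "j \<le> q" for i j
    proof -
      have "y i \<in> E" "y j \<in> E" "\<sim>(y i) \<in> E" "\<sim>(y i) \<oplus> y j \<in> E"
        using that by (auto simp: E_def intro: image_eqI[of _ _ "(i, j)"])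
      from local_valuation_diff[OF w this] show ?thesis using diff[OF that] by simp
    qed
    \<comment> \<open>The difference of \<open>Suc i\<close> and \<open>i\<close> gives the
      increment truncated at 0; the opposite difference has index 0 and shows that nothing was
      truncated.\<close>
    have step: "w (y (Suc i)) = w (y i) + w (y 1)" if "Suc i \<le> q" for i
      using wd[of "Suc i" i] wd[of i "Suc i"] that w0 by simp
    have "w (y i) = real i * w (y 1)" if "i \<le> q" for i
      using that
    proof (induction i)
      case (Suc i)
      then show ?case using step[of i] by (simp add: algebra_simps)
    qed (simp add: w0)
    from this[of p] this[of q] have "w (y p) = of_nat p / of_nat q * w (y q)"
      using \<open>p \<le> q\<close> pq by simp
    moreover have "y q = x" using pq x by (simp add: y_def scal_one)
    ultimately show ?thesis by (simp add: pq y_def of_rat_divide)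
  qed
  moreover have "finite E" "E \<subseteq> carrier A" by (auto simp: E_def)
  ultimately show ?thesis by blast
qed

subsection \<open>Completeness with respect to the real unit interval\<close>

definition unit_dmv :: "real dmv" where
  "unit_dmv = \<lparr>carrier = {0..1}, oplus = (\<lambda>x y. min 1 (x + y)), mvneg = (\<lambda>x. 1 - x), mvzero = 0,
     scal = (\<lambda>r x. of_rat r * x)\<rparr>"

lemma unit_dmv_diff: "x \<odot>\<^bsub>unit_dmv\<^esub> \<sim>\<^bsub>unit_dmv\<^esub> y = max 0 (x - y)"
  by (simp add: unit_dmv_def odot_def min_def max_def)

lemma dmv_algebra_unit: "dmv_algebra unit_dmv"
proof
  fix x y z :: real and r q :: rat
  assume x: "x \<in> carrier unit_dmv"
  show "\<sim>\<^bsub>unit_dmv\<^esub> x \<in> carrier unit_dmv" "\<sim>\<^bsub>unit_dmv\<^esub> (\<sim>\<^bsub>unit_dmv\<^esub> x) = x"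
    "\<sim>\<^bsub>unit_dmv\<^esub> \<zero>\<^bsub>unit_dmv\<^esub> \<oplus>\<^bsub>unit_dmv\<^esub> x = \<sim>\<^bsub>unit_dmv\<^esub> \<zero>\<^bsub>unit_dmv\<^esub>" "scal unit_dmv 1 x = x"
    using x by (simp_all add: unit_dmv_def)
  assume r: "r \<in> {0..1}"
  then have r': "0 \<le> real_of_rat r" "real_of_rat r \<le> 1" by simp_all
  show "scal unit_dmv r x \<in> carrier unit_dmv"
    using x r' by (simp add: unit_dmv_def mult_le_one)
  show "scal unit_dmv r (scal unit_dmv q x) = scal unit_dmv (r * q) x"
    by (simp add: unit_dmv_def of_rat_mult)
  show "scal unit_dmv r (x \<odot>\<^bsub>unit_dmv\<^esub> \<sim>\<^bsub>unit_dmv\<^esub> y) =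
      scal unit_dmv r x \<odot>\<^bsub>unit_dmv\<^esub> \<sim>\<^bsub>unit_dmv\<^esub> (scal unit_dmv r y)"
  proof -
    have "of_rat r * max 0 (x - y) = max 0 (of_rat r * x - of_rat r * y)"
      using r' mult_left_mono[of x y "of_rat r"] mult_left_mono[of y x "of_rat r"]
      by (cases x y rule: le_cases) (simp_all add: max_def right_diff_distrib)
    then show ?thesis unfolding unit_dmv_diff by (simp add: unit_dmv_def)
  qed
  show "scal unit_dmv (max 0 (r - q)) x = scal unit_dmv r x \<odot>\<^bsub>unit_dmv\<^esub> \<sim>\<^bsub>unit_dmv\<^esub> (scal unit_dmv q x)"
  proof -
    have "real_of_rat (max 0 (r - q)) * x = max 0 (of_rat r * x - of_rat q * x)"
    proof (cases "q \<le> r")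
      case True
      then have "of_rat q * x \<le> of_rat r * x"
        using x by (intro mult_right_mono) (simp_all add: unit_dmv_def of_rat_less_eq)
      then show ?thesis using True by (simp add: max_def of_rat_diff algebra_simps)
    next
      case False
      then have "of_rat r * x \<le> of_rat q * x"
        using x by (intro mult_right_mono) (simp_all add: unit_dmv_def of_rat_less_eq)
      then show ?thesis using False by (simp add: max_def algebra_simps)
    qed
    then show ?thesis unfolding unit_dmv_diff by (simp add: unit_dmv_def)
  qed
next
  fix x y assume "x \<in> carrier unit_dmv" "y \<in> carrier unit_dmv"
  then show "\<sim>\<^bsub>unit_dmv\<^esub> (\<sim>\<^bsub>unit_dmv\<^esub> x \<oplus>\<^bsub>unit_dmv\<^esub> y) \<oplus>\<^bsub>unit_dmv\<^esub> y =
      \<sim>\<^bsub>unit_dmv\<^esub> (\<sim>\<^bsub>unit_dmv\<^esub> y \<oplus>\<^bsub>unit_dmv\<^esub> x) \<oplus>\<^bsub>unit_dmv\<^esub> x"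
    by (auto simp: unit_dmv_def min_def)
qed (auto simp: unit_dmv_def min_def)

interpretation U: dmv_algebra unit_dmv by (rule dmv_algebra_unit)

abbreviation mv_val :: "('v \<Rightarrow> real) \<Rightarrow> 'v mv_term \<Rightarrow> real" where "mv_val \<equiv> mv_eval unit_dmv"
abbreviation dmv_val :: "('v \<Rightarrow> real) \<Rightarrow> 'v dmv_term \<Rightarrow> real" where "dmv_val \<equiv> dmv_eval unit_dmv"

text \<open>A local valuation may take any real value at generators outside its finite set. Clipping
  produces an evaluation in \<open>[0,1]\<close> at all generators and leaves the values on the
  finite set unchanged.\<close>

definition clip :: "real \<Rightarrow> real" where "clip x = max 0 (min 1 x)"

lemma clip_range [simp]: "0 \<le> clip x" "clip x \<le> 1" "clip x \<in> carrier unit_dmv"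
  by (auto simp: clip_def unit_dmv_def)

lemma clip_id: "\<lbrakk>0 \<le> x; x \<le> 1\<rbrakk> \<Longrightarrow> clip x = x"
  by (simp add: clip_def)

lemma MV_class_in [simp]: "t \<in> mv_terms X \<Longrightarrow> mv_eq X `` {t} \<in> carrier (MV X)"
  by (simp add: MV_ops quotientI)

lemma DMV_class_in [simp]: "t \<in> dmv_terms X \<Longrightarrow> dmv_eq X `` {t} \<in> carrier (DMV X)"
  by (simp add: DMV_ops quotientI)

lemma MV_class_eq_iff:
  "\<lbrakk>s \<in> mv_terms X; t \<in> mv_terms X\<rbrakk> \<Longrightarrow> mv_eq X `` {s} = mv_eq X `` {t} \<longleftrightarrow> (s, t) \<in> mv_eq X"
  by (rule eq_equiv_class_iff[OF equiv_mv_eq])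

lemma DMV_class_eq_iff:
  "\<lbrakk>s \<in> dmv_terms X; t \<in> dmv_terms X\<rbrakk> \<Longrightarrow> dmv_eq X `` {s} = dmv_eq X `` {t} \<longleftrightarrow> (s, t) \<in> dmv_eq X"
  by (rule eq_equiv_class_iff[OF equiv_dmv_eq])

text \<open>\<open>E\<close> collects the classes of the proper subterms, and for a variable its own
  class, so that \<open>w\<close> commutes with every operation occurring in \<open>t\<close>. It
  depends on \<open>t\<close> alone, not on \<open>w\<close>.\<close>

lemma MV_local_valuation_eval:
  assumes "t \<in> mv_terms X"
  shows "\<exists>E. finite E \<and> E \<subseteq> carrier (MV X) \<and> (\<forall>w. local_valuation (MV X) w E \<longrightarrow>
    w (mv_eq X `` {t}) = mv_val (\<lambda>x. clip (w (mv_gen X x))) t)"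
  using assms
proof induction
  case (1 x)
  then show ?case
    by (intro exI[of _ "{mv_gen X x}"])
      (simp add: local_valuation_def clip_id mv_gen_def mv_terms.intros)
next
  case 2
  then show ?case
    by (intro exI[of _ "{}"]) (simp add: local_valuation_def unit_dmv_def MV_ops)
next
  case (3 t)
  then obtain E where E: "finite E" "E \<subseteq> carrier (MV X)" "\<And>w. local_valuation (MV X) w E \<Longrightarrow>
    w (mv_eq X `` {t}) = mv_val (\<lambda>x. clip (w (mv_gen X x))) t" by blast
  let ?E = "insert (mv_eq X `` {t}) E"
  have "w (mv_eq X `` {MNeg t}) = mv_val (\<lambda>x. clip (w (mv_gen X x))) (MNeg t)"
    if w: "local_valuation (MV X) w ?E" for w
  proof -
    have "w (mvneg (MV X) (mv_eq X `` {t})) = 1 - w (mv_eq X `` {t})"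
      using w by (simp add: local_valuation_def)
    then show ?thesis using E(3)[OF local_valuation_mono[OF w]] 3(1)
      by (simp add: MV_ops subset_insertI) (simp add: unit_dmv_def)
  qed
  then show ?case using E 3 by (intro exI[of _ ?E]) simp
next
  case (4 s t)
  then obtain D E where D: "finite D" "D \<subseteq> carrier (MV X)" "\<And>w. local_valuation (MV X) w D \<Longrightarrow>
      w (mv_eq X `` {s}) = mv_val (\<lambda>x. clip (w (mv_gen X x))) s"
    and E: "finite E" "E \<subseteq> carrier (MV X)" "\<And>w. local_valuation (MV X) w E \<Longrightarrow>
      w (mv_eq X `` {t}) = mv_val (\<lambda>x. clip (w (mv_gen X x))) t" by blast
  let ?E = "{mv_eq X `` {s}, mv_eq X `` {t}} \<union> (D \<union> E)"
  have "w (mv_eq X `` {MPlus s t}) = mv_val (\<lambda>x. clip (w (mv_gen X x))) (MPlus s t)"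
    if w: "local_valuation (MV X) w ?E" for w
  proof -
    have "w (oplus (MV X) (mv_eq X `` {s}) (mv_eq X `` {t})) = min 1 (w (mv_eq X `` {s}) + w (mv_eq X `` {t}))"
      using w by (simp add: local_valuation_def)
    moreover have "local_valuation (MV X) w D" "local_valuation (MV X) w E"
      by (rule local_valuation_mono[OF w]; blast)+
    ultimately show ?thesis using D(3) E(3) 4(1,2)
      by (simp add: MV_ops) (simp add: unit_dmv_def)
  qed
  then show ?case using D E 4 by (intro exI[of _ ?E]) simp
qed

text \<open>The induction is the one for MV-terms; the new case of a scalar enlarges
  \<open>E\<close> by the set that forces the scalar to act as real multiplication.\<close>

lemma DMV_local_valuation_eval:
  assumes "t \<in> dmv_terms X"
  shows "\<exists>E. finite E \<and> E \<subseteq> carrier (DMV X) \<and> (\<forall>w. local_valuation (DMV X) w E \<longrightarrow>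
    w (dmv_eq X `` {t}) = dmv_val (\<lambda>x. clip (w (dmv_gen X x))) t)"
  using assms
proof induction
  case (1 x)
  then show ?case
    by (intro exI[of _ "{dmv_gen X x}"])
      (simp add: local_valuation_def clip_id dmv_gen_def dmv_terms.intros)
next
  case 2
  then show ?case
    by (intro exI[of _ "{}"]) (simp add: local_valuation_def unit_dmv_def DMV_ops)
next
  case (3 t)
  then obtain E where E: "finite E" "E \<subseteq> carrier (DMV X)" "\<And>w. local_valuation (DMV X) w E \<Longrightarrow>
    w (dmv_eq X `` {t}) = dmv_val (\<lambda>x. clip (w (dmv_gen X x))) t" by blast
  let ?E = "insert (dmv_eq X `` {t}) E"
  have "w (dmv_eq X `` {DNeg t}) = dmv_val (\<lambda>x. clip (w (dmv_gen X x))) (DNeg t)"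
    if w: "local_valuation (DMV X) w ?E" for w
  proof -
    have "w (mvneg (DMV X) (dmv_eq X `` {t})) = 1 - w (dmv_eq X `` {t})"
      using w by (simp add: local_valuation_def)
    then show ?thesis using E(3)[OF local_valuation_mono[OF w]] 3(1)
      by (simp add: DMV_ops subset_insertI) (simp add: unit_dmv_def)
  qed
  then show ?case using E 3 by (intro exI[of _ ?E]) simp
next
  case (4 s t)
  then obtain D E where D: "finite D" "D \<subseteq> carrier (DMV X)" "\<And>w. local_valuation (DMV X) w D \<Longrightarrow>
      w (dmv_eq X `` {s}) = dmv_val (\<lambda>x. clip (w (dmv_gen X x))) s"
    and E: "finite E" "E \<subseteq> carrier (DMV X)" "\<And>w. local_valuation (DMV X) w E \<Longrightarrow>
      w (dmv_eq X `` {t}) = dmv_val (\<lambda>x. clip (w (dmv_gen X x))) t" by blast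
  let ?E = "{dmv_eq X `` {s}, dmv_eq X `` {t}} \<union> (D \<union> E)"
  have "w (dmv_eq X `` {DPlus s t}) = dmv_val (\<lambda>x. clip (w (dmv_gen X x))) (DPlus s t)"
    if w: "local_valuation (DMV X) w ?E" for w
  proof -
    have "w (oplus (DMV X) (dmv_eq X `` {s}) (dmv_eq X `` {t})) = min 1 (w (dmv_eq X `` {s}) + w (dmv_eq X `` {t}))"
      using w by (simp add: local_valuation_def)
    moreover have "local_valuation (DMV X) w D" "local_valuation (DMV X) w E"
      by (rule local_valuation_mono[OF w]; blast)+
    ultimately show ?thesis using D(3) E(3) 4(1,2)
      by (simp add: DMV_ops) (simp add: unit_dmv_def)
  qed
  then show ?case using D E 4 by (intro exI[of _ ?E]) simp
next
  case (5 r t)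
  interpret dmv_algebra "DMV X" by (rule dmv_algebra_DMV)
  from 5 obtain E where E: "finite E" "E \<subseteq> carrier (DMV X)" "\<And>w. local_valuation (DMV X) w E \<Longrightarrow>
    w (dmv_eq X `` {t}) = dmv_val (\<lambda>x. clip (w (dmv_gen X x))) t" by blast
  obtain D where D: "finite D" "D \<subseteq> carrier (DMV X)" "\<And>w. local_valuation (DMV X) w D \<Longrightarrow>
    w (scal (DMV X) r (dmv_eq X `` {t})) = of_rat r * w (dmv_eq X `` {t})"
    using local_valuation_scal[OF 5(1) DMV_class_in[OF 5(2)]] by blast
  have "w (dmv_eq X `` {DScal r t}) = dmv_val (\<lambda>x. clip (w (dmv_gen X x))) (DScal r t)"
    if w: "local_valuation (DMV X) w (D \<union> E)" for w
  proof -
    have "local_valuation (DMV X) w D" "local_valuation (DMV X) w E"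
      by (rule local_valuation_mono[OF w]; blast)+
    then show ?thesis using D(3) E(3) 5(1,2)
      by (simp add: DMV_ops) (simp add: unit_dmv_def)
  qed
  then show ?case using D E by (intro exI[of _ "D \<union> E"]) simp
qed

text \<open>Chang's completeness theorem. If the classes differ, a local valuation separates them on
  a set large enough to evaluate both terms, and its clipped values at the generators refute the
  equation in \<open>[0,1]\<close>.\<close>

theorem MV_complete:
  assumes st: "s \<in> mv_terms X" "t \<in> mv_terms X"
    and eq: "\<And>e. e \<in> X \<rightarrow> {0..1} \<Longrightarrow> mv_val e s = mv_val e t"
  shows "(s, t) \<in> mv_eq X"
proof (rule ccontr)
  interpret mv_algebra "MV X" by (rule mv_algebra_MV)
  assume "(s, t) \<notin> mv_eq X"
  then have ne: "mv_eq X `` {s} \<noteq> mv_eq X `` {t}" using st by (simp add: MV_class_eq_iff)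
  obtain D E where D: "finite D" "D \<subseteq> carrier (MV X)" "\<And>w. local_valuation (MV X) w D \<Longrightarrow>
      w (mv_eq X `` {s}) = mv_val (\<lambda>x. clip (w (mv_gen X x))) s"
    and E: "finite E" "E \<subseteq> carrier (MV X)" "\<And>w. local_valuation (MV X) w E \<Longrightarrow>
      w (mv_eq X `` {t}) = mv_val (\<lambda>x. clip (w (mv_gen X x))) t"
    using st[THEN MV_local_valuation_eval] by meson
  obtain w where w: "local_valuation (MV X) w (D \<union> E)" "w (mv_eq X `` {s}) \<noteq> w (mv_eq X `` {t})"
  proof -
    have "\<exists>w. local_valuation (MV X) w (D \<union> E) \<and> w (mv_eq X `` {s}) \<noteq> w (mv_eq X `` {t})"
      using D E st ne by (intro separating_local_valuation) simp_all
    then show thesis using that by blast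
  qed
  have "local_valuation (MV X) w D" "local_valuation (MV X) w E"
    by (rule local_valuation_mono[OF w(1)]; blast)+
  then show False using w(2) D(3) E(3) eq[of "\<lambda>x. clip (w (mv_gen X x))"] by simp
qed

theorem DMV_complete:
  assumes st: "s \<in> dmv_terms X" "t \<in> dmv_terms X"
    and eq: "\<And>e. e \<in> X \<rightarrow> {0..1} \<Longrightarrow> dmv_val e s = dmv_val e t"
  shows "(s, t) \<in> dmv_eq X"
proof (rule ccontr)
  interpret mv_algebra "DMV X" by (rule mv_algebra_DMV)
  assume "(s, t) \<notin> dmv_eq X"
  then have ne: "dmv_eq X `` {s} \<noteq> dmv_eq X `` {t}" using st by (simp add: DMV_class_eq_iff)
  obtain D E where D: "finite D" "D \<subseteq> carrier (DMV X)" "\<And>w. local_valuation (DMV X) w D \<Longrightarrow>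
      w (dmv_eq X `` {s}) = dmv_val (\<lambda>x. clip (w (dmv_gen X x))) s"
    and E: "finite E" "E \<subseteq> carrier (DMV X)" "\<And>w. local_valuation (DMV X) w E \<Longrightarrow>
      w (dmv_eq X `` {t}) = dmv_val (\<lambda>x. clip (w (dmv_gen X x))) t"
    using st[THEN DMV_local_valuation_eval] by meson
  obtain w where w: "local_valuation (DMV X) w (D \<union> E)" "w (dmv_eq X `` {s}) \<noteq> w (dmv_eq X `` {t})"
  proof -
    have "\<exists>w. local_valuation (DMV X) w (D \<union> E) \<and> w (dmv_eq X `` {s}) \<noteq> w (dmv_eq X `` {t})"
      using D E st ne by (intro separating_local_valuation) simp_all
    then show thesis using that by blast
  qed
  have "local_valuation (DMV X) w D" "local_valuation (DMV X) w E"
    by (rule local_valuation_mono[OF w(1)]; blast)+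
  then show False using w(2) D(3) E(3) eq[of "\<lambda>x. clip (w (dmv_gen X x))"] by simp
qed

subsection \<open>The embedding of the free MV-algebra\<close>

primrec emb_term :: "'v mv_term \<Rightarrow> 'v dmv_term" where
  "emb_term (MVar x) = DVar x"
| "emb_term MZero = DZero"
| "emb_term (MNeg t) = DNeg (emb_term t)"
| "emb_term (MPlus s t) = DPlus (emb_term s) (emb_term t)"

lemma emb_term_in [simp]: "t \<in> mv_terms X \<Longrightarrow> emb_term t \<in> dmv_terms X"
  by (induction rule: mv_terms.induct) (auto intro: dmv_terms.intros)

lemma dmv_eval_emb_term [simp]: "dmv_eval A e (emb_term t) = mv_eval A e t"
  by (induction t) simp_all

lemma iota_class: "t \<in> mv_terms X \<Longrightarrow> iota X (mv_eq X `` {t}) = dmv_eq X `` {emb_term t}"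
proof (induction rule: mv_terms.induct)
  case (1 x)
  then show ?case using iota_gen[of x X] by (simp add: mv_gen_def dmv_gen_def)
next
  case 2
  then show ?case using iota_hom[of X] by (simp add: mv_hom_def MV_ops DMV_ops)
next
  case (3 t)
  then show ?case using iota_hom[of X] by (simp add: mv_hom_def MV_ops(3)[symmetric] DMV_ops(3))
next
  case (4 s t)
  then show ?case using iota_hom[of X] by (simp add: mv_hom_def MV_ops(4)[symmetric] DMV_ops(4))
qed

lemma inj_on_iota: "inj_on (iota X) (carrier (MV X))"
proof (rule inj_onI)
  fix C D assume "C \<in> carrier (MV X)" "D \<in> carrier (MV X)" and eq: "iota X C = iota X D"
  then obtain s t where s: "s \<in> mv_terms X" "C = mv_eq X `` {s}" and t: "t \<in> mv_terms X" "D = mv_eq X `` {t}"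
    by (auto elim!: MV_cases)
  then have "(emb_term s, emb_term t) \<in> dmv_eq X" using eq by (simp add: iota_class DMV_class_eq_iff)
  then have "mv_val e s = mv_val e t" if "e \<in> X \<rightarrow> {0..1}" for e
    using U.dmv_eval_sound[of e X "emb_term s" "emb_term t"] that by (simp add: unit_dmv_def)
  then show "C = D" using s t by (simp add: MV_class_eq_iff MV_complete)
qed

subsection \<open>Clearing denominators\<close>

lemma unit_dmv_simps [simp]:
  "mvzero unit_dmv = 0" "mvneg unit_dmv x = 1 - x" "oplus unit_dmv x y = min 1 (x + y)"
  "scal unit_dmv r x = of_rat r * x" "mvone unit_dmv = 1"
  by (simp_all add: unit_dmv_def mvone_def)

lemma mv_val_range: "\<lbrakk>e \<in> X \<rightarrow> {0..1}; t \<in> mv_terms X\<rbrakk> \<Longrightarrow> 0 \<le> mv_val e t \<and> mv_val e t \<le> 1"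
  using U.mv_eval_closed[of e X t] by (simp add: unit_dmv_def)

lemma dmv_val_range: "\<lbrakk>e \<in> X \<rightarrow> {0..1}; t \<in> dmv_terms X\<rbrakk> \<Longrightarrow> 0 \<le> dmv_val e t \<and> dmv_val e t \<le> 1"
  using U.dmv_eval_closed[of e X t] by (simp add: unit_dmv_def)

text \<open>The additive group of functions generated by the term functions. Negatives are present
  because \<open>- t\<close> is the value of \<open>MNeg t\<close> plus the constant -1.\<close>

inductive mv_sum :: "'v set \<Rightarrow> (('v \<Rightarrow> real) \<Rightarrow> real) \<Rightarrow> bool" for X where
  const: "mv_sum X (\<lambda>e. of_int n)"
| val_add: "\<lbrakk>t \<in> mv_terms X; mv_sum X \<phi>\<rbrakk> \<Longrightarrow> mv_sum X (\<lambda>e. mv_val e t + \<phi> e)"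

lemma mv_sum_val: "t \<in> mv_terms X \<Longrightarrow> mv_sum X (\<lambda>e. mv_val e t)"
  using mv_sum.val_add[OF _ mv_sum.const[of X 0]] by simp

lemma mv_sum_add:
  assumes "mv_sum X \<phi>" "mv_sum X \<psi>" shows "mv_sum X (\<lambda>e. \<phi> e + \<psi> e)"
  using assms(1)
proof induction
  case (const n)
  from assms(2) show ?case
  proof induction
    case (const m)
    then show ?case using mv_sum.const[of X "n + m"] by simp
  next
    case (val_add t \<psi>)
    then show ?case using mv_sum.val_add[OF val_add(1,3)] by (simp add: add.left_commute)
  qed
next
  case (val_add t \<phi>)
  then show ?case using mv_sum.val_add[OF val_add(1,3)] by (simp add: add.assoc)
qed

lemma mv_sum_uminus: "mv_sum X \<phi> \<Longrightarrow> mv_sum X (\<lambda>e. - \<phi> e)"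
proof (induction rule: mv_sum.induct)
  case (const n)
  then show ?case using mv_sum.const[of X "- n"] by simp
next
  case (val_add t \<phi>)
  have "mv_sum X (\<lambda>e. mv_val e (MNeg t) + (of_int (- 1) + - \<phi> e))"
    by (intro mv_sum.val_add mv_sum_add mv_sum.const val_add mv_terms.intros)
  then show ?case by (simp add: algebra_simps)
qed

lemma mv_sum_mult: "mv_sum X \<phi> \<Longrightarrow> mv_sum X (\<lambda>e. of_nat n * \<phi> e)"
proof (induction n)
  case 0
  then show ?case using mv_sum.const[of X 0] by simp
next
  case (Suc n)
  then show ?case using mv_sum_add[of X \<phi> "\<lambda>e. of_nat n * \<phi> e"] by (simp add: algebra_simps)
qed

text \<open>Truncating a sum one summand at a time, at all integer levels simultaneously.\<close>

lemma clip_add: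
  assumes "0 \<le> c" "c \<le> 1"
  shows "clip (c + x) = min 1 (clip x + max 0 (c + clip (x + 1) - 1))"
  using assms by (auto simp: clip_def min_def max_def)

text \<open>Truncating \<open>c + x\<close> calls for truncations of \<open>x\<close> at two
  consecutive levels, which is why \<open>k\<close> is arbitrary in the induction.\<close>

lemma mv_sum_clip:
  assumes "mv_sum X \<phi>"
  shows "\<exists>t\<in>mv_terms X. \<forall>e\<in>X \<rightarrow> {0..1}. mv_val e t = clip (\<phi> e - of_int k)"
  using assms
proof (induction arbitrary: k)
  case (const n)
  show ?case
  proof (cases "n \<le> k")
    case True
    then show ?thesis by (intro bexI[of _ MZero]) (auto simp: clip_def mv_terms.intros)
  next
    case False
    then have "1 \<le> (of_int n :: real) - of_int k" by linarith
    then show ?thesis by (intro bexI[of _ "MNeg MZero"]) (auto simp: clip_def intro: mv_terms.intros)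
  qed
next
  case (val_add t \<phi>)
  obtain u v where u: "u \<in> mv_terms X" "\<And>e. e \<in> X \<rightarrow> {0..1} \<Longrightarrow> mv_val e u = clip (\<phi> e - of_int k)"
    and v: "v \<in> mv_terms X" "\<And>e. e \<in> X \<rightarrow> {0..1} \<Longrightarrow> mv_val e v = clip (\<phi> e - of_int (k - 1))"
    using val_add.IH[of k] val_add.IH[of "k - 1"] by blast
  \<comment> \<open>The term reads \<open>u \<oplus> (t \<odot> v)\<close>: \<open>u\<close>
    accounts for a nonnegative remainder, \<open>t \<odot> v\<close> for one between -1 and 0, where
    \<open>v\<close> truncates one level lower.\<close>
  let ?s = "MPlus u (MNeg (MPlus (MNeg t) (MNeg v)))"
  have "mv_val e ?s = clip (mv_val e t + \<phi> e - of_int k)" if e: "e \<in> X \<rightarrow> {0..1}" for e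
  proof -
    have "clip (mv_val e t + (\<phi> e - of_int k)) =
        min 1 (clip (\<phi> e - of_int k) + max 0 (mv_val e t + clip (\<phi> e - of_int k + 1) - 1))"
      using mv_val_range[OF e val_add.hyps(1)] by (intro clip_add) auto
    moreover have "1 - min 1 (1 - a + (1 - b)) = max 0 (a + b - 1)" for a b :: real by auto
    ultimately show ?thesis using u(2)[OF e] v(2)[OF e] by (simp add: algebra_simps)
  qed
  then show ?case using u(1) v(1) val_add.hyps(1) by (intro bexI[of _ ?s]) (auto intro: mv_terms.intros)
qed

lemma sum_clip: "0 \<le> x \<Longrightarrow> (\<Sum>k<n. clip (x - of_nat k)) = min (of_nat n) x"
proof (induction n)
  case (Suc n)
  then show ?case by (auto simp: clip_def min_def max_def)
qed simp

text \<open>The part of a nonnegative function below height \<open>n\<close> is cut into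
  \<open>n\<close> layers of height 1, each of which is a term function.\<close>

lemma mv_sum_truncate:
  assumes \<phi>: "mv_sum X \<phi>" and nonneg: "\<And>e. e \<in> X \<rightarrow> {0..1} \<Longrightarrow> 0 \<le> \<phi> e"
  shows "\<exists>\<psi>. mv_sum X \<psi> \<and> (\<forall>e\<in>X \<rightarrow> {0..1}. \<psi> e = min (of_nat n) (\<phi> e))"
proof -
  have "\<exists>\<psi>. mv_sum X \<psi> \<and> (\<forall>e\<in>X \<rightarrow> {0..1}. \<psi> e = (\<Sum>k<n. clip (\<phi> e - of_nat k)))"
  proof (induction n)
    case 0
    then show ?case using mv_sum.const[of X 0] by (intro exI[of _ "\<lambda>e. 0"]) simp
  next
    case (Suc n)
    then obtain \<psi> where \<psi>: "mv_sum X \<psi>" "\<And>e. e \<in> X \<rightarrow> {0..1} \<Longrightarrow> \<psi> e = (\<Sum>k<n. clip (\<phi> e - of_nat k))"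
      by blast
    obtain t where t: "t \<in> mv_terms X" "\<And>e. e \<in> X \<rightarrow> {0..1} \<Longrightarrow> mv_val e t = clip (\<phi> e - of_int (int n))"
      using mv_sum_clip[OF \<phi>, of "int n"] by blast
    have "mv_sum X (\<lambda>e. mv_val e t + \<psi> e)" using t(1) \<psi>(1) by (rule mv_sum.val_add)
    then show ?case using \<psi>(2) t(2) by (intro exI[of _ "\<lambda>e. mv_val e t + \<psi> e"]) simp
  qed
  then show ?thesis using sum_clip nonneg by simp
qed

text \<open>The number \<open>n\<close> is a common denominator: negation keeps it, a sum multiplies
  the denominators \<open>m\<close> and \<open>n\<close> of its parts, and a scalar
  \<open>a / b\<close> contributes a factor \<open>b\<close>. Scaling turns the truncation of a sum
  at 1 into one at \<open>m * n\<close>.\<close>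

lemma dmv_term_multiple:
  assumes "f \<in> dmv_terms X"
  shows "\<exists>n>0. \<exists>\<phi>. mv_sum X \<phi> \<and> (\<forall>e\<in>X \<rightarrow> {0..1}. of_nat n * dmv_val e f = \<phi> e)"
  using assms
proof induction
  case (1 x)
  then show ?case using mv_sum_val[of "MVar x" X]
    by (intro exI[of _ 1] conjI exI[of _ "\<lambda>e. mv_val e (MVar x)"]) (simp_all add: mv_terms.intros)
next
  case 2
  then show ?case using mv_sum.const[of X 0] by (intro exI[of _ 1] conjI exI[of _ "\<lambda>e. 0"]) simp_all
next
  case (3 f)
  then obtain n \<phi> where n: "n > 0" "mv_sum X \<phi>" "\<And>e. e \<in> X \<rightarrow> {0..1} \<Longrightarrow> of_nat n * dmv_val e f = \<phi> e"
    by blast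
  have "mv_sum X (\<lambda>e. of_int (int n) + - \<phi> e)"
    by (intro mv_sum_add mv_sum.const mv_sum_uminus n)
  then show ?case using n by (intro exI[of _ n] conjI exI[of _ "\<lambda>e. of_int (int n) + - \<phi> e"])
      (simp_all add: algebra_simps)
next
  case (4 f g)
  then obtain m \<phi> where m: "m > 0" "mv_sum X \<phi>" "\<And>e. e \<in> X \<rightarrow> {0..1} \<Longrightarrow> of_nat m * dmv_val e f = \<phi> e"
    by blast
  from 4 obtain n \<psi> where n: "n > 0" "mv_sum X \<psi>" "\<And>e. e \<in> X \<rightarrow> {0..1} \<Longrightarrow> of_nat n * dmv_val e g = \<psi> e"
    by blast
  define \<chi> where "\<chi> = (\<lambda>e. of_nat n * \<phi> e + of_nat m * \<psi> e)"
  have \<chi>: "\<chi> e = of_nat (m * n) * (dmv_val e f + dmv_val e g)" if "e \<in> X \<rightarrow> {0..1}" for e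
    using m(3)[OF that, symmetric] n(3)[OF that, symmetric] by (simp add: \<chi>_def algebra_simps)
  have "mv_sum X \<chi>" unfolding \<chi>_def by (intro mv_sum_add mv_sum_mult m n)
  moreover have "0 \<le> \<chi> e" if "e \<in> X \<rightarrow> {0..1}" for e
    using \<chi>[OF that] dmv_val_range[OF that 4(1)] dmv_val_range[OF that 4(2)] by simp
  ultimately obtain \<theta> where \<theta>: "mv_sum X \<theta>" "\<And>e. e \<in> X \<rightarrow> {0..1} \<Longrightarrow> \<theta> e = min (of_nat (m * n)) (\<chi> e)"
    using mv_sum_truncate[of X \<chi> "m * n"] by blast
  have "of_nat (m * n) * dmv_val e (DPlus f g) = \<theta> e" if "e \<in> X \<rightarrow> {0..1}" for e
    using \<theta>(2)[OF that] \<chi>[OF that] by (simp add: min_mult_distrib_left)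
  then show ?case using \<theta>(1) m(1) n(1) by (intro exI[of _ "m * n"] conjI exI[of _ \<theta>]) simp_all
next
  case (5 r f)
  then obtain n \<phi> where n: "n > 0" "mv_sum X \<phi>" "\<And>e. e \<in> X \<rightarrow> {0..1} \<Longrightarrow> of_nat n * dmv_val e f = \<phi> e"
    by blast
  obtain a b where ab: "r = Fract a b" "b > 0" by (cases r) auto
  have "0 \<le> a" using 5(1) ab by (simp add: zero_le_Fract_iff)
  then have r: "of_rat r = (of_nat (nat a) / of_nat (nat b) :: real)"
    using ab by (simp add: of_rat_rat)
  have "of_nat (nat b * n) * dmv_val e (DScal r f) = of_nat (nat a) * \<phi> e" if "e \<in> X \<rightarrow> {0..1}" for e
    using n(3)[OF that, symmetric] ab(2) by (simp add: r)
  then show ?case using mv_sum_mult[OF n(2), of "nat a"] n(1) ab(2)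
    by (intro exI[of _ "nat b * n"] conjI exI[of _ "\<lambda>e. of_nat (nat a) * \<phi> e"]) simp_all
qed

primrec dmv_multiple :: "nat \<Rightarrow> 'v dmv_term \<Rightarrow> 'v dmv_term" where
  "dmv_multiple 0 f = DZero"
| "dmv_multiple (Suc n) f = DPlus f (dmv_multiple n f)"

lemma dmv_multiple_in [simp]: "f \<in> dmv_terms X \<Longrightarrow> dmv_multiple n f \<in> dmv_terms X"
  by (induction n) (simp_all add: dmv_terms.intros)

lemma dmv_val_multiple: "0 \<le> dmv_val e f \<Longrightarrow> dmv_val e (dmv_multiple n f) = clip (of_nat n * dmv_val e f)"
  by (induction n) (auto simp: clip_def min_def max_def algebra_simps)

text \<open>The MV-element is the sum of \<open>n\<close> copies of \<open>C\<close>, hence in every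
  ideal containing \<open>C\<close>, and lies above \<open>C\<close> since \<open>n\<close> is
  positive. Quantifying over all ideals lets generators be exchanged one by one.\<close>

lemma dmv_ideal_generator:
  assumes C: "C \<in> carrier (DMV X)"
  shows "\<exists>D\<in>carrier (MV X). \<forall>I. mv_ideal (DMV X) I \<longrightarrow> (C \<in> I \<longleftrightarrow> iota X D \<in> I)"
proof -
  obtain f where f: "f \<in> dmv_terms X" and Cf: "C = dmv_eq X `` {f}" using C by (rule DMV_cases)
  obtain n \<phi> where n: "n > 0" "mv_sum X \<phi>" "\<And>e. e \<in> X \<rightarrow> {0..1} \<Longrightarrow> of_nat n * dmv_val e f = \<phi> e"
    using dmv_term_multiple[OF f] by blast
  obtain t where t: "t \<in> mv_terms X" "\<And>e. e \<in> X \<rightarrow> {0..1} \<Longrightarrow> mv_val e t = clip (\<phi> e - of_int 0)"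
    using mv_sum_clip[OF n(2), of 0] by blast
  have val: "mv_val e t = clip (of_nat n * dmv_val e f)" if "e \<in> X \<rightarrow> {0..1}" for e
    using t(2)[OF that] n(3)[OF that] by simp
  have "(emb_term t, dmv_multiple n f) \<in> dmv_eq X"
    using t f by (intro DMV_complete) (simp_all add: val dmv_val_multiple dmv_val_range)
  then have iota: "iota X (mv_eq X `` {t}) = dmv_eq X `` {dmv_multiple n f}"
    using t by (simp add: iota_class dmv_class_eq)
  have "(DPlus (DNeg f) (emb_term t), DNeg DZero) \<in> dmv_eq X"
  proof (rule DMV_complete)
    fix e :: "'a \<Rightarrow> real" assume e: "e \<in> X \<rightarrow> {0..1}"
    have "1 * dmv_val e f \<le> of_nat n * dmv_val e f"
      using n(1) dmv_val_range[OF e f] by (intro mult_right_mono) auto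
    then show "dmv_val e (DPlus (DNeg f) (emb_term t)) = dmv_val e (DNeg DZero)"
      using dmv_val_range[OF e f] by (simp add: val[OF e] clip_def)
  qed (use f t in \<open>auto intro: dmv_terms.intros\<close>)
  then have le: "C \<preceq>\<^bsub>DMV X\<^esub> iota X (mv_eq X `` {t})"
    using f t by (simp add: mvle_def mvone_def Cf iota_class DMV_ops dmv_terms.intros dmv_class_eq)
  have "C \<in> I \<longleftrightarrow> iota X (mv_eq X `` {t}) \<in> I" if I: "mv_ideal (DMV X) I" for I
  proof
    assume "iota X (mv_eq X `` {t}) \<in> I"
    then show "C \<in> I" using le I C by (auto simp: mv_ideal_def)
  next
    interpret mv_algebra "DMV X" by (rule mv_algebra_DMV)
    assume CI: "C \<in> I"
    have "dmv_eq X `` {dmv_multiple n f} \<in> I"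
    proof (induction n)
      case 0
      have "mvzero (DMV X) \<preceq>\<^bsub>DMV X\<^esub> C" using C by simp
      then show ?case using I CI unfolding mv_ideal_def by (auto simp: DMV_ops dmv_terms.intros quotientI)
    next
      case (Suc n)
      then have "oplus (DMV X) C (dmv_eq X `` {dmv_multiple n f}) \<in> I"
        using I CI by (simp add: mv_ideal_def)
      then show ?case using f by (simp add: Cf DMV_ops)
    qed
    then show "iota X (mv_eq X `` {t}) \<in> I" by (simp add: iota)
  qed
  then show ?thesis using t(1) by (intro bexI[of _ "mv_eq X `` {t}"]) simp_all
qed

subsection \<open>Ideals and homomorphisms\<close>

context mv_algebra
begin

lemma mv_ideal_gen:
  assumes "S \<subseteq> carrier A"
  shows "mv_ideal A (ideal_gen A S)"
proof -
  have "mv_ideal A (carrier A)" by (auto simp: mv_ideal_def)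
  then have "ideal_gen A S \<subseteq> carrier A" using assms by (auto simp: ideal_gen_def)
  moreover have "\<zero> \<in> ideal_gen A S" by (auto simp: ideal_gen_def ideal_zero)
  ultimately show ?thesis unfolding mv_ideal_def ideal_gen_def by blast
qed

end

lemma ideal_gen_superset: "S \<subseteq> ideal_gen A S"
  by (auto simp: ideal_gen_def)

lemma ideal_gen_least: "\<lbrakk>mv_ideal A I; S \<subseteq> I\<rbrakk> \<Longrightarrow> ideal_gen A S \<subseteq> I"
  by (auto simp: ideal_gen_def)

lemma ideal_gen_mono: "S \<subseteq> T \<Longrightarrow> ideal_gen A S \<subseteq> ideal_gen A T"
  by (auto simp: ideal_gen_def)

lemma mv_hom_closed: "\<lbrakk>h \<in> mv_hom A B; x \<in> carrier A\<rbrakk> \<Longrightarrow> h x \<in> carrier B"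
  by (auto simp: mv_hom_def PiE_iff)

lemma mv_hom_ext:
  assumes "g \<in> mv_hom A B" "h \<in> mv_hom A B" "\<And>x. x \<in> carrier A \<Longrightarrow> g x = h x"
  shows "g = h"
proof (rule extensionalityI)
  show "g \<in> extensional (carrier A)" "h \<in> extensional (carrier A)"
    using assms(1,2) by (simp_all add: mv_hom_def PiE_def)
qed (rule assms(3))

lemma mv_hom_id: "mv_algebra A \<Longrightarrow> (\<lambda>u\<in>carrier A. u) \<in> mv_hom A A"
  by (simp add: mv_hom_def mv_algebra.closed)

lemma mv_hom_compose:
  assumes "mv_algebra A" "g \<in> mv_hom A B" "h \<in> mv_hom B C"
  shows "compose (carrier A) h g \<in> mv_hom A C"
proof -
  interpret mv_algebra A by fact
  show ?thesis
    using assms(2,3) mv_hom_closed[OF assms(2)] mv_hom_closed[OF assms(3)]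
    unfolding mv_hom_def by (simp add: compose_def)
qed

lemma dmv_hom_mv_hom: "h \<in> dmv_hom A B \<Longrightarrow> h \<in> mv_hom A B"
  by (simp add: dmv_hom_def)

lemma dmv_hom_id: "dmv_algebra A \<Longrightarrow> (\<lambda>u\<in>carrier A. u) \<in> dmv_hom A A"
  by (simp add: dmv_hom_def mv_hom_id dmv_algebra.axioms(1) dmv_algebra.scal_closed)

lemma dmv_hom_compose:
  assumes "dmv_algebra A" "g \<in> dmv_hom A B" "h \<in> dmv_hom B C"
  shows "compose (carrier A) h g \<in> dmv_hom A C"
proof -
  interpret dmv_algebra A by fact
  have "compose (carrier A) h g \<in> mv_hom A C"
    by (rule mv_hom_compose[OF mv_algebra_axioms assms(2,3)[THEN dmv_hom_mv_hom]])
  then show ?thesis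
    using assms(2,3) mv_hom_closed[OF dmv_hom_mv_hom[OF assms(2)]]
    by (simp add: dmv_hom_def compose_def scal_closed)
qed

lemma hom_image_ideal_gen:
  assumes A: "mv_algebra A" and B: "mv_algebra B" and h: "h \<in> mv_hom A B" and S: "S \<subseteq> carrier A"
  shows "h ` ideal_gen A S \<subseteq> ideal_gen B (h ` S)"
proof -
  interpret A: mv_algebra A by fact
  interpret B: mv_algebra B by fact
  note cl = mv_hom_closed[OF h]
  have hom: "h \<zero>\<^bsub>A\<^esub> = \<zero>\<^bsub>B\<^esub>" "\<And>x. x \<in> carrier A \<Longrightarrow> h (\<sim>\<^bsub>A\<^esub> x) = \<sim>\<^bsub>B\<^esub> (h x)"
    "\<And>x y. \<lbrakk>x \<in> carrier A; y \<in> carrier A\<rbrakk> \<Longrightarrow> h (x \<oplus>\<^bsub>A\<^esub> y) = h x \<oplus>\<^bsub>B\<^esub> h y"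
    using h by (simp_all add: mv_hom_def)
  let ?J = "ideal_gen B (h ` S)"
  have J: "mv_ideal B ?J" using S cl by (intro B.mv_ideal_gen) auto
  have "mv_ideal A {x \<in> carrier A. h x \<in> ?J}" unfolding mv_ideal_def
  proof (intro conjI ballI impI)
    show "{x \<in> carrier A. h x \<in> ?J} \<noteq> {}"
      using B.ideal_zero[OF J] hom(1) A.zero_closed by auto
    show "x \<in> {x \<in> carrier A. h x \<in> ?J}"
      if "x \<in> carrier A" "y \<in> {x \<in> carrier A. h x \<in> ?J}" "x \<preceq>\<^bsub>A\<^esub> y" for x y
    proof -
      have "h (\<sim>\<^bsub>A\<^esub> x \<oplus>\<^bsub>A\<^esub> y) = h (\<sim>\<^bsub>A\<^esub> \<zero>\<^bsub>A\<^esub>)"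
        using that(3) by (simp add: mvle_def)
      then have "\<sim>\<^bsub>B\<^esub> (h x) \<oplus>\<^bsub>B\<^esub> h y = \<sim>\<^bsub>B\<^esub> \<zero>\<^bsub>B\<^esub>"
        using that by (simp only: hom A.closed mem_Collect_eq)
      then have "h x \<preceq>\<^bsub>B\<^esub> h y" by (simp add: mvle_def)
      then show ?thesis using that J cl by (auto simp: mv_ideal_def)
    qed
    show "x \<oplus>\<^bsub>A\<^esub> y \<in> {x \<in> carrier A. h x \<in> ?J}"
      if "x \<in> {x \<in> carrier A. h x \<in> ?J}" "y \<in> {x \<in> carrier A. h x \<in> ?J}" for x y
      using that J by (simp add: hom(3) mv_ideal_def)
  qed auto
  then have "ideal_gen A S \<subseteq> {x \<in> carrier A. h x \<in> ?J}"
    using S ideal_gen_superset[of "h ` S" B] by (intro ideal_gen_least) auto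
  then show ?thesis by auto
qed

lemma mv_gen_closed [simp]: "x \<in> X \<Longrightarrow> mv_gen X x \<in> carrier (MV X)"
  by (simp add: mv_gen_def mv_terms.intros)

lemma dmv_gen_closed [simp]: "x \<in> X \<Longrightarrow> dmv_gen X x \<in> carrier (DMV X)"
  by (simp add: dmv_gen_def dmv_terms.intros)

lemma MV_hom_eqI:
  assumes "mv_algebra B" "g \<in> mv_hom (MV X) B" "h \<in> mv_hom (MV X) B"
    "\<And>x. x \<in> X \<Longrightarrow> g (mv_gen X x) = h (mv_gen X x)"
  shows "g = h"
  using MV_free[OF assms(1), of "\<lambda>x. h (mv_gen X x)" X] assms mv_hom_closed[OF assms(3)] by auto

lemma DMV_hom_eqI:
  assumes "dmv_algebra B" "g \<in> dmv_hom (DMV X) B" "h \<in> dmv_hom (DMV X) B"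
    "\<And>x. x \<in> X \<Longrightarrow> g (dmv_gen X x) = h (dmv_gen X x)"
  shows "g = h"
  using DMV_free[OF assms(1), of "\<lambda>x. h (dmv_gen X x)" X] assms
    mv_hom_closed[OF dmv_hom_mv_hom[OF assms(3)]] by auto

lemma iota_closed: "u \<in> carrier (MV X) \<Longrightarrow> iota X u \<in> carrier (DMV X)"
  by (rule mv_hom_closed[OF iota_hom])

text \<open>Both composites are MV-homomorphisms on \<open>MV X\<close> that agree on the
  generators.\<close>

lemma iota_square:
  assumes \<sigma>: "\<sigma> \<in> mv_hom (MV X) (MV Y)" and \<tau>: "\<tau> \<in> dmv_hom (DMV X) (DMV Y)"
    and gen: "\<And>x. x \<in> X \<Longrightarrow> \<tau> (dmv_gen X x) = iota Y (\<sigma> (mv_gen X x))"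
    and u: "u \<in> carrier (MV X)"
  shows "\<tau> (iota X u) = iota Y (\<sigma> u)"
proof -
  have "compose (carrier (MV X)) \<tau> (iota X) = compose (carrier (MV X)) (iota Y) \<sigma>"
  proof (rule MV_hom_eqI[OF mv_algebra_DMV])
    show "compose (carrier (MV X)) \<tau> (iota X) \<in> mv_hom (MV X) (DMV Y)"
      by (rule mv_hom_compose[OF mv_algebra_MV iota_hom dmv_hom_mv_hom[OF \<tau>]])
    show "compose (carrier (MV X)) (iota Y) \<sigma> \<in> mv_hom (MV X) (DMV Y)"
      by (rule mv_hom_compose[OF mv_algebra_MV \<sigma> iota_hom])
  qed (simp add: compose_def iota_gen gen)
  from fun_cong[OF this, of u] show ?thesis using u by (simp add: compose_def)
qed

subsection \<open>Ideals of free algebras\<close>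

text \<open>It carries finite generating sets through the embedding, in both directions of the
  correspondence of ideals.\<close>

lemma DMV_ideal_gen_iota:
  assumes F: "F \<subseteq> carrier (MV X)"
  shows "ideal_gen (DMV X) (iota X ` ideal_gen (MV X) F) = ideal_gen (DMV X) (iota X ` F)"
proof
  interpret D: mv_algebra "DMV X" by (rule mv_algebra_DMV)
  show "ideal_gen (DMV X) (iota X ` ideal_gen (MV X) F) \<subseteq> ideal_gen (DMV X) (iota X ` F)"
    using F iota_closed
    by (intro ideal_gen_least D.mv_ideal_gen hom_image_ideal_gen mv_algebra_MV mv_algebra_DMV iota_hom) auto
  show "ideal_gen (DMV X) (iota X ` F) \<subseteq> ideal_gen (DMV X) (iota X ` ideal_gen (MV X) F)"
    by (intro ideal_gen_mono image_mono ideal_gen_superset)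
qed

lemma iota_le_iff:
  assumes "u \<in> carrier (MV X)" "v \<in> carrier (MV X)"
  shows "iota X u \<preceq>\<^bsub>DMV X\<^esub> iota X v \<longleftrightarrow> u \<preceq>\<^bsub>MV X\<^esub> v"
proof -
  interpret M: mv_algebra "MV X" by (rule mv_algebra_MV)
  have "iota X (\<sim>\<^bsub>MV X\<^esub> u \<oplus>\<^bsub>MV X\<^esub> v) = \<sim>\<^bsub>DMV X\<^esub> (iota X u) \<oplus>\<^bsub>DMV X\<^esub> iota X v"
    "iota X (\<sim>\<^bsub>MV X\<^esub> \<zero>\<^bsub>MV X\<^esub>) = \<sim>\<^bsub>DMV X\<^esub> \<zero>\<^bsub>DMV X\<^esub>"
    using iota_hom[of X] assms by (simp_all only: mv_hom_def mem_Collect_eq M.closed)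
  then show ?thesis
    using inj_on_eq_iff[OF inj_on_iota, of "\<sim>\<^bsub>MV X\<^esub> u \<oplus>\<^bsub>MV X\<^esub> v" X "\<sim>\<^bsub>MV X\<^esub> \<zero>\<^bsub>MV X\<^esub>"] assms
    by (simp only: mvle_def mvone_def M.closed)
qed

text \<open>The downward closure \<open>J\<close> of the image of \<open>I\<close> is already an
  ideal, because \<open>iota X\<close> preserves sums. An element of it lies below the image of some
  \<open>v \<in> I\<close>, and an injective homomorphism reflects the order, which is an
  equation.\<close>

lemma iota_in_ideal_gen_iff:
  assumes I: "mv_ideal (MV X) I" and u: "u \<in> carrier (MV X)"
  shows "iota X u \<in> ideal_gen (DMV X) (iota X ` I) \<longleftrightarrow> u \<in> I"
proof
  interpret D: mv_algebra "DMV X" by (rule mv_algebra_DMV)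
  have I_sub: "I \<subseteq> carrier (MV X)" using I by (simp add: mv_ideal_def)
  define J where "J = {y \<in> carrier (DMV X). \<exists>v\<in>I. y \<preceq>\<^bsub>DMV X\<^esub> iota X v}"
  have "mv_ideal (DMV X) J" unfolding mv_ideal_def
  proof (intro conjI ballI impI)
    obtain v where v: "v \<in> I" using I by (auto simp: mv_ideal_def)
    then have "iota X v \<in> J" using I_sub by (auto simp: J_def intro!: iota_closed bexI[of _ v] D.le_refl)
    then show "J \<noteq> {}" by blast
    show "x \<in> J" if x: "x \<in> carrier (DMV X)" "y \<in> J" "x \<preceq>\<^bsub>DMV X\<^esub> y" for x y
    proof -
      obtain v where v: "v \<in> I" "y \<preceq>\<^bsub>DMV X\<^esub> iota X v" "y \<in> carrier (DMV X)"
        using x by (auto simp: J_def)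
      then have "x \<preceq>\<^bsub>DMV X\<^esub> iota X v"
        using D.le_trans[OF x(3) v(2)] x I_sub iota_closed by blast
      then show ?thesis using v x by (auto simp: J_def)
    qed
    show "x \<oplus>\<^bsub>DMV X\<^esub> y \<in> J" if x: "x \<in> J" and y: "y \<in> J" for x y
    proof -
      obtain v where v: "v \<in> I" "x \<preceq>\<^bsub>DMV X\<^esub> iota X v" "x \<in> carrier (DMV X)"
        using x by (auto simp: J_def)
      obtain w where w: "w \<in> I" "y \<preceq>\<^bsub>DMV X\<^esub> iota X w" "y \<in> carrier (DMV X)"
        using y by (auto simp: J_def)
      have vw: "v \<in> carrier (MV X)" "w \<in> carrier (MV X)" using v w I_sub by auto
      then have "x \<oplus>\<^bsub>DMV X\<^esub> y \<preceq>\<^bsub>DMV X\<^esub> iota X v \<oplus>\<^bsub>DMV X\<^esub> iota X w"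
        using v w by (intro D.oplus_mono iota_closed)
      also have "\<dots> = iota X (v \<oplus>\<^bsub>MV X\<^esub> w)" using iota_hom[of X] vw by (simp add: mv_hom_def)
      finally have "x \<oplus>\<^bsub>DMV X\<^esub> y \<preceq>\<^bsub>DMV X\<^esub> iota X (v \<oplus>\<^bsub>MV X\<^esub> w)" .
      moreover have "v \<oplus>\<^bsub>MV X\<^esub> w \<in> I" using I v w by (simp add: mv_ideal_def)
      ultimately show ?thesis using v w by (auto simp: J_def)
    qed
  qed (simp add: J_def)
  moreover have "iota X ` I \<subseteq> J"
    using I_sub by (auto simp: J_def intro!: iota_closed D.le_refl)
  ultimately have "ideal_gen (DMV X) (iota X ` I) \<subseteq> J" by (rule ideal_gen_least)
  moreover assume "iota X u \<in> ideal_gen (DMV X) (iota X ` I)"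
  ultimately obtain v where "v \<in> I" "iota X u \<preceq>\<^bsub>DMV X\<^esub> iota X v" by (auto simp: J_def)
  then show "u \<in> I" using I_sub u I iota_le_iff[of u X v] by (auto simp: mv_ideal_def)
next
  assume "u \<in> I"
  then show "iota X u \<in> ideal_gen (DMV X) (iota X ` I)"
    using ideal_gen_superset[of "iota X ` I" "DMV X"] by blast
qed

lemma fin_gen_ideal_sub:
  assumes "mv_algebra A" "fin_gen_ideal A I"
  shows "mv_ideal A I" "I \<subseteq> carrier A"
proof -
  show "mv_ideal A I"
    using assms(2) mv_algebra.mv_ideal_gen[OF assms(1)] by (auto simp: fin_gen_ideal_def)
  then show "I \<subseteq> carrier A" by (simp add: mv_ideal_def)
qed

lemma fin_gen_DMV_iota:
  assumes "fin_gen_ideal (MV X) I"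
  shows "fin_gen_ideal (DMV X) (ideal_gen (DMV X) (iota X ` I))"
proof -
  obtain F where F: "finite F" "F \<subseteq> carrier (MV X)" "I = ideal_gen (MV X) F"
    using assms by (auto simp: fin_gen_ideal_def)
  have "ideal_gen (DMV X) (iota X ` I) = ideal_gen (DMV X) (iota X ` F)"
    unfolding F(3) by (rule DMV_ideal_gen_iota[OF F(2)])
  moreover have "iota X ` F \<subseteq> carrier (DMV X)" using F(2) iota_closed by blast
  ultimately show ?thesis unfolding fin_gen_ideal_def using F(1) by blast
qed

text \<open>Each generator is replaced by an MV-element that lies in the same ideals. Then the old
  and the new generators are contained in the same ideals, and so generate the same one.\<close>

lemma fin_gen_DMV_from_MV:
  assumes "fin_gen_ideal (DMV X) I"
  shows "\<exists>J. fin_gen_ideal (MV X) J \<and> I = ideal_gen (DMV X) (iota X ` J)"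
proof -
  obtain F where F: "finite F" "F \<subseteq> carrier (DMV X)" "I = ideal_gen (DMV X) F"
    using assms by (auto simp: fin_gen_ideal_def)
  have "\<forall>C\<in>F. \<exists>D. D \<in> carrier (MV X) \<and>
      (\<forall>K. mv_ideal (DMV X) K \<longrightarrow> (C \<in> K \<longleftrightarrow> iota X D \<in> K))"
  proof
    fix C assume "C \<in> F"
    then have "C \<in> carrier (DMV X)" using F(2) by blast
    from dmv_ideal_generator[OF this]
    show "\<exists>D. D \<in> carrier (MV X) \<and> (\<forall>K. mv_ideal (DMV X) K \<longrightarrow> (C \<in> K \<longleftrightarrow> iota X D \<in> K))"
      by blast
  qed
  then obtain d where d: "\<forall>C\<in>F. d C \<in> carrier (MV X) \<and>
      (\<forall>K. mv_ideal (DMV X) K \<longrightarrow> (C \<in> K \<longleftrightarrow> iota X (d C) \<in> K))"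
    by (rule bchoice[THEN exE])
  then have dF: "d ` F \<subseteq> carrier (MV X)" by blast
  have "F \<subseteq> K \<longleftrightarrow> iota X ` d ` F \<subseteq> K" if "mv_ideal (DMV X) K" for K
    using d that by (simp add: image_subset_iff subset_eq[of F])
  then have "{K. mv_ideal (DMV X) K \<and> F \<subseteq> K} = {K. mv_ideal (DMV X) K \<and> iota X ` d ` F \<subseteq> K}"
    by blast
  then have "I = ideal_gen (DMV X) (iota X ` d ` F)" by (simp only: F(3) ideal_gen_def)
  also have "\<dots> = ideal_gen (DMV X) (iota X ` ideal_gen (MV X) (d ` F))"
    by (rule DMV_ideal_gen_iota[OF dF, symmetric])
  finally have "I = ideal_gen (DMV X) (iota X ` ideal_gen (MV X) (d ` F))" .
  moreover have "fin_gen_ideal (MV X) (ideal_gen (MV X) (d ` F))"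
    unfolding fin_gen_ideal_def using F(1) dF by blast
  ultimately show ?thesis by blast
qed

subsection \<open>Functors bijective on objects and arrows\<close>

text \<open>The inverse functor is the inverse on objects and on each hom-set. Both composites act
  as the identity on objects and arrows of the categories, so identity arrows serve as the natural
  isomorphisms.\<close>

lemma is_equivalence_bijective:
  assumes F: "is_functor C D F"
    and obj: "bij_betw (on_obj F) (Obj C) (Obj D)"
    and hom: "\<And>a b. \<lbrakk>a \<in> Obj C; b \<in> Obj C\<rbrakk> \<Longrightarrow>
      bij_betw (on_arr F a b) (Hom C a b) (Hom D (on_obj F a) (on_obj F b))"
  shows "is_equivalence C D F"
proof -
  have C: "category C" and D: "category D" using F by (simp_all add: is_functor_def)
  have F_obj: "on_obj F a \<in> Obj D" if "a \<in> Obj C" for a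
    using F that by (simp add: is_functor_def)
  have F_arr: "on_arr F a b f \<in> Hom D (on_obj F a) (on_obj F b)"
    if "a \<in> Obj C" "b \<in> Obj C" "f \<in> Hom C a b" for a b f
    using F that by (simp add: is_functor_def)
  have F_id: "on_arr F a a (Id C a) = Id D (on_obj F a)" if "a \<in> Obj C" for a
    using F that by (simp add: is_functor_def)
  have F_comp: "on_arr F a c (Comp C a b c g f) =
      Comp D (on_obj F a) (on_obj F b) (on_obj F c) (on_arr F b c g) (on_arr F a b f)"
    if "a \<in> Obj C" "b \<in> Obj C" "c \<in> Obj C" "f \<in> Hom C a b" "g \<in> Hom C b c" for a b c f g
    using F that by (simp add: is_functor_def)
  have C_id: "Id C a \<in> Hom C a a" if "a \<in> Obj C" for a using C that by (simp add: category_def)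
  have C_comp: "Comp C a b c g f \<in> Hom C a c"
    if "a \<in> Obj C" "b \<in> Obj C" "c \<in> Obj C" "f \<in> Hom C a b" "g \<in> Hom C b c" for a b c f g
    using C that unfolding category_def by blast
  have C_unit: "Comp C a a b f (Id C a) = f" "Comp C a b b (Id C b) f = f"
    if "a \<in> Obj C" "b \<in> Obj C" "f \<in> Hom C a b" for a b f
    using C that unfolding category_def by blast+
  have D_id: "Id D a \<in> Hom D a a" if "a \<in> Obj D" for a using D that by (simp add: category_def)
  have D_unit: "Comp D a a b f (Id D a) = f" "Comp D a b b (Id D b) f = f"
    if "a \<in> Obj D" "b \<in> Obj D" "f \<in> Hom D a b" for a b f
    using D that unfolding category_def by blast+
  define g where "g = inv_into (Obj C) (on_obj F)"
  define ga where "ga x y = inv_into (Hom C (g x) (g y)) (on_arr F (g x) (g y))" for x y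
  define G where "G = \<lparr>on_obj = g, on_arr = ga\<rparr>"
  have g: "g x \<in> Obj C" "on_obj F (g x) = x" if "x \<in> Obj D" for x
    using bij_betw_inv_into_right[OF obj that] bij_betwE[OF bij_betw_inv_into[OF obj]] that
    by (simp_all add: g_def)
  have gF: "g (on_obj F a) = a" if "a \<in> Obj C" for a
    using bij_betw_inv_into_left[OF obj that] by (simp add: g_def)
  have ga: "ga x y f \<in> Hom C (g x) (g y)" "on_arr F (g x) (g y) (ga x y f) = f"
    if "x \<in> Obj D" "y \<in> Obj D" "f \<in> Hom D x y" for x y f
  proof -
    have bij: "bij_betw (on_arr F (g x) (g y)) (Hom C (g x) (g y)) (Hom D x y)"
      using hom[of "g x" "g y"] g that by simp
    show "ga x y f \<in> Hom C (g x) (g y)" "on_arr F (g x) (g y) (ga x y f) = f"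
      using bij_betw_inv_into_right[OF bij that(3)] bij_betwE[OF bij_betw_inv_into[OF bij]] that(3)
      by (simp_all add: ga_def)
  qed
  have ga_F: "ga x y (on_arr F (g x) (g y) h) = h"
    if "x \<in> Obj D" "y \<in> Obj D" "h \<in> Hom C (g x) (g y)" for x y h
    using bij_betw_inv_into_left[OF hom that(3)] g that by (simp add: ga_def)
  have "is_functor D C G"
    unfolding is_functor_def
  proof (intro conjI ballI C D)
    fix x assume x: "x \<in> Obj D"
    show "on_obj G x \<in> Obj C" using g x by (simp add: G_def)
    show "on_arr G x x (Id D x) = Id C (on_obj G x)"
      using ga_F[OF x x, of "Id C (g x)"] g[OF x] by (simp add: G_def F_id C_id)
    fix y f assume y: "y \<in> Obj D" and f: "f \<in> Hom D x y"
    show "on_arr G x y f \<in> Hom C (on_obj G x) (on_obj G y)"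
      using ga x y f by (simp add: G_def)
  next
    fix x y z f h
    assume x: "x \<in> Obj D" and y: "y \<in> Obj D" and z: "z \<in> Obj D"
      and f: "f \<in> Hom D x y" and h: "h \<in> Hom D y z"
    \<comment> \<open>The law for \<open>G\<close> is read off after applying \<open>F\<close>,
      which is injective on the hom-set.\<close>
    have "on_arr F (g x) (g z) (Comp C (g x) (g y) (g z) (ga y z h) (ga x y f)) = Comp D x y z h f"
      using F_comp[of "g x" "g y" "g z" "ga x y f" "ga y z h"] g ga x y z f h by simp
    then have "ga x z (Comp D x y z h f) = Comp C (g x) (g y) (g z) (ga y z h) (ga x y f)"
      using ga_F[OF x z, of "Comp C (g x) (g y) (g z) (ga y z h) (ga x y f)"] g ga x y z f h
      by (simp add: C_comp)
    then show "on_arr G x z (Comp D x y z h f) =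
        Comp C (on_obj G x) (on_obj G y) (on_obj G z) (on_arr G y z h) (on_arr G x y f)"
      by (simp add: G_def)
  qed
  moreover have "natural_iso C C id_functor (comp_functor G F) (Id C)"
    unfolding natural_iso_def
  proof (intro conjI ballI)
    fix a assume a: "a \<in> Obj C"
    show "is_iso C (on_obj id_functor a) (on_obj (comp_functor G F) a) (Id C a)"
      using a gF C_id C_unit unfolding is_iso_def
      by (auto simp: id_functor_def comp_functor_def G_def intro!: bexI[of _ "Id C a"])
    fix b f assume b: "b \<in> Obj C" and f: "f \<in> Hom C a b"
    have "ga (on_obj F a) (on_obj F b) (on_arr F a b f) = f"
      using ga_F[of "on_obj F a" "on_obj F b" f] F_obj gF a b f by simp
    then show "Comp C (on_obj id_functor a) (on_obj id_functor b) (on_obj (comp_functor G F) b)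
          (Id C b) (on_arr id_functor a b f) =
        Comp C (on_obj id_functor a) (on_obj (comp_functor G F) a) (on_obj (comp_functor G F) b)
          (on_arr (comp_functor G F) a b f) (Id C a)"
      using a b f by (simp add: id_functor_def comp_functor_def G_def gF C_unit)
  qed
  moreover have "natural_iso D D (comp_functor F G) id_functor (Id D)"
    unfolding natural_iso_def
  proof (intro conjI ballI)
    fix x assume x: "x \<in> Obj D"
    show "is_iso D (on_obj (comp_functor F G) x) (on_obj id_functor x) (Id D x)"
      using x g D_id D_unit unfolding is_iso_def
      by (auto simp: id_functor_def comp_functor_def G_def intro!: bexI[of _ "Id D x"])
    fix y f assume y: "y \<in> Obj D" and f: "f \<in> Hom D x y"
    then show "Comp D (on_obj (comp_functor F G) x) (on_obj (comp_functor F G) y) (on_obj id_functor y)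
          (Id D y) (on_arr (comp_functor F G) x y f) =
        Comp D (on_obj (comp_functor F G) x) (on_obj id_functor x) (on_obj id_functor y)
          (on_arr id_functor x y f) (Id D x)"
      using x by (simp add: id_functor_def comp_functor_def G_def g ga D_unit)
  qed
  ultimately show ?thesis using F unfolding is_equivalence_def by blast
qed

subsection \<open>The functor between the categories of theories\<close>

lemma ThMV_simps:
  "(X, I) \<in> Obj ThMV \<longleftrightarrow> fin_gen_ideal (MV X) I"
  "Hom ThMV (X, I) (Y, J) = {\<sigma> \<in> mv_hom (MV X) (MV Y). \<sigma> ` I \<subseteq> J}"
  "Id ThMV (X, I) = (\<lambda>u\<in>carrier (MV X). u)"
  "Comp ThMV (X, I) B C \<tau> \<sigma> = compose (carrier (MV X)) \<tau> \<sigma>"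
  by (simp_all add: ThMV_def)

lemma ThDMV'_simps:
  "(X, I) \<in> Obj ThDMV' \<longleftrightarrow> fin_gen_ideal (DMV X) I"
  "Hom ThDMV' (X, I) (Y, J) = {\<sigma> \<in> dmv_hom (DMV X) (DMV Y). \<sigma> ` I \<subseteq> J \<and>
     (\<forall>x\<in>X. \<sigma> (dmv_gen X x) \<in> iota Y ` carrier (MV Y))}"
  "Id ThDMV' (X, I) = (\<lambda>u\<in>carrier (DMV X). u)"
  "Comp ThDMV' (X, I) B C \<tau> \<sigma> = compose (carrier (DMV X)) \<tau> \<sigma>"
  by (auto simp: ThDMV'_def ThDMV_def)

lemma DT_obj_simp: "DT_obj (X, I) = (X, ideal_gen (DMV X) (iota X ` I))"
  by (simp add: DT_obj_def)

lemma DT_spec_simp: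
  "DT_spec (X, I) (Y, J) \<sigma> \<tau> \<longleftrightarrow> \<tau> \<in> dmv_hom (DMV X) (DMV Y) \<and>
     \<tau> ` ideal_gen (DMV X) (iota X ` I) \<subseteq> ideal_gen (DMV Y) (iota Y ` J) \<and>
     (\<forall>x\<in>X. \<tau> (dmv_gen X x) = iota Y (\<sigma> (mv_gen X x)))"
  by (simp add: DT_spec_def DT_obj_def ThDMV_def)

lemma compose_unit:
  assumes "h \<in> mv_hom A B"
  shows "compose (carrier A) h (\<lambda>u\<in>carrier A. u) = h"
    and "compose (carrier A) (\<lambda>u\<in>carrier B. u) h = h"
  using assms mv_hom_closed[OF assms]
  by (auto simp: compose_def mv_hom_def PiE_def extensional_def fun_eq_iff)

lemma compose_hom_assoc:
  assumes "f \<in> mv_hom A B"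
  shows "compose (carrier A) (compose (carrier B) h g) f = compose (carrier A) h (compose (carrier A) g f)"
  using mv_hom_closed[OF assms] by (auto simp: compose_def fun_eq_iff)

lemma category_ThMV: "category (ThMV :: ('v mv_theory, 'v mv_term set \<Rightarrow> 'v mv_term set) cat)"
  unfolding category_def
proof (intro conjI ballI)
  fix A assume "A \<in> Obj (ThMV :: ('v mv_theory, 'v mv_term set \<Rightarrow> 'v mv_term set) cat)"
  then obtain X I where A: "A = (X, I)" and fg: "fin_gen_ideal (MV X) I"
    by (cases A) (simp add: ThMV_simps)
  have I: "I \<subseteq> carrier (MV X)" by (rule fin_gen_ideal_sub[OF mv_algebra_MV fg])
  show "Id ThMV A \<in> Hom ThMV A A"
    using mv_hom_id[OF mv_algebra_MV, of X] I by (auto simp: A ThMV_simps)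
  fix B :: "'v mv_theory" and f :: "'v mv_term set \<Rightarrow> 'v mv_term set"
  obtain Y J where B: "B = (Y, J)" by (cases B)
  assume f: "f \<in> Hom ThMV A B"
  show "Comp ThMV A A B f (Id ThMV A) = f" "Comp ThMV A B B (Id ThMV B) f = f"
    using f by (auto simp: A B ThMV_simps intro: compose_unit)
next
  fix A B C D :: "'v mv_theory" and f g h :: "'v mv_term set \<Rightarrow> 'v mv_term set"
  obtain X I Y J Z K W L where ABCD: "A = (X, I)" "B = (Y, J)" "C = (Z, K)" "D = (W, L)"
    by (cases A; cases B; cases C; cases D)
  assume "A \<in> Obj ThMV" and f: "f \<in> Hom ThMV A B" and g: "g \<in> Hom ThMV B C"
  then have I: "I \<subseteq> carrier (MV X)"
    using fin_gen_ideal_sub[OF mv_algebra_MV, of X I] by (simp add: ABCD ThMV_simps)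
  have fg: "f \<in> mv_hom (MV X) (MV Y)" "f ` I \<subseteq> J" "g \<in> mv_hom (MV Y) (MV Z)" "g ` J \<subseteq> K"
    using f g by (simp_all add: ABCD ThMV_simps)
  have "compose (carrier (MV X)) g f ` I \<subseteq> K" using fg I by (auto simp: compose_def)
  then show "Comp ThMV A B C g f \<in> Hom ThMV A C"
    using mv_hom_compose[OF mv_algebra_MV fg(1,3)] by (simp add: ABCD ThMV_simps)
  show "Comp ThMV A B D (Comp ThMV B C D h g) f = Comp ThMV A C D h (Comp ThMV A B C g f)"
    using compose_hom_assoc[OF fg(1)] by (simp add: ABCD ThMV_simps)
qed

text \<open>The values on generators are pulled back through the embedding and extended by freeness.
  The last conclusion extends a condition on generators to all of \<open>MV X\<close>.\<close>

lemma MV_hom_lift: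
  assumes \<tau>: "\<tau> \<in> dmv_hom (DMV X) (DMV Y)"
    and gen: "\<And>x. x \<in> X \<Longrightarrow> \<tau> (dmv_gen X x) \<in> iota Y ` carrier (MV Y)"
  obtains \<sigma> where "\<sigma> \<in> mv_hom (MV X) (MV Y)"
    "\<And>x. x \<in> X \<Longrightarrow> \<tau> (dmv_gen X x) = iota Y (\<sigma> (mv_gen X x))"
    "\<And>u. u \<in> carrier (MV X) \<Longrightarrow> \<tau> (iota X u) = iota Y (\<sigma> u)"
proof -
  define f where "f x = inv_into (carrier (MV Y)) (iota Y) (\<tau> (dmv_gen X x))" for x
  have f: "f x \<in> carrier (MV Y)" "iota Y (f x) = \<tau> (dmv_gen X x)" if "x \<in> X" for x
    using inv_into_into[OF gen[OF that]] f_inv_into_f[OF gen[OF that]] by (simp_all add: f_def)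
  have "f \<in> X \<rightarrow> carrier (MV Y)" using f by simp
  from MV_free[OF mv_algebra_MV this]
  obtain \<sigma> where \<sigma>: "\<sigma> \<in> mv_hom (MV X) (MV Y)" "\<And>x. x \<in> X \<Longrightarrow> \<sigma> (mv_gen X x) = f x" by blast
  then have gen': "\<tau> (dmv_gen X x) = iota Y (\<sigma> (mv_gen X x))" if "x \<in> X" for x
    using f that by simp
  show thesis
    by (rule that[OF \<sigma>(1)]) (use gen' iota_square[OF \<sigma>(1) \<tau> gen'] in blast)+
qed

lemma category_ThDMV': "category (ThDMV' :: ('v dmv_theory, 'v dmv_term set \<Rightarrow> 'v dmv_term set) cat)"
  unfolding category_def
proof (intro conjI ballI)
  fix A assume "A \<in> Obj (ThDMV' :: ('v dmv_theory, 'v dmv_term set \<Rightarrow> 'v dmv_term set) cat)"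
  then obtain X I where A: "A = (X, I)" and fg: "fin_gen_ideal (DMV X) I"
    by (cases A) (simp add: ThDMV'_simps)
  have I: "I \<subseteq> carrier (DMV X)" by (rule fin_gen_ideal_sub[OF mv_algebra_DMV fg])
  have "dmv_gen X x \<in> iota X ` carrier (MV X)" if "x \<in> X" for x
    using that by (auto simp: iota_gen[symmetric])
  then show "Id ThDMV' A \<in> Hom ThDMV' A A"
    using dmv_hom_id[OF dmv_algebra_DMV, of X] I by (auto simp: A ThDMV'_simps)
  fix B :: "'v dmv_theory" and f :: "'v dmv_term set \<Rightarrow> 'v dmv_term set"
  obtain Y J where B: "B = (Y, J)" by (cases B)
  assume f: "f \<in> Hom ThDMV' A B"
  show "Comp ThDMV' A A B f (Id ThDMV' A) = f" "Comp ThDMV' A B B (Id ThDMV' B) f = f"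
    using f by (auto simp: A B ThDMV'_simps intro: compose_unit dmv_hom_mv_hom)
next
  fix A B C D :: "'v dmv_theory" and f g h :: "'v dmv_term set \<Rightarrow> 'v dmv_term set"
  obtain X I Y J Z K W L where ABCD: "A = (X, I)" "B = (Y, J)" "C = (Z, K)" "D = (W, L)"
    by (cases A; cases B; cases C; cases D)
  assume "A \<in> Obj ThDMV'" and f: "f \<in> Hom ThDMV' A B" and g: "g \<in> Hom ThDMV' B C"
  then have I: "I \<subseteq> carrier (DMV X)"
    using fin_gen_ideal_sub[OF mv_algebra_DMV, of X I] by (simp add: ABCD ThDMV'_simps)
  have fg: "f \<in> dmv_hom (DMV X) (DMV Y)" "f ` I \<subseteq> J" "g \<in> dmv_hom (DMV Y) (DMV Z)" "g ` J \<subseteq> K"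
    and f_gen: "\<And>x. x \<in> X \<Longrightarrow> f (dmv_gen X x) \<in> iota Y ` carrier (MV Y)"
    and g_gen: "\<And>y. y \<in> Y \<Longrightarrow> g (dmv_gen Y y) \<in> iota Z ` carrier (MV Z)"
    using f g by (simp_all add: ABCD ThDMV'_simps)
  \<comment> \<open>The generators of \<open>DMV X\<close> are sent by \<open>f\<close> to arbitrary
    elements of the image of \<open>MV Y\<close>, whereas \<open>g\<close> is controlled only on
    generators; the lift closes this gap.\<close>
  obtain \<sigma> where \<sigma>: "\<sigma> \<in> mv_hom (MV Y) (MV Z)"
    "\<And>u. u \<in> carrier (MV Y) \<Longrightarrow> g (iota Y u) = iota Z (\<sigma> u)"
    by (rule MV_hom_lift[OF fg(3) g_gen]) blast+
  have "g (f (dmv_gen X x)) \<in> iota Z ` carrier (MV Z)" if "x \<in> X" for x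
    using f_gen[OF that] \<sigma>(2) mv_hom_closed[OF \<sigma>(1)] by auto
  moreover have "compose (carrier (DMV X)) g f ` I \<subseteq> K" using fg I by (auto simp: compose_def)
  ultimately show "Comp ThDMV' A B C g f \<in> Hom ThDMV' A C"
    using dmv_hom_compose[OF dmv_algebra_DMV fg(1,3)] by (simp add: ABCD ThDMV'_simps compose_def)
  show "Comp ThDMV' A B D (Comp ThDMV' B C D h g) f = Comp ThDMV' A C D h (Comp ThDMV' A B C g f)"
    using compose_hom_assoc[OF dmv_hom_mv_hom[OF fg(1)]] by (simp add: ABCD ThDMV'_simps)
qed

text \<open>Freeness gives the homomorphism and its uniqueness. The ideals are respected because the
  square with the embeddings sends the image of \<open>I\<close> into that of \<open>J\<close>, and
  it suffices to test generators.\<close>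

lemma DT_spec_unique_exists:
  assumes A: "A \<in> Obj ThMV" and \<sigma>: "\<sigma> \<in> Hom ThMV A B"
  shows "\<exists>!\<tau>. DT_spec A B \<sigma> \<tau>"
proof -
  obtain X I Y J where AB: "A = (X, I)" "B = (Y, J)" by (cases A; cases B)
  have I: "I \<subseteq> carrier (MV X)"
    using A fin_gen_ideal_sub[OF mv_algebra_MV, of X I] by (simp add: AB ThMV_simps)
  have hom: "\<sigma> \<in> mv_hom (MV X) (MV Y)" and IJ: "\<sigma> ` I \<subseteq> J" using \<sigma> by (simp_all add: AB ThMV_simps)
  have "(\<lambda>x. iota Y (\<sigma> (mv_gen X x))) \<in> X \<rightarrow> carrier (DMV Y)"
    by (intro funcsetI iota_closed mv_hom_closed[OF hom] mv_gen_closed)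
  from DMV_free[OF dmv_algebra_DMV this]
  obtain \<tau> where \<tau>: "\<tau> \<in> dmv_hom (DMV X) (DMV Y)"
    and gen: "\<And>x. x \<in> X \<Longrightarrow> \<tau> (dmv_gen X x) = iota Y (\<sigma> (mv_gen X x))" by blast
  have iI: "iota X ` I \<subseteq> carrier (DMV X)" using I iota_closed by auto
  have "\<tau> ` ideal_gen (DMV X) (iota X ` I) \<subseteq> ideal_gen (DMV Y) (\<tau> ` iota X ` I)"
    by (rule hom_image_ideal_gen[OF mv_algebra_DMV mv_algebra_DMV dmv_hom_mv_hom[OF \<tau>] iI])
  also have "\<dots> \<subseteq> ideal_gen (DMV Y) (iota Y ` J)"
  proof (rule ideal_gen_mono)
    have "\<tau> (iota X u) = iota Y (\<sigma> u)" if "u \<in> I" for u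
      using iota_square[OF hom \<tau> gen] that I by blast
    then show "\<tau> ` iota X ` I \<subseteq> iota Y ` J" using IJ by auto
  qed
  finally have "DT_spec A B \<sigma> \<tau>" using \<tau> gen by (simp add: AB DT_spec_simp)
  moreover have "\<tau>' = \<tau>" if "DT_spec A B \<sigma> \<tau>'" for \<tau>'
  proof -
    have \<tau>': "\<tau>' \<in> dmv_hom (DMV X) (DMV Y)" "\<forall>x\<in>X. \<tau>' (dmv_gen X x) = iota Y (\<sigma> (mv_gen X x))"
      using that by (simp_all add: AB DT_spec_simp)
    show ?thesis
      by (rule DMV_hom_eqI[OF dmv_algebra_DMV \<tau>'(1) \<tau>]) (use gen \<tau>'(2) in simp)
  qed
  ultimately show ?thesis by blast
qed

lemma DT_arr:
  assumes "A \<in> Obj ThMV" "\<sigma> \<in> Hom ThMV A B"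
  shows "DT_spec A B \<sigma> (on_arr DT A B \<sigma>)"
  using theI'[OF DT_spec_unique_exists[OF assms]] by (simp add: DT_def)

lemma DT_arr_eqI:
  assumes "A \<in> Obj ThMV" "\<sigma> \<in> Hom ThMV A B" "DT_spec A B \<sigma> \<tau>"
  shows "on_arr DT A B \<sigma> = \<tau>"
  using DT_spec_unique_exists[OF assms(1,2)] DT_arr[OF assms(1,2)] assms(3) by blast

lemma DT_arr_square:
  assumes "(X, I) \<in> Obj ThMV" "\<sigma> \<in> Hom ThMV (X, I) (Y, J)" "u \<in> carrier (MV X)"
  shows "on_arr DT (X, I) (Y, J) \<sigma> (iota X u) = iota Y (\<sigma> u)"
  using DT_arr[OF assms(1,2)] assms(2,3) iota_square[of \<sigma> X Y] by (simp add: DT_spec_simp ThMV_simps)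

lemma DT_arr_hom:
  assumes A: "A \<in> Obj ThMV" and \<sigma>: "\<sigma> \<in> Hom ThMV A B"
  shows "on_arr DT A B \<sigma> \<in> Hom ThDMV' (DT_obj A) (DT_obj B)"
proof -
  obtain X I Y J where AB: "A = (X, I)" "B = (Y, J)" by (cases A; cases B)
  have "\<sigma> (mv_gen X x) \<in> carrier (MV Y)" if "x \<in> X" for x
    using \<sigma> that by (auto simp: AB ThMV_simps intro: mv_hom_closed)
  then show ?thesis
    using DT_arr[OF A \<sigma>] by (auto simp: AB DT_spec_simp DT_obj_simp ThDMV'_simps)
qed

text \<open>Identities and composites in \<open>ThDMV'\<close> satisfy the specification of the
  required image, so the functor laws follow from its uniqueness.\<close>

lemma is_functor_DT:
  "is_functor (ThMV :: ('v mv_theory, 'v mv_term set \<Rightarrow> 'v mv_term set) cat) ThDMV' DT"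
  unfolding is_functor_def
proof (intro conjI ballI category_ThMV category_ThDMV')
  have on_obj: "on_obj DT = DT_obj" by (simp add: DT_def)
  fix A assume A: "A \<in> Obj (ThMV :: ('v mv_theory, 'v mv_term set \<Rightarrow> 'v mv_term set) cat)"
  obtain X I where XI: "A = (X, I)" by (cases A)
  have fg: "fin_gen_ideal (MV X) I" using A by (simp add: XI ThMV_simps)
  show "on_obj DT A \<in> Obj ThDMV'"
    using fin_gen_DMV_iota[OF fg] by (simp add: on_obj XI DT_obj_simp ThDMV'_simps)
  show "on_arr DT A A (Id ThMV A) = Id ThDMV' (on_obj DT A)"
  proof (rule DT_arr_eqI[OF A])
    show "Id ThMV A \<in> Hom ThMV A A" using category_ThMV A unfolding category_def by blast
    have "ideal_gen (DMV X) (iota X ` I) \<subseteq> carrier (DMV X)"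
      by (rule fin_gen_ideal_sub[OF mv_algebra_DMV fin_gen_DMV_iota[OF fg]])
    then show "DT_spec A A (Id ThMV A) (Id ThDMV' (on_obj DT A))"
      using dmv_hom_id[OF dmv_algebra_DMV, of X]
      by (auto simp: on_obj XI DT_obj_simp DT_spec_simp ThMV_simps ThDMV'_simps iota_gen)
  qed
  fix B \<sigma> assume "\<sigma> \<in> Hom ThMV A B"
  with A show "on_arr DT A B \<sigma> \<in> Hom ThDMV' (on_obj DT A) (on_obj DT B)"
    unfolding on_obj by (rule DT_arr_hom)
next
  have on_obj: "on_obj DT = DT_obj" by (simp add: DT_def)
  fix A B C :: "'v mv_theory" and \<sigma> \<tau> :: "'v mv_term set \<Rightarrow> 'v mv_term set"
  obtain X I Y J Z K where ABC: "A = (X, I)" "B = (Y, J)" "C = (Z, K)"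
    by (cases A; cases B; cases C)
  assume A: "A \<in> Obj ThMV" and B: "B \<in> Obj ThMV" and C: "C \<in> Obj ThMV"
    and \<sigma>: "\<sigma> \<in> Hom ThMV A B" and \<tau>: "\<tau> \<in> Hom ThMV B C"
  show "on_arr DT A C (Comp ThMV A B C \<tau> \<sigma>) =
      Comp ThDMV' (on_obj DT A) (on_obj DT B) (on_obj DT C) (on_arr DT B C \<tau>) (on_arr DT A B \<sigma>)"
  proof (rule DT_arr_eqI[OF A])
    show "Comp ThMV A B C \<tau> \<sigma> \<in> Hom ThMV A C"
      using category_ThMV A B C \<sigma> \<tau> unfolding category_def by blast
    let ?s = "on_arr DT A B \<sigma>" and ?t = "on_arr DT B C \<tau>"
    have s: "DT_spec A B \<sigma> ?s" and t: "DT_spec B C \<tau> ?t" using DT_arr A B \<sigma> \<tau> by blast+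
    have I: "ideal_gen (DMV X) (iota X ` I) \<subseteq> carrier (DMV X)"
      using A fin_gen_ideal_sub(2)[OF mv_algebra_DMV fin_gen_DMV_iota, of X I] by (simp add: ABC ThMV_simps)
    have "\<sigma> (mv_gen X x) \<in> carrier (MV Y)" if "x \<in> X" for x
      using \<sigma> that by (auto simp: ABC ThMV_simps intro: mv_hom_closed)
    then have gen: "?t (iota Y (\<sigma> (mv_gen X x))) = iota Z (\<tau> (\<sigma> (mv_gen X x)))" if "x \<in> X" for x
      using DT_arr_square[of Y J \<tau> Z K "\<sigma> (mv_gen X x)"] B \<tau> that by (simp add: ABC)
    have "compose (carrier (DMV X)) ?t ?s \<in> dmv_hom (DMV X) (DMV Z)"
    proof (rule dmv_hom_compose[OF dmv_algebra_DMV])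
      show "?s \<in> dmv_hom (DMV X) (DMV Y)" "?t \<in> dmv_hom (DMV Y) (DMV Z)"
        using s t by (simp_all add: ABC DT_spec_simp)
    qed
    moreover have "compose (carrier (DMV X)) ?t ?s ` ideal_gen (DMV X) (iota X ` I) \<subseteq>
        ideal_gen (DMV Z) (iota Z ` K)"
      using s t I by (auto simp: ABC DT_spec_simp compose_def image_subset_iff)
    ultimately show "DT_spec A C (Comp ThMV A B C \<tau> \<sigma>)
        (Comp ThDMV' (on_obj DT A) (on_obj DT B) (on_obj DT C) ?t ?s)"
      using s gen by (simp add: on_obj ABC DT_obj_simp DT_spec_simp ThMV_simps ThDMV'_simps compose_def)
  qed
qed

lemma bij_betw_DT_obj:
  "bij_betw DT_obj (Obj (ThMV :: ('v mv_theory, 'v mv_term set \<Rightarrow> 'v mv_term set) cat)) (Obj ThDMV')"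
proof (rule bij_betw_imageI)
  show "inj_on DT_obj (Obj (ThMV :: ('v mv_theory, 'v mv_term set \<Rightarrow> 'v mv_term set) cat))"
  proof (rule inj_onI)
    fix A B :: "'v mv_theory"
    assume A: "A \<in> Obj ThMV" and B: "B \<in> Obj ThMV" and eq: "DT_obj A = DT_obj B"
    obtain X I J where AB: "A = (X, I)" "B = (X, J)"
      using eq by (cases A; cases B) (simp add: DT_obj_simp)
    then have I: "mv_ideal (MV X) I" "I \<subseteq> carrier (MV X)" and J: "mv_ideal (MV X) J" "J \<subseteq> carrier (MV X)"
      using A B by (auto simp: ThMV_simps dest: fin_gen_ideal_sub[OF mv_algebra_MV])
    have "u \<in> I \<longleftrightarrow> u \<in> J" if "u \<in> carrier (MV X)" for u
      using iota_in_ideal_gen_iff[OF I(1) that] iota_in_ideal_gen_iff[OF J(1) that] eq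
      by (simp add: AB DT_obj_simp)
    then show "A = B" using I J AB by blast
  qed
  show "DT_obj ` Obj (ThMV :: ('v mv_theory, 'v mv_term set \<Rightarrow> 'v mv_term set) cat) = Obj ThDMV'"
  proof (intro equalityI subsetI)
    fix B :: "'v dmv_theory" assume "B \<in> DT_obj ` Obj ThMV"
    then show "B \<in> Obj ThDMV'" by (auto simp: ThMV_simps ThDMV'_simps DT_obj_simp fin_gen_DMV_iota)
  next
    fix B :: "'v dmv_theory" assume B: "B \<in> Obj ThDMV'"
    obtain X J where XJ: "B = (X, J)" by (cases B)
    then obtain I where "fin_gen_ideal (MV X) I" "J = ideal_gen (DMV X) (iota X ` I)"
      using fin_gen_DMV_from_MV B by (auto simp: ThDMV'_simps)
    then show "B \<in> DT_obj ` Obj ThMV"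
      by (intro image_eqI[of _ _ "(X, I)"]) (simp_all add: XJ ThMV_simps DT_obj_simp)
  qed
qed

text \<open>The square with the embeddings determines \<open>\<sigma>\<close> since
  \<open>iota Y\<close> is injective. Conversely an arrow lifts to an MV-homomorphism, which maps
  \<open>I\<close> into \<open>J\<close> because elements of \<open>J\<close> are recognised in the
  generated ideal.\<close>

lemma bij_betw_DT_arr:
  assumes A: "A \<in> Obj ThMV" and B: "B \<in> Obj ThMV"
  shows "bij_betw (on_arr DT A B) (Hom ThMV A B) (Hom ThDMV' (DT_obj A) (DT_obj B))"
proof (rule bij_betw_imageI)
  obtain X I Y J where AB: "A = (X, I)" "B = (Y, J)" by (cases A; cases B)
  have I: "mv_ideal (MV X) I" "I \<subseteq> carrier (MV X)" and J: "mv_ideal (MV Y) J"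
    using A B by (auto simp: AB ThMV_simps dest: fin_gen_ideal_sub[OF mv_algebra_MV])
  show "inj_on (on_arr DT A B) (Hom ThMV A B)"
  proof (rule inj_onI)
    fix \<sigma> \<tau> assume \<sigma>: "\<sigma> \<in> Hom ThMV A B" and \<tau>: "\<tau> \<in> Hom ThMV A B"
      and eq: "on_arr DT A B \<sigma> = on_arr DT A B \<tau>"
    have hom: "\<sigma> \<in> mv_hom (MV X) (MV Y)" "\<tau> \<in> mv_hom (MV X) (MV Y)"
      using \<sigma> \<tau> by (simp_all add: AB ThMV_simps)
    show "\<sigma> = \<tau>"
    proof (rule mv_hom_ext[OF hom])
      fix u assume u: "u \<in> carrier (MV X)"
      have "iota Y (\<sigma> u) = iota Y (\<tau> u)"
        using DT_arr_square[of X I \<sigma> Y J u] DT_arr_square[of X I \<tau> Y J u] A \<sigma> \<tau> eq u by (simp add: AB)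
      then show "\<sigma> u = \<tau> u"
        using inj_onD[OF inj_on_iota] mv_hom_closed[OF hom(1) u] mv_hom_closed[OF hom(2) u] by blast
    qed
  qed
  show "on_arr DT A B ` Hom ThMV A B = Hom ThDMV' (DT_obj A) (DT_obj B)"
  proof (intro equalityI subsetI)
    fix \<tau> assume "\<tau> \<in> on_arr DT A B ` Hom ThMV A B"
    then show "\<tau> \<in> Hom ThDMV' (DT_obj A) (DT_obj B)" using DT_arr_hom[OF A] by blast
  next
    fix \<tau> assume "\<tau> \<in> Hom ThDMV' (DT_obj A) (DT_obj B)"
    then have \<tau>: "\<tau> \<in> dmv_hom (DMV X) (DMV Y)"
        "\<tau> ` ideal_gen (DMV X) (iota X ` I) \<subseteq> ideal_gen (DMV Y) (iota Y ` J)"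
      and gen: "\<And>x. x \<in> X \<Longrightarrow> \<tau> (dmv_gen X x) \<in> iota Y ` carrier (MV Y)"
      by (simp_all add: AB DT_obj_simp ThDMV'_simps)
    obtain \<sigma> where \<sigma>: "\<sigma> \<in> mv_hom (MV X) (MV Y)"
      "\<And>x. x \<in> X \<Longrightarrow> \<tau> (dmv_gen X x) = iota Y (\<sigma> (mv_gen X x))"
      "\<And>u. u \<in> carrier (MV X) \<Longrightarrow> \<tau> (iota X u) = iota Y (\<sigma> u)"
      by (rule MV_hom_lift[OF \<tau>(1) gen]) blast+
    have "\<sigma> u \<in> J" if u: "u \<in> I" for u
    proof -
      have uX: "u \<in> carrier (MV X)" using u I by blast
      have "iota X u \<in> ideal_gen (DMV X) (iota X ` I)" using iota_in_ideal_gen_iff[OF I(1) uX] u by simp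
      then have "iota Y (\<sigma> u) \<in> ideal_gen (DMV Y) (iota Y ` J)" using \<tau>(2) \<sigma>(3)[OF uX] by force
      then show ?thesis using iota_in_ideal_gen_iff[OF J mv_hom_closed[OF \<sigma>(1) uX]] by simp
    qed
    then have hom: "\<sigma> \<in> Hom ThMV A B" using \<sigma>(1) by (auto simp: AB ThMV_simps)
    have "DT_spec A B \<sigma> \<tau>" using \<tau> \<sigma>(2) by (simp add: AB DT_spec_simp)
    from DT_arr_eqI[OF A hom this] hom
    show "\<tau> \<in> on_arr DT A B ` Hom ThMV A B" by blast
  qed
qed

theorem theorem3p15:
  shows "(\<forall>A\<in>Obj (ThMV :: ('v mv_theory, 'v mv_term set \<Rightarrow> 'v mv_term set) cat).
           \<forall>B\<in>Obj ThMV. \<forall>\<sigma>\<in>Hom ThMV A B. \<exists>!\<sigma>D. DT_spec A B \<sigma> \<sigma>D) \<and>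
         is_functor (ThMV :: ('v mv_theory, 'v mv_term set \<Rightarrow> 'v mv_term set) cat) ThDMV' DT \<and>
         is_equivalence (ThMV :: ('v mv_theory, 'v mv_term set \<Rightarrow> 'v mv_term set) cat) ThDMV' DT"
proof (intro conjI ballI is_functor_DT is_equivalence_bijective)
  have on_obj: "on_obj DT = DT_obj" by (simp add: DT_def)
  fix A B :: "'v mv_theory"
  show "bij_betw (on_obj DT) (Obj ThMV) (Obj (ThDMV' :: ('v dmv_theory, 'v dmv_term set \<Rightarrow> 'v dmv_term set) cat))"
    unfolding on_obj by (rule bij_betw_DT_obj)
  assume A: "A \<in> Obj ThMV" and B: "B \<in> Obj ThMV"
  then show "bij_betw (on_arr DT A B) (Hom ThMV A B) (Hom ThDMV' (on_obj DT A) (on_obj DT B))"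
    unfolding on_obj by (rule bij_betw_DT_arr)
  fix \<sigma> assume "\<sigma> \<in> Hom ThMV A B"
  with A show "\<exists>!\<sigma>D. DT_spec A B \<sigma> \<sigma>D" by (rule DT_spec_unique_exists)
qed

end
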